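(* Let $\mathcal C$ be an essentially small category, $T$ the class of sieves on objects of $\mathcal C$, $S$ the class of presheaves on $\mathcal C$, and $$F_R:(\mathcal P(T),\subseteq)\to(\mathcal P(S),\supseteq),\qquad G_R:(\mathcal P(S),\supseteq)\to(\mathcal P(T),\subseteq)$$ the adjoint pair defined by the duality relation $R\subseteq T\times S$ between sieves and presheaves (see context). Then: (i) For every collection $J$ of sieves on $\mathcal C$, the image $\overline J=G_R\circ F_R(J)$ is the topology of $\mathcal C$ generated by $J$, i.e. the smallest topology of $\mathcal C$ containing $J$, and the subclass $F_R(J)=F_R(\overline J)$ consists of the presheaves on $\mathcal C$ which are sheaves for the topology $\overline J$. (ii) For every collection $I$ of presheaves on $\mathcal C$, the image $\overline I=F_R\circ G_R(I)$ is the subclass of presheaves which are objects of the smallest subtopos of $\widehat{\mathcal C}$ containing the elements of $I$, and this subtopos is defined by the topology $G_R(I)=G_R(\overline I)$.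
   Context: $\widehat{\mathcal C}=[\mathcal C^{\rm op},{\rm Set}]$, $y$ is the Yoneda embedding, and a sieve on $X$ is a sub-presheaf $C\hookrightarrow y(X)$. $\mathcal P(\cdot)$ denotes the collection of subclasses. The relation $R\subseteq T\times S$ consists of the pairs $(C\hookrightarrow y(X),P)$ such that, for every morphism $x:X'\to X$ of $\mathcal C$, the restriction map $P(X')={\rm Hom}(y(X'),P)\to{\rm Hom}(C\times_{y(X)}y(X'),P)$ is a bijection. One sets $$F_R(J)=\{s\in S\mid(t,s)\in R\ \forall t\in J\},\qquad G_R(I)=\{t\in T\mid(t,s)\in R\ \forall s\in I\}.$$ A topology is a Grothendieck topology, viewed as the class of its covering sieves. A subtopos of $\widehat{\mathcal C}$ is here a full subcategory $j_*:\mathcal E\hookrightarrow\widehat{\mathcal C}$ whose embedding has a left adjoint $j^*$ preserving finite limits and such that $P$ belongs to $\mathcal E$ iff $P\to j_*j^*P$ is an isomorphism; a topology $J$ defines the subtopos $\widehat{\mathcal C}_J$ of $J$-sheaves. *)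

theory Defs
  imports Main "HOL-Library.FuncSet"
begin

unbundle cardinal_syntax

section \<open>Categories\<close>

text \<open>\<open>Comp C g f\<close> is the composite "g after f".\<close>

record ('o, 'm) cat =
  Obj :: "'o set"
  Mor :: "'m set"
  Dom :: "'m \<Rightarrow> 'o"
  Cod :: "'m \<Rightarrow> 'o"
  Id :: "'o \<Rightarrow> 'm"
  Comp :: "'m \<Rightarrow> 'm \<Rightarrow> 'm"

definition hom :: "('o, 'm) cat \<Rightarrow> 'o \<Rightarrow> 'o \<Rightarrow> 'm set" where
  "hom C X Y = {f \<in> Mor C. Dom C f = X \<and> Cod C f = Y}"

locale category =
  fixes C :: "('o, 'm) cat"
  assumes Dom_in: "f \<in> Mor C \<Longrightarrow> Dom C f \<in> Obj C"
    and Cod_in: "f \<in> Mor C \<Longrightarrow> Cod C f \<in> Obj C"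
    and Id_in: "X \<in> Obj C \<Longrightarrow> Id C X \<in> hom C X X"
    and Comp_in: "f \<in> hom C X Y \<Longrightarrow> g \<in> hom C Y Z \<Longrightarrow> Comp C g f \<in> hom C X Z"
    and Comp_Id_right: "f \<in> hom C X Y \<Longrightarrow> Comp C f (Id C X) = f"
    and Comp_Id_left: "f \<in> hom C X Y \<Longrightarrow> Comp C (Id C Y) f = f"
    and Comp_assoc: "f \<in> hom C X Y \<Longrightarrow> g \<in> hom C Y Z \<Longrightarrow> h \<in> hom C Z W \<Longrightarrow>
      Comp C h (Comp C g f) = Comp C (Comp C h g) f"

definition is_iso :: "('o, 'm) cat \<Rightarrow> 'm \<Rightarrow> bool" where
  "is_iso C f \<longleftrightarrow> f \<in> Mor C \<and>
    (\<exists>g \<in> hom C (Cod C f) (Dom C f).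
      Comp C g f = Id C (Dom C f) \<and> Comp C f g = Id C (Cod C f))"

record ('o, 'm, 'p, 'n) func =
  FOb :: "'o \<Rightarrow> 'p"
  FMor :: "'m \<Rightarrow> 'n"

definition is_functor :: "('o, 'm) cat \<Rightarrow> ('p, 'n) cat \<Rightarrow> ('o, 'm, 'p, 'n) func \<Rightarrow> bool" where
  "is_functor A B F \<longleftrightarrow>
    (\<forall>X \<in> Obj A. FOb F X \<in> Obj B) \<and>
    (\<forall>f \<in> Mor A. FMor F f \<in> hom B (FOb F (Dom A f)) (FOb F (Cod A f))) \<and>
    (\<forall>X \<in> Obj A. FMor F (Id A X) = Id B (FOb F X)) \<and>
    (\<forall>f \<in> Mor A. \<forall>g \<in> Mor A. Cod A f = Dom A g \<longrightarrow>
      FMor F (Comp A g f) = Comp B (FMor F g) (FMor F f))"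

definition id_func :: "('o, 'm, 'o, 'm) func" where
  "id_func = \<lparr>FOb = (\<lambda>X. X), FMor = (\<lambda>f. f)\<rparr>"

definition comp_func ::
  "('p, 'n, 'q, 'k) func \<Rightarrow> ('o, 'm, 'p, 'n) func \<Rightarrow> ('o, 'm, 'q, 'k) func" where
  "comp_func G F = \<lparr>FOb = FOb G \<circ> FOb F, FMor = FMor G \<circ> FMor F\<rparr>"

definition natural ::
  "('o, 'm) cat \<Rightarrow> ('p, 'n) cat \<Rightarrow> ('o, 'm, 'p, 'n) func \<Rightarrow> ('o, 'm, 'p, 'n) func \<Rightarrow>
    ('o \<Rightarrow> 'n) \<Rightarrow> bool" where
  "natural A B F G \<eta> \<longleftrightarrow>
    (\<forall>X \<in> Obj A. \<eta> X \<in> hom B (FOb F X) (FOb G X)) \<and>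
    (\<forall>f \<in> Mor A. Comp B (\<eta> (Cod A f)) (FMor F f) = Comp B (FMor G f) (\<eta> (Dom A f)))"

definition natural_iso ::
  "('o, 'm) cat \<Rightarrow> ('p, 'n) cat \<Rightarrow> ('o, 'm, 'p, 'n) func \<Rightarrow> ('o, 'm, 'p, 'n) func \<Rightarrow>
    ('o \<Rightarrow> 'n) \<Rightarrow> bool" where
  "natural_iso A B F G \<eta> \<longleftrightarrow> natural A B F G \<eta> \<and> (\<forall>X \<in> Obj A. is_iso B (\<eta> X))"

definition equivalent_cats :: "('o, 'm) cat \<Rightarrow> ('p, 'n) cat \<Rightarrow> bool" where
  "equivalent_cats A B \<longleftrightarrow> (\<exists>F G \<eta> \<epsilon>. is_functor A B F \<and> is_functor B A G \<and>
    natural_iso A A id_func (comp_func G F) \<eta> \<and>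
    natural_iso B B (comp_func F G) id_func \<epsilon>)"

text \<open>\<open>F\<close> is left adjoint to \<open>G\<close>, with unit \<open>\<eta>\<close>.\<close>

definition adjunction ::
  "('o, 'm) cat \<Rightarrow> ('p, 'n) cat \<Rightarrow> ('o, 'm, 'p, 'n) func \<Rightarrow> ('p, 'n, 'o, 'm) func \<Rightarrow>
    ('o \<Rightarrow> 'm) \<Rightarrow> bool" where
  "adjunction A B F G \<eta> \<longleftrightarrow> is_functor A B F \<and> is_functor B A G \<and>
    natural A A id_func (comp_func G F) \<eta> \<and>
    (\<forall>X \<in> Obj A. \<forall>Y \<in> Obj B.
      bij_betw (\<lambda>g. Comp A (FMor G g) (\<eta> X)) (hom B (FOb F X) Y) (hom A X (FOb G Y)))"

definition is_cone ::
  "('o, 'm) cat \<Rightarrow> ('i, 'j) cat \<Rightarrow> ('i, 'j, 'o, 'm) func \<Rightarrow> 'o \<Rightarrow> ('i \<Rightarrow> 'm) \<Rightarrow> bool" where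
  "is_cone A K D L \<pi> \<longleftrightarrow> L \<in> Obj A \<and>
    (\<forall>i \<in> Obj K. \<pi> i \<in> hom A L (FOb D i)) \<and>
    (\<forall>k \<in> Mor K. Comp A (FMor D k) (\<pi> (Dom K k)) = \<pi> (Cod K k))"

definition is_limit ::
  "('o, 'm) cat \<Rightarrow> ('i, 'j) cat \<Rightarrow> ('i, 'j, 'o, 'm) func \<Rightarrow> 'o \<Rightarrow> ('i \<Rightarrow> 'm) \<Rightarrow> bool" where
  "is_limit A K D L \<pi> \<longleftrightarrow> is_cone A K D L \<pi> \<and>
    (\<forall>M \<rho>. is_cone A K D M \<rho> \<longrightarrow>
      (\<exists>!u. u \<in> hom A M L \<and> (\<forall>i \<in> Obj K. Comp A (\<pi> i) u = \<rho> i)))"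

text \<open>Every finite category is isomorphic to one whose objects and morphisms are natural
  numbers, so the index categories are taken of that form.\<close>

definition preserves_finite_limits ::
  "('o, 'm) cat \<Rightarrow> ('p, 'n) cat \<Rightarrow> ('o, 'm, 'p, 'n) func \<Rightarrow> bool" where
  "preserves_finite_limits A B F \<longleftrightarrow>
    (\<forall>(K :: (nat, nat) cat) D L \<pi>.
      category K \<and> finite (Obj K) \<and> finite (Mor K) \<and> is_functor K A D \<and> is_limit A K D L \<pi> \<longrightarrow>
      is_limit B K (comp_func F D) (FOb F L) (\<lambda>i. FMor F (\<pi> i)))"

definition full_subcat :: "('o, 'm) cat \<Rightarrow> 'o set \<Rightarrow> ('o, 'm) cat" where
  "full_subcat A E = A\<lparr>Obj := E, Mor := {f \<in> Mor A. Dom A f \<in> E \<and> Cod A f \<in> E}\<rparr>"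

section \<open>The universe of sets\<close>

text \<open>Size is measured by a universe in the sense of Grothendieck, presented by a type \<open>'u\<close>
  whose cardinality is a regular strong limit: a set (of any type) is small when it has fewer
  elements than \<open>'u\<close>, and the category Set is that of the small subsets of \<open>'u\<close> and all maps
  between them.  It contains a copy of every small set.  Objects and morphisms of the base category,
  and classes of sieves or presheaves, are not subject to any size bound.  Uncountability is not
  needed and not imposed, so \<open>'u = nat\<close> with the finite sets is admitted as well.\<close>

definition set_universe :: "'u itself \<Rightarrow> bool" where
  "set_universe _ \<longleftrightarrow> infinite (UNIV :: 'u set) \<and> regularCard |UNIV :: 'u set| \<and>
    (\<forall>A :: 'u set. |A| <o |UNIV :: 'u set| \<longrightarrow> |Pow A| <o |UNIV :: 'u set| )"

definition essentially_small :: "'u itself \<Rightarrow> ('o, 'm) cat \<Rightarrow> bool" where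
  "essentially_small _ C \<longleftrightarrow> (\<exists>D :: ('u, 'u) cat. category D \<and>
    |Obj D| <o |UNIV :: 'u set| \<and> |Mor D| <o |UNIV :: 'u set| \<and> equivalent_cats C D)"

section \<open>Presheaves\<close>

text \<open>Values and actions are extensional (fixed to \<open>undefined\<close> outside their domains), so that
  equality of the representing data is equality of presheaves and of natural transformations.
  The value type is left free: representable presheaves and sieves take values in sets of
  morphisms, the objects of the presheaf category in small sets of the universe.\<close>

record ('o, 'm, 'a) presheaf =
  At :: "'o \<Rightarrow> 'a set"
  Act :: "'m \<Rightarrow> 'a \<Rightarrow> 'a"

definition is_presheaf :: "('o, 'm) cat \<Rightarrow> ('o, 'm, 'a) presheaf \<Rightarrow> bool" where
  "is_presheaf C P \<longleftrightarrow>
    At P \<in> extensional (Obj C) \<and>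
    Act P \<in> (\<Pi>\<^sub>E f \<in> Mor C. At P (Cod C f) \<rightarrow>\<^sub>E At P (Dom C f)) \<and>
    (\<forall>X \<in> Obj C. \<forall>s \<in> At P X. Act P (Id C X) s = s) \<and>
    (\<forall>f \<in> Mor C. \<forall>g \<in> Mor C. Cod C f = Dom C g \<longrightarrow>
      (\<forall>s \<in> At P (Cod C g). Act P (Comp C g f) s = Act P f (Act P g s)))"

definition nat_trans ::
  "('o, 'm) cat \<Rightarrow> ('o, 'm, 'a) presheaf \<Rightarrow> ('o, 'm, 'b) presheaf \<Rightarrow> ('o \<Rightarrow> 'a \<Rightarrow> 'b) set" where
  "nat_trans C P Q = {\<alpha> \<in> (\<Pi>\<^sub>E X \<in> Obj C. At P X \<rightarrow>\<^sub>E At Q X).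
    \<forall>f \<in> Mor C. \<forall>s \<in> At P (Cod C f).
      \<alpha> (Dom C f) (Act P f s) = Act Q f (\<alpha> (Cod C f) s)}"

text \<open>The class \<open>S\<close> of presheaves of (small) sets.\<close>

definition presheaves :: "('o, 'm) cat \<Rightarrow> ('o, 'm, 'u) presheaf set" where
  "presheaves C = {P. is_presheaf C P \<and> (\<forall>X \<in> Obj C. |At P X| <o |UNIV :: 'u set| )}"

text \<open>A morphism of presheaves is a triple consisting of source, target and components.\<close>

definition psh_cat :: "('o, 'm) cat \<Rightarrow>
  (('o, 'm, 'u) presheaf,
   ('o, 'm, 'u) presheaf \<times> ('o, 'm, 'u) presheaf \<times> ('o \<Rightarrow> 'u \<Rightarrow> 'u)) cat" where
  "psh_cat C =
    \<lparr>Obj = presheaves C,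
     Mor = {(P, Q, \<alpha>). P \<in> presheaves C \<and> Q \<in> presheaves C \<and> \<alpha> \<in> nat_trans C P Q},
     Dom = (\<lambda>(P, Q, \<alpha>). P),
     Cod = (\<lambda>(P, Q, \<alpha>). Q),
     Id = (\<lambda>P. (P, P, \<lambda>X \<in> Obj C. \<lambda>s \<in> At P X. s)),
     Comp = (\<lambda>(Q', R, \<beta>) (P, Q, \<alpha>). (P, R, \<lambda>X \<in> Obj C. \<lambda>s \<in> At P X. \<beta> X (\<alpha> X s)))\<rparr>"

definition yoneda :: "('o, 'm) cat \<Rightarrow> 'o \<Rightarrow> ('o, 'm, 'm) presheaf" where
  "yoneda C X =
    \<lparr>At = (\<lambda>Y \<in> Obj C. hom C Y X),
     Act = (\<lambda>f \<in> Mor C. \<lambda>g \<in> hom C (Cod C f) X. Comp C g f)\<rparr>"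

section \<open>Sieves and the duality relation\<close>

definition subpresheaf ::
  "('o, 'm) cat \<Rightarrow> ('o, 'm, 'a) presheaf \<Rightarrow> ('o, 'm, 'a) presheaf \<Rightarrow> bool" where
  "subpresheaf C K P \<longleftrightarrow> is_presheaf C K \<and>
    (\<forall>X \<in> Obj C. At K X \<subseteq> At P X) \<and>
    (\<forall>f \<in> Mor C. \<forall>s \<in> At K (Cod C f). Act K f s = Act P f s)"

type_synonym ('o, 'm) sieve = "'o \<times> ('o, 'm, 'm) presheaf"

definition sieves :: "('o, 'm) cat \<Rightarrow> ('o, 'm) sieve set" where
  "sieves C = {(X, K). X \<in> Obj C \<and> subpresheaf C K (yoneda C X)}"

text \<open>For a sieve \<open>K\<close> on the codomain of \<open>x : X' \<rightarrow> X\<close>, the fibre product of \<open>K\<close> and \<open>y(X')\<close> over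
  \<open>y(X)\<close>, as a sub-presheaf of \<open>y(X')\<close>: its second projection is injective, the first component of
  a pair being determined by the second.\<close>

definition sieve_pullback ::
  "('o, 'm) cat \<Rightarrow> 'm \<Rightarrow> ('o, 'm, 'm) presheaf \<Rightarrow> ('o, 'm, 'm) presheaf" where
  "sieve_pullback C x K =
    (let B = (\<lambda>Y. {g \<in> hom C Y (Dom C x). Comp C x g \<in> At K Y}) in
    \<lparr>At = (\<lambda>Y \<in> Obj C. B Y),
     Act = (\<lambda>f \<in> Mor C. \<lambda>g \<in> B (Cod C f). Comp C g f)\<rparr>)"

text \<open>The Yoneda bijection from \<open>P(X)\<close> to \<open>Hom(y(X), P)\<close>, and restriction of a natural
  transformation along the inclusion of a sub-presheaf \<open>K\<close>.\<close>

definition yoneda_map ::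
  "('o, 'm) cat \<Rightarrow> ('o, 'm, 'a) presheaf \<Rightarrow> 'o \<Rightarrow> 'a \<Rightarrow> ('o \<Rightarrow> 'm \<Rightarrow> 'a)" where
  "yoneda_map C P X s = (\<lambda>Y \<in> Obj C. \<lambda>f \<in> hom C Y X. Act P f s)"

definition restrict_trans ::
  "('o, 'm) cat \<Rightarrow> ('o, 'm, 'b) presheaf \<Rightarrow> ('o \<Rightarrow> 'b \<Rightarrow> 'a) \<Rightarrow> ('o \<Rightarrow> 'b \<Rightarrow> 'a)" where
  "restrict_trans C K \<alpha> = (\<lambda>Y \<in> Obj C. \<lambda>s \<in> At K Y. \<alpha> Y s)"

text \<open>The sheaf condition of \<open>P\<close> at a single sieve \<open>K\<close> on \<open>X\<close>: the restriction map from
  \<open>P(X) = Hom(y(X), P)\<close> to \<open>Hom(K, P)\<close> is a bijection.\<close>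

definition restriction_bij ::
  "('o, 'm) cat \<Rightarrow> ('o, 'm, 'a) presheaf \<Rightarrow> 'o \<Rightarrow> ('o, 'm, 'm) presheaf \<Rightarrow> bool" where
  "restriction_bij C P X K \<longleftrightarrow>
    bij_betw (\<lambda>s. restrict_trans C K (yoneda_map C P X s)) (At P X) (nat_trans C K P)"

definition duality_rel :: "('o, 'm) cat \<Rightarrow> (('o, 'm) sieve \<times> ('o, 'm, 'u) presheaf) set" where
  "duality_rel C = {((X, K), P). (X, K) \<in> sieves C \<and> P \<in> presheaves C \<and>
    (\<forall>x \<in> Mor C. Cod C x = X \<longrightarrow> restriction_bij C P (Dom C x) (sieve_pullback C x K))}"

definition F_R :: "('o, 'm) cat \<Rightarrow> ('o, 'm) sieve set \<Rightarrow> ('o, 'm, 'u) presheaf set" where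
  "F_R C J = {s \<in> presheaves C. \<forall>t \<in> J. (t, s) \<in> duality_rel C}"

definition G_R :: "('o, 'm) cat \<Rightarrow> ('o, 'm, 'u) presheaf set \<Rightarrow> ('o, 'm) sieve set" where
  "G_R C I = {t \<in> sieves C. \<forall>s \<in> I. (t, s) \<in> duality_rel C}"

section \<open>Topologies, sheaves and subtoposes\<close>

definition grothendieck_topology :: "('o, 'm) cat \<Rightarrow> ('o, 'm) sieve set \<Rightarrow> bool" where
  "grothendieck_topology C J \<longleftrightarrow> J \<subseteq> sieves C \<and>
    (\<forall>X \<in> Obj C. (X, yoneda C X) \<in> J) \<and>
    (\<forall>X K. (X, K) \<in> J \<longrightarrow>
      (\<forall>x \<in> Mor C. Cod C x = X \<longrightarrow> (Dom C x, sieve_pullback C x K) \<in> J)) \<and>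
    (\<forall>X K L. (X, K) \<in> J \<and> (X, L) \<in> sieves C \<and>
      (\<forall>Y \<in> Obj C. \<forall>x \<in> At K Y. (Y, sieve_pullback C x L) \<in> J) \<longrightarrow> (X, L) \<in> J)"

definition smallest_topology ::
  "('o, 'm) cat \<Rightarrow> ('o, 'm) sieve set \<Rightarrow> ('o, 'm) sieve set \<Rightarrow> bool" where
  "smallest_topology C J K \<longleftrightarrow> grothendieck_topology C K \<and> J \<subseteq> K \<and>
    (\<forall>K'. grothendieck_topology C K' \<and> J \<subseteq> K' \<longrightarrow> K \<subseteq> K')"

definition sheaves :: "('o, 'm) cat \<Rightarrow> ('o, 'm) sieve set \<Rightarrow> ('o, 'm, 'u) presheaf set" where
  "sheaves C J = {P \<in> presheaves C. \<forall>(X, K) \<in> J. restriction_bij C P X K}"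

text \<open>A subtopos is given by its class \<open>E\<close> of objects; \<open>L\<close> is the left adjoint of the embedding and
  the unit \<open>\<eta>\<close> is the canonical morphism from a presheaf to its reflection.\<close>

definition subtopos :: "('o, 'm) cat \<Rightarrow> ('o, 'm, 'u) presheaf set \<Rightarrow> bool" where
  "subtopos C E \<longleftrightarrow> E \<subseteq> presheaves C \<and>
    (\<exists>L \<eta>. adjunction (psh_cat C) (full_subcat (psh_cat C) E) L id_func \<eta> \<and>
      preserves_finite_limits (psh_cat C) (full_subcat (psh_cat C) E) L \<and>
      (\<forall>P \<in> presheaves C. P \<in> E \<longleftrightarrow> is_iso (psh_cat C) (\<eta> P)))"

definition smallest_subtopos ::
  "('o, 'm) cat \<Rightarrow> ('o, 'm, 'u) presheaf set \<Rightarrow> ('o, 'm, 'u) presheaf set \<Rightarrow> bool" where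
  "smallest_subtopos C I E \<longleftrightarrow> subtopos C E \<and> I \<subseteq> E \<and>
    (\<forall>E'. subtopos C E' \<and> I \<subseteq> E' \<longrightarrow> E \<subseteq> E')"

end

theory Submission
  imports Defs
begin

text \<open>The maps \<open>F_R\<close> and \<open>G_R\<close> are the two halves of a Galois connection, so the closures in the
  theorem are determined once it is known which classes of sieves and which classes of presheaves are
  closed.  The answer is: the topologies, and the subtoposes.

  Every class \<open>G_R I\<close> is a topology because the universal sheaf condition for a fixed presheaf is
  transitive: a compatible family on a sieve is glued over the members of another sieve first and over
  that sieve afterwards (\<open>sheaf_on_trans\<close>).  For a topology \<open>J\<close> the class \<open>F_R J\<close> is the class of
  \<open>J\<close>-sheaves, since coverings are stable under pullback.

  That a topology \<open>J\<close> is closed means that a sieve \<open>S\<close> on \<open>X\<close> covers as soon as every \<open>J\<close>-sheaf is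
  separated for it.  Glue two copies of the representable presheaf of \<open>X\<close> along \<open>S\<close> and take the
  associated sheaf.  The two generic elements agree on \<open>S\<close>, hence are equal in the sheaf, hence
  agree locally in the glued presheaf; and they agree exactly along the members of \<open>S\<close>
  (\<open>covers_if_sheaves_separated\<close>).

  That the sheaves for a topology form a subtopos requires a left exact associated sheaf functor.
  It is constructed in one step.  A section over \<open>X\<close> is the set of all pairs \<open>(f, s)\<close> such that
  \<open>s\<close> represents the section along \<open>f\<close>; over a fixed \<open>X\<close> such sets never contain one
  another properly, so equations between sections, and with them functoriality and the preservation of
  finite limits, are reduced to inclusions (\<open>section_eqI\<close>, \<open>sheafify_pointwise_limit\<close>).

  Conversely let \<open>E\<close> be a subtopos with reflector \<open>L\<close> and let \<open>P\<close> be a sheaf for \<open>G_R E\<close>.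
  The unit from \<open>P\<close> to \<open>L P\<close> is inverted by \<open>L\<close>.  By left exactness the pullbacks of an inverted
  morphism are inverted; therefore so are the diagonal of the kernel pair of the unit and the inclusion
  of its image, and so are the pullbacks of these two monomorphisms along points, which are inclusions of
  sieves.  An inverted inclusion of a sieve is orthogonal to the objects of \<open>E\<close>, so these sieves
  belong to \<open>G_R E\<close>.  Both \<open>P\<close> and \<open>L P\<close> are sheaves for them, which makes the unit injective and
  surjective, and \<open>P\<close> belongs to \<open>E\<close> (\<open>dual_sheaf_in\<close>).

  The auxiliary presheaves take values in various types.  Essential smallness of the base category
  bounds these values, and \<open>shrink\<close> replaces them by subsets of the universe.\<close>

section \<open>Categories and reflective subcategories\<close>

context category
begin

lemma Comp_Mor [simp]:
  assumes "f \<in> Mor C" "g \<in> Mor C" "Cod C f = Dom C g"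
  shows "Comp C g f \<in> Mor C" "Dom C (Comp C g f) = Dom C f" "Cod C (Comp C g f) = Cod C g"
  using Comp_in[of f "Dom C f" "Cod C f" g "Cod C g"] assms by (auto simp: hom_def)

lemma Comp_assoc_Mor [simp]:
  assumes "f \<in> Mor C" "g \<in> Mor C" "h \<in> Mor C" "Cod C f = Dom C g" "Cod C g = Dom C h"
  shows "Comp C (Comp C h g) f = Comp C h (Comp C g f)"
  using Comp_assoc[of f "Dom C f" "Cod C f" g "Cod C g" h "Cod C h"] assms by (auto simp: hom_def)

lemma Id_Mor [simp]:
  assumes "X \<in> Obj C"
  shows "Id C X \<in> Mor C" "Dom C (Id C X) = X" "Cod C (Id C X) = X"
  using Id_in[OF assms] by (auto simp: hom_def)

lemma Comp_Id_Mor [simp]: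
  assumes "f \<in> Mor C"
  shows "Dom C f = X \<Longrightarrow> Comp C f (Id C X) = f" "Cod C f = X \<Longrightarrow> Comp C (Id C X) f = f"
  using Comp_Id_right[of f "Dom C f" "Cod C f"] Comp_Id_left[of f "Dom C f" "Cod C f"] assms
  by (auto simp: hom_def)

lemma Dom_Cod_Obj [simp]:
  assumes "f \<in> Mor C"
  shows "Dom C f \<in> Obj C" "Cod C f \<in> Obj C"
  using assms Dom_in Cod_in by auto

lemma is_isoE:
  assumes "is_iso C f"
  obtains g where "f \<in> Mor C" "g \<in> Mor C" "Dom C g = Cod C f" "Cod C g = Dom C f"
    "Comp C g f = Id C (Dom C f)" "Comp C f g = Id C (Cod C f)"
  using assms by (auto simp: is_iso_def hom_def)

lemma is_isoI:
  assumes "f \<in> Mor C" "g \<in> Mor C" "Dom C g = Cod C f" "Cod C g = Dom C f"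
    "Comp C g f = Id C (Dom C f)" "Comp C f g = Id C (Cod C f)"
  shows "is_iso C f"
  using assms by (auto simp: is_iso_def hom_def)

lemma is_iso_cancel_left:
  assumes "is_iso C g" "f \<in> Mor C" "Cod C f = Dom C g" "is_iso C (Comp C g f)"
  shows "is_iso C f"
proof -
  obtain g' where g: "g \<in> Mor C" "g' \<in> Mor C" "Dom C g' = Cod C g" "Cod C g' = Dom C g"
    "Comp C g' g = Id C (Dom C g)" "Comp C g g' = Id C (Cod C g)"
    using assms(1) by (rule is_isoE)
  obtain h where h: "h \<in> Mor C" "Dom C h = Cod C g" "Cod C h = Dom C f"
    "Comp C h (Comp C g f) = Id C (Dom C f)" "Comp C (Comp C g f) h = Id C (Cod C g)"
    using assms(4) by (rule is_isoE) (use g assms in auto)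
  show ?thesis
  proof (rule is_isoI)
    show "Comp C (Comp C h g) f = Id C (Dom C f)"
      using g h assms by simp
    have "Comp C g (Comp C f h) = Id C (Cod C g)" using g h assms by simp
    then have "Comp C g' (Comp C g (Comp C f h)) = g'" using g by simp
    moreover have "Comp C g' (Comp C g (Comp C f h)) = Comp C (Comp C g' g) (Comp C f h)"
      by (rule Comp_assoc_Mor[symmetric]) (use g h assms in auto)
    ultimately have "Comp C f h = g'" using g(5) h assms by simp
    then have "Comp C (Comp C f h) g = Id C (Cod C f)" using g assms by simp
    then show "Comp C f (Comp C h g) = Id C (Cod C f)" using g h assms by simp
  qed (use g h assms in auto)
qed

lemma is_iso_cancel_right:
  assumes "is_iso C f" "g \<in> Mor C" "Cod C f = Dom C g" "is_iso C (Comp C g f)"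
  shows "is_iso C g"
proof -
  obtain f' where f: "f \<in> Mor C" "f' \<in> Mor C" "Dom C f' = Cod C f" "Cod C f' = Dom C f"
    "Comp C f' f = Id C (Dom C f)" "Comp C f f' = Id C (Cod C f)"
    using assms(1) by (rule is_isoE)
  obtain h where h: "h \<in> Mor C" "Dom C h = Cod C g" "Cod C h = Dom C f"
    "Comp C h (Comp C g f) = Id C (Dom C f)" "Comp C (Comp C g f) h = Id C (Cod C g)"
    using assms(4) by (rule is_isoE) (use f assms in auto)
  show ?thesis
  proof (rule is_isoI)
    show "Comp C g (Comp C f h) = Id C (Cod C g)"
      using f h assms by simp
    have "Comp C (Comp C h g) f = Id C (Dom C f)" using f h assms by simp
    then have "Comp C (Comp C (Comp C h g) f) f' = f'" using f by simp
    moreover have "Comp C (Comp C (Comp C h g) f) f' = Comp C (Comp C h g) (Comp C f f')"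
      by (rule Comp_assoc_Mor) (use f h assms in auto)
    ultimately have "Comp C h g = f'" using f(6) h assms by simp
    then have "Comp C f (Comp C h g) = Id C (Cod C f)" using f assms by simp
    then show "Comp C (Comp C f h) g = Id C (Dom C g)" using f h assms by simp
  qed (use f h assms in auto)
qed

lemma is_iso_Id: "X \<in> Obj C \<Longrightarrow> is_iso C (Id C X)"
  by (rule is_isoI[where g = "Id C X"]) auto

end

lemma full_subcat_simps [simp]:
  "Obj (full_subcat A E) = E"
  "Mor (full_subcat A E) = {f \<in> Mor A. Dom A f \<in> E \<and> Cod A f \<in> E}"
  "Dom (full_subcat A E) = Dom A" "Cod (full_subcat A E) = Cod A"
  "Id (full_subcat A E) = Id A" "Comp (full_subcat A E) = Comp A"
  by (auto simp: full_subcat_def)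

lemma hom_full_subcat [simp]:
  "X \<in> E \<Longrightarrow> Y \<in> E \<Longrightarrow> hom (full_subcat A E) X Y = hom A X Y"
  by (auto simp: hom_def)

lemma hom_full_subcat_iff:
  "f \<in> hom (full_subcat A E) X Y \<longleftrightarrow> f \<in> hom A X Y \<and> X \<in> E \<and> Y \<in> E"
  by (auto simp: hom_def)

lemma category_full_subcat:
  assumes "category A" "E \<subseteq> Obj A"
  shows "category (full_subcat A E)"
proof -
  interpret category A by fact
  show ?thesis
    using assms(2) by unfold_locales (auto simp: hom_def)
qed

lemma is_iso_full_subcat:
  "is_iso (full_subcat A E) f \<longleftrightarrow> is_iso A f \<and> Dom A f \<in> E \<and> Cod A f \<in> E"
  by (auto simp: is_iso_def)

text \<open>The shape 0 \<rightarrow> 2 \<leftarrow> 1, its two arrows being numbered 3 and 4; each identity carries the number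
  of its object.\<close>

definition cospan :: "(nat, nat) cat" where
  "cospan = \<lparr>Obj = {0, 1, 2}, Mor = {0, 1, 2, 3, 4},
     Dom = (\<lambda>k. if k = 3 then 0 else if k = 4 then 1 else k),
     Cod = (\<lambda>k. if k \<ge> 3 then 2 else k),
     Id = (\<lambda>i. i),
     Comp = (\<lambda>g f. if g \<ge> 3 then g else f)\<rparr>"

definition cospan_func :: "('o, 'm) cat \<Rightarrow> 'm \<Rightarrow> 'm \<Rightarrow> (nat, nat, 'o, 'm) func" where
  "cospan_func A f g = \<lparr>
     FOb = (\<lambda>i. if i = 0 then Dom A f else if i = 1 then Dom A g else Cod A g),
     FMor = (\<lambda>k. if k = 0 then Id A (Dom A f) else if k = 1 then Id A (Dom A g)
       else if k = 2 then Id A (Cod A g) else if k = 3 then f else g)\<rparr>"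

definition cospan_cone :: "('o, 'm) cat \<Rightarrow> 'm \<Rightarrow> 'm \<Rightarrow> 'm \<Rightarrow> nat \<Rightarrow> 'm" where
  "cospan_cone A f p q = (\<lambda>i. if i = 0 then p else if i = 1 then q else Comp A f p)"

lemma category_cospan: "category cospan"
  by unfold_locales (auto simp: cospan_def hom_def split: if_splits)

lemma finite_cospan: "finite (Obj cospan)" "finite (Mor cospan)"
  by (auto simp: cospan_def)

lemma (in category) functor_cospan_func:
  assumes "f \<in> Mor C" "g \<in> Mor C" "Cod C f = Cod C g"
  shows "is_functor cospan C (cospan_func C f g)"
  using assms by (auto simp: is_functor_def cospan_func_def cospan_def hom_def)

text \<open>A section of the projection opposite to an isomorphism comes from the cone with vertex
  \<open>FOb D 1\<close>, and uniqueness of factorisations makes it a two-sided inverse.  The square is given as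
  a limit over the cospan because that is the form in which a limit preserving functor delivers it.\<close>

lemma (in category) iso_pullback:
  assumes D: "is_functor cospan C D" and lim: "is_limit C cospan D P \<pi>"
    and iso: "is_iso C (FMor D 3)"
  shows "is_iso C (\<pi> 1)"
proof -
  have D3: "FMor D 3 \<in> Mor C" "Dom C (FMor D 3) = FOb D 0" "Cod C (FMor D 3) = FOb D 2"
    and D4: "FMor D 4 \<in> Mor C" "Dom C (FMor D 4) = FOb D 1" "Cod C (FMor D 4) = FOb D 2"
    and DO: "FOb D 0 \<in> Obj C" "FOb D 1 \<in> Obj C" "FOb D 2 \<in> Obj C"
    and DI: "FMor D 0 = Id C (FOb D 0)" "FMor D 1 = Id C (FOb D 1)" "FMor D 2 = Id C (FOb D 2)"
    using D by (auto simp: is_functor_def cospan_def hom_def)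
  obtain h where h: "h \<in> Mor C" "Dom C h = FOb D 2" "Cod C h = FOb D 0"
    "Comp C h (FMor D 3) = Id C (FOb D 0)" "Comp C (FMor D 3) h = Id C (FOb D 2)"
    using iso by (rule is_isoE) (use D3 in auto)
  have cone: "P \<in> Obj C" "\<pi> 0 \<in> Mor C" "Dom C (\<pi> 0) = P" "Cod C (\<pi> 0) = FOb D 0"
    "\<pi> 1 \<in> Mor C" "Dom C (\<pi> 1) = P" "Cod C (\<pi> 1) = FOb D 1"
    "\<pi> 2 \<in> Mor C" "Dom C (\<pi> 2) = P" "Cod C (\<pi> 2) = FOb D 2"
    "Comp C (FMor D 3) (\<pi> 0) = \<pi> 2" "Comp C (FMor D 4) (\<pi> 1) = \<pi> 2"
    using lim by (auto simp: is_limit_def is_cone_def cospan_def hom_def)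
  have univ: "is_cone C cospan D M \<rho> \<Longrightarrow>
      \<exists>!u. u \<in> hom C M P \<and> (\<forall>i \<in> Obj cospan. Comp C (\<pi> i) u = \<rho> i)" for M \<rho>
    using lim by (auto simp: is_limit_def)
  define \<rho> where "\<rho> = (\<lambda>i::nat. if i = 0 then Comp C h (FMor D 4)
    else if i = 1 then Id C (FOb D 1) else FMor D 4)"
  have "Comp C (FMor D 3) (Comp C h (FMor D 4)) = FMor D 4"
  proof -
    have "Comp C (FMor D 3) (Comp C h (FMor D 4)) = Comp C (Comp C (FMor D 3) h) (FMor D 4)"
      using D3 D4 h(1-3) by simp
    then show ?thesis using D4 h DO by simp
  qed
  then have "is_cone C cospan D (FOb D 1) \<rho>"
    using D3 D4 h DO DI by (auto simp: is_cone_def \<rho>_def cospan_def hom_def)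
  from univ[OF this] obtain u where u: "u \<in> Mor C" "Dom C u = FOb D 1" "Cod C u = P"
    "Comp C (\<pi> 0) u = Comp C h (FMor D 4)" "Comp C (\<pi> 1) u = Id C (FOb D 1)"
    by (auto simp: \<rho>_def cospan_def hom_def)
  have "is_cone C cospan D P \<pi>" using lim by (simp add: is_limit_def)
  from univ[OF this] have uniq: "\<And>v w. v \<in> hom C P P \<Longrightarrow> w \<in> hom C P P \<Longrightarrow>
     (\<forall>i \<in> Obj cospan. Comp C (\<pi> i) v = \<pi> i) \<Longrightarrow> (\<forall>i \<in> Obj cospan. Comp C (\<pi> i) w = \<pi> i) \<Longrightarrow> v = w"
    by blast
  have e0: "Comp C (\<pi> 0) (Comp C u (\<pi> 1)) = \<pi> 0"
  proof -
    have "Comp C (\<pi> 0) (Comp C u (\<pi> 1)) = Comp C (Comp C (\<pi> 0) u) (\<pi> 1)"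
      using cone(1-10) u(1-3) by simp
    also have "\<dots> = Comp C h (Comp C (FMor D 4) (\<pi> 1))" using cone u h D4 by simp
    also have "\<dots> = Comp C h (Comp C (FMor D 3) (\<pi> 0))" using cone by simp
    also have "\<dots> = Comp C (Comp C h (FMor D 3)) (\<pi> 0)"
      using cone(1-10) h(1-3) D3 by simp
    finally show ?thesis using h cone by simp
  qed
  have e1: "Comp C (\<pi> 1) (Comp C u (\<pi> 1)) = \<pi> 1"
  proof -
    have "Comp C (\<pi> 1) (Comp C u (\<pi> 1)) = Comp C (Comp C (\<pi> 1) u) (\<pi> 1)"
      using cone(1-10) u(1-3) by simp
    then show ?thesis using u cone by simp
  qed
  have e2: "Comp C (\<pi> 2) (Comp C u (\<pi> 1)) = \<pi> 2"
  proof -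
    have "Comp C (\<pi> 2) (Comp C u (\<pi> 1)) = Comp C (Comp C (FMor D 3) (\<pi> 0)) (Comp C u (\<pi> 1))"
      using cone by simp
    also have "\<dots> = Comp C (FMor D 3) (Comp C (\<pi> 0) (Comp C u (\<pi> 1)))"
      using cone(1-10) u(1-3) D3 by simp
    finally show ?thesis using cone e0 by simp
  qed
  have "Comp C u (\<pi> 1) = Id C P"
    by (rule uniq) (use e0 e1 e2 cone u in \<open>auto simp: cospan_def hom_def\<close>)
  then show ?thesis
    using u cone by (intro is_isoI[where g = u]) auto
qed

text \<open>The data of a subtopos before left exactness is imposed.  The morphisms inverted by the reflector
  carry all the information that is needed to compare the subcategory with a class of sheaves.\<close>

locale reflection = category A for A :: "('o, 'm) cat" +
  fixes E :: "'o set" and L :: "('o, 'm, 'o, 'm) func" and \<eta> :: "'o \<Rightarrow> 'm"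
  assumes E_Obj: "E \<subseteq> Obj A"
    and adj: "adjunction A (full_subcat A E) L id_func \<eta>"
    and unit_iso: "\<And>P. P \<in> Obj A \<Longrightarrow> P \<in> E \<longleftrightarrow> is_iso A (\<eta> P)"
begin

definition inverted :: "'m \<Rightarrow> bool" where
  "inverted f \<longleftrightarrow> f \<in> Mor A \<and> is_iso A (FMor L f)"

lemma L_functor: "is_functor A (full_subcat A E) L"
  using adj by (simp add: adjunction_def)

lemma L_Obj: "X \<in> Obj A \<Longrightarrow> FOb L X \<in> E" "X \<in> Obj A \<Longrightarrow> FOb L X \<in> Obj A"
  using L_functor E_Obj by (auto simp: is_functor_def)

lemma L_Mor:
  assumes "f \<in> Mor A"
  shows "FMor L f \<in> Mor A" "Dom A (FMor L f) = FOb L (Dom A f)" "Cod A (FMor L f) = FOb L (Cod A f)"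
  using L_functor assms by (auto simp: is_functor_def hom_def)

lemma L_Comp:
  assumes "f \<in> Mor A" "g \<in> Mor A" "Cod A f = Dom A g"
  shows "FMor L (Comp A g f) = Comp A (FMor L g) (FMor L f)"
  using L_functor assms by (auto simp: is_functor_def)

lemma L_Id: "X \<in> Obj A \<Longrightarrow> FMor L (Id A X) = Id A (FOb L X)"
  using L_functor by (auto simp: is_functor_def)

lemma unit_Mor:
  assumes "X \<in> Obj A"
  shows "\<eta> X \<in> Mor A" "Dom A (\<eta> X) = X" "Cod A (\<eta> X) = FOb L X"
  using adj assms by (auto simp: adjunction_def natural_def id_func_def comp_func_def hom_def)

lemma unit_natural:
  assumes "f \<in> Mor A"
  shows "Comp A (\<eta> (Cod A f)) f = Comp A (FMor L f) (\<eta> (Dom A f))"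
  using adj assms by (auto simp: adjunction_def natural_def id_func_def comp_func_def)

lemma unit_bij:
  assumes "X \<in> Obj A" "Y \<in> E"
  shows "bij_betw (\<lambda>g. Comp A g (\<eta> X)) (hom A (FOb L X) Y) (hom A X Y)"
  using adj assms L_Obj(1)[OF assms(1)]
  by (auto simp: adjunction_def id_func_def)

lemma unit_cancel:
  assumes "X \<in> Obj A" "Y \<in> E" "g \<in> hom A (FOb L X) Y" "h \<in> hom A (FOb L X) Y"
    "Comp A g (\<eta> X) = Comp A h (\<eta> X)"
  shows "g = h"
  using unit_bij[OF assms(1,2)] assms(3-) by (auto simp: bij_betw_def inj_on_def)

lemma unit_factor:
  assumes "X \<in> Obj A" "Y \<in> E" "g \<in> hom A X Y"
  obtains h where "h \<in> hom A (FOb L X) Y" "g = Comp A h (\<eta> X)"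
proof -
  have "g \<in> (\<lambda>g. Comp A g (\<eta> X)) ` hom A (FOb L X) Y"
    using unit_bij[OF assms(1,2)] assms(3) by (simp add: bij_betw_def)
  then show ?thesis using that by blast
qed

text \<open>Naturality of the unit at its own component identifies \<open>L (\<eta> X)\<close> with the unit at
  \<open>L X\<close>, which is invertible because \<open>L X\<close> lies in the subcategory.\<close>

lemma inverted_unit:
  assumes "X \<in> Obj A"
  shows "inverted (\<eta> X)"
proof -
  note [simp] = unit_Mor[OF assms] L_Obj[OF assms] L_Mor
  have "Comp A (\<eta> (FOb L X)) (\<eta> X) = Comp A (FMor L (\<eta> X)) (\<eta> X)"
    using unit_natural[of "\<eta> X"] by simp
  then have "\<eta> (FOb L X) = FMor L (\<eta> X)"
    by (rule unit_cancel[OF assms L_Obj(1)[of "FOb L X"], rotated -1])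
      (use assms unit_Mor[of "FOb L X"] in \<open>auto simp: hom_def\<close>)
  then show ?thesis
    using unit_iso[of "FOb L X"] by (simp add: inverted_def)
qed

lemma inverted_cancel_left:
  assumes "inverted g" "f \<in> Mor A" "Cod A f = Dom A g" "inverted (Comp A g f)"
  shows "inverted f"
  using assms is_iso_cancel_left[of "FMor L g" "FMor L f"]
  by (auto simp: inverted_def L_Comp L_Mor)

lemma inverted_cancel_right:
  assumes "inverted f" "g \<in> Mor A" "Cod A f = Dom A g" "inverted (Comp A g f)"
  shows "inverted g"
  using assms is_iso_cancel_right[of "FMor L f" "FMor L g"]
  by (auto simp: inverted_def L_Comp L_Mor)

lemma inverted_Id: "X \<in> Obj A \<Longrightarrow> inverted (Id A X)"
  by (simp add: inverted_def L_Id is_iso_Id L_Obj)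

text \<open>The adjunction turns maps into \<open>Y\<close> into maps out of the reflections, and there precomposition is
  with the isomorphism \<open>L m\<close>.\<close>

lemma inverted_orthogonal:
  assumes "inverted m" "Y \<in> E"
  shows "bij_betw (\<lambda>h. Comp A h m) (hom A (Cod A m) Y) (hom A (Dom A m) Y)"
proof -
  have m: "m \<in> Mor A" and iso: "is_iso A (FMor L m)" using assms by (auto simp: inverted_def)
  have O: "Dom A m \<in> Obj A" "Cod A m \<in> Obj A" using m by auto
  have Y: "Y \<in> Obj A" using assms E_Obj by auto
  obtain n where n: "n \<in> Mor A" "Dom A n = FOb L (Cod A m)" "Cod A n = FOb L (Dom A m)"
    "Comp A n (FMor L m) = Id A (FOb L (Dom A m))" "Comp A (FMor L m) n = Id A (FOb L (Cod A m))"
    using iso by (rule is_isoE) (use m L_Mor in auto)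
  note [simp] = L_Mor[OF m] unit_Mor[OF O(1)] unit_Mor[OF O(2)] L_Obj O m Y n(1-3)
  have precomp: "Comp A (Comp A h (\<eta> (Cod A m))) m = Comp A (Comp A h (FMor L m)) (\<eta> (Dom A m))"
    if "h \<in> hom A (FOb L (Cod A m)) Y" for h
    using that unit_natural[OF m] by (auto simp: hom_def)
  show ?thesis
    unfolding bij_betw_def
  proof (intro conjI inj_onI equalityI subsetI)
    fix h k assume h: "h \<in> hom A (Cod A m) Y" and k: "k \<in> hom A (Cod A m) Y"
      and eq: "Comp A h m = Comp A k m"
    obtain h' where h': "h' \<in> hom A (FOb L (Cod A m)) Y" "h = Comp A h' (\<eta> (Cod A m))"
      by (rule unit_factor[OF O(2) assms(2) h])
    obtain k' where k': "k' \<in> hom A (FOb L (Cod A m)) Y" "k = Comp A k' (\<eta> (Cod A m))"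
      by (rule unit_factor[OF O(2) assms(2) k])
    have "Comp A h' (FMor L m) = Comp A k' (FMor L m)"
      by (rule unit_cancel[OF O(1) assms(2)]) (use eq h' k' precomp in \<open>auto simp: hom_def\<close>)
    then have "Comp A (Comp A h' (FMor L m)) n = Comp A (Comp A k' (FMor L m)) n" by simp
    then have "h' = k'" using h' k' n by (auto simp: hom_def)
    then show "h = k" using h' k' by simp
  next
    fix h assume "h \<in> (\<lambda>h. Comp A h m) ` hom A (Cod A m) Y"
    then show "h \<in> hom A (Dom A m) Y" by (auto simp: hom_def)
  next
    fix k assume k: "k \<in> hom A (Dom A m) Y"
    obtain k' where k': "k' \<in> hom A (FOb L (Dom A m)) Y" "k = Comp A k' (\<eta> (Dom A m))"
      by (rule unit_factor[OF O(1) assms(2) k])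
    define h where "h = Comp A k' n"
    have h: "h \<in> hom A (FOb L (Cod A m)) Y" using k' by (auto simp: h_def hom_def)
    have "Comp A h (FMor L m) = k'"
      using k' n by (auto simp: h_def hom_def)
    then have "k = Comp A (Comp A h (\<eta> (Cod A m))) m"
      using precomp[OF h] k' by simp
    moreover have "Comp A h (\<eta> (Cod A m)) \<in> hom A (Cod A m) Y" using h by (auto simp: hom_def)
    ultimately show "k \<in> (\<lambda>h. Comp A h m) ` hom A (Cod A m) Y" by (rule image_eqI)
  qed
qed

text \<open>Left exactness of the reflector is used only here.\<close>

lemma inverted_pullback:
  assumes lex: "preserves_finite_limits A (full_subcat A E) L"
    and f: "inverted f" "g \<in> Mor A" "Cod A f = Cod A g"
    and pb: "is_limit A cospan (cospan_func A f g) P (cospan_cone A f p q)"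
  shows "inverted q"
proof -
  interpret E: category "full_subcat A E"
    by (rule category_full_subcat) (use E_Obj category_axioms in auto)
  have fm: "f \<in> Mor A" using f by (simp add: inverted_def)
  have D: "is_functor cospan A (cospan_func A f g)"
    using functor_cospan_func[OF fm f(2,3)] .
  then have D': "is_functor cospan (full_subcat A E) (comp_func L (cospan_func A f g))"
    using L_functor category.Dom_Cod_Obj[OF category_cospan]
    by (auto simp: is_functor_def comp_func_def hom_def)
  have "q \<in> Mor A"
    using pb by (auto simp: is_limit_def is_cone_def cospan_cone_def cospan_def hom_def)
  moreover have "is_iso (full_subcat A E) (FMor L q)"
  proof -
    have lim: "is_limit (full_subcat A E) cospan (comp_func L (cospan_func A f g)) (FOb L P)
      (\<lambda>i. FMor L (cospan_cone A f p q i))"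
      using lex D pb finite_cospan category_cospan unfolding preserves_finite_limits_def by blast
    have "is_iso (full_subcat A E) (FMor (comp_func L (cospan_func A f g)) 3)"
      using f L_Mor[OF fm] L_Obj fm
      by (auto simp: comp_func_def cospan_func_def inverted_def is_iso_full_subcat)
    from E.iso_pullback[OF D' lim this] show ?thesis by (simp add: cospan_cone_def)
  qed
  ultimately show ?thesis by (simp add: inverted_def is_iso_full_subcat)
qed

end

section \<open>Small sets\<close>

definition small :: "'u itself \<Rightarrow> 'a set \<Rightarrow> bool" where
  "small _ A \<longleftrightarrow> |A| <o |UNIV :: 'u set|"

lemma small_inj:
  assumes "small U B" "inj_on f A" "f ` A \<subseteq> B"
  shows "small U A"
proof -
  have "|A| \<le>o |B|" using assms(2,3) card_of_ordLeq by blast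
  then show ?thesis using assms(1) ordLeq_ordLess_trans by (auto simp: small_def)
qed

lemma small_subset: "small U B \<Longrightarrow> A \<subseteq> B \<Longrightarrow> small U A"
  by (rule small_inj[where f = id and B = B]) auto

lemma small_image: "small U A \<Longrightarrow> small U (f ` A)"
  using card_of_image[of f A] ordLeq_ordLess_trans by (auto simp: small_def)

lemma small_finite:
  fixes U :: "'u itself"
  assumes "set_universe U" "finite A"
  shows "small U A"
  using assms finite_ordLess_infinite[of "|A|" "|UNIV :: 'u set|"]
    card_of_Well_order[of A] card_of_Well_order[of "UNIV :: 'u set"]
  by (auto simp: small_def set_universe_def Field_card_of)

lemma small_UN:
  fixes U :: "'u itself"
  assumes "set_universe U" "small U I" "\<And>i. i \<in> I \<Longrightarrow> small U (F i)"
  shows "small U (\<Union>i\<in>I. F i)"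
proof -
  have "stable |UNIV :: 'u set|"
    using assms(1) card_of_Card_order
    by (intro regularCard_stable) (auto simp: set_universe_def Field_card_of)
  then show ?thesis using assms stable_UNION by (auto simp: small_def)
qed

lemma small_Times:
  assumes "set_universe U" "small U A" "small U B"
  shows "small U (A \<times> B)"
proof -
  have "small U (\<Union>a\<in>A. Pair a ` B)"
    using assms by (intro small_UN small_image)
  moreover have "A \<times> B = (\<Union>a\<in>A. Pair a ` B)" by auto
  ultimately show ?thesis by simp
qed

lemma small_Pow:
  fixes U :: "'u itself"
  assumes "set_universe U" "small U A"
  shows "small U (Pow A)"
proof -
  have "|A| \<le>o |UNIV :: 'u set|"
    using assms(2) ordLess_imp_ordLeq by (auto simp: small_def)
  then obtain f :: "'a \<Rightarrow> 'u" where f: "inj_on f A"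
    using card_of_ordLeq[of A "UNIV :: 'u set"] by auto
  have "small U (Pow (f ` A))"
    using assms small_image[OF assms(2), of f] by (auto simp: small_def set_universe_def)
  moreover have "inj_on (image f) (Pow A)" using f by (rule inj_on_image_Pow)
  ultimately show ?thesis by (rule small_inj) auto
qed

text \<open>An essentially small category need not have a set of objects, but homs are small and a small
  set of objects meets every isomorphism class; this is what bounds the values of the presheaves
  built below.\<close>

locale small_category = category C for C :: "('o, 'm) cat" +
  fixes U :: "'u itself"
  assumes universe: "set_universe U"
    and hom_small: "\<And>X Y. X \<in> Obj C \<Longrightarrow> Y \<in> Obj C \<Longrightarrow> small U (hom C X Y)"
    and representatives: "\<exists>A. A \<subseteq> Obj C \<and> small U A \<and>
      (\<forall>Y \<in> Obj C. \<exists>e. is_iso C e \<and> Dom C e \<in> A \<and> Cod C e = Y)"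

lemma essentially_small_category:
  fixes C :: "('o, 'm) cat" and U :: "'u itself"
  assumes "set_universe U" "category C" "essentially_small U C"
  shows "small_category C U"
proof -
  interpret category C by fact
  obtain D :: "('u, 'u) cat" and F G \<eta> \<epsilon> where D: "category D"
      "small U (Obj D)" "small U (Mor D)"
    and F: "is_functor C D F" and G: "is_functor D C G"
    and \<eta>: "natural_iso C C id_func (comp_func G F) \<eta>"
    using assms(3) unfolding essentially_small_def equivalent_cats_def small_def by blast
  have \<eta>': "\<eta> X \<in> Mor C" "Dom C (\<eta> X) = X" "Cod C (\<eta> X) = FOb G (FOb F X)" "is_iso C (\<eta> X)"
    if "X \<in> Obj C" for X
    using that \<eta> by (auto simp: natural_iso_def natural_def id_func_def comp_func_def hom_def)
  show ?thesis
  proof (intro small_category.intro small_category_axioms.intro)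
    fix X Y assume X: "X \<in> Obj C" and Y: "Y \<in> Obj C"
    obtain y where y: "y \<in> Mor C" "Dom C y = FOb G (FOb F Y)" "Cod C y = Y"
      "Comp C y (\<eta> Y) = Id C Y"
      using \<eta>'(4)[OF Y] by (rule is_isoE) (use \<eta>'[OF Y] in auto)
    have "f = Comp C y (Comp C (FMor G (FMor F f)) (\<eta> X))" if "f \<in> hom C X Y" for f
    proof -
      have f: "f \<in> Mor C" "Dom C f = X" "Cod C f = Y" using that by (auto simp: hom_def)
      have "Comp C (FMor G (FMor F f)) (\<eta> X) = Comp C (\<eta> Y) f"
        using \<eta> f by (auto simp: natural_iso_def natural_def id_func_def comp_func_def)
      moreover have "Comp C y (Comp C (\<eta> Y) f) = Comp C (Comp C y (\<eta> Y)) f"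
        by (rule Comp_assoc_Mor[symmetric]) (use f y \<eta>'[OF Y] in auto)
      ultimately show ?thesis using y f by simp
    qed
    then have "inj_on (FMor F) (hom C X Y)" by (intro inj_onI) metis
    moreover have "FMor F ` hom C X Y \<subseteq> Mor D"
      using F by (auto simp: is_functor_def hom_def)
    ultimately show "small U (hom C X Y)" using D(3) by (blast intro: small_inj)
  next
    have "\<exists>e. is_iso C e \<and> Dom C e \<in> FOb G ` Obj D \<and> Cod C e = Y" if Y: "Y \<in> Obj C" for Y
    proof -
      obtain y where y: "y \<in> Mor C" "Dom C y = FOb G (FOb F Y)" "Cod C y = Y"
        "Comp C y (\<eta> Y) = Id C Y" "Comp C (\<eta> Y) y = Id C (FOb G (FOb F Y))"
        using \<eta>'(4)[OF Y] by (rule is_isoE) (use \<eta>'[OF Y] in auto)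
      have "is_iso C y" by (rule is_isoI[where g = "\<eta> Y"]) (use y \<eta>'[OF Y] in auto)
      moreover have "FOb F Y \<in> Obj D" using F Y by (auto simp: is_functor_def)
      ultimately show ?thesis using y by blast
    qed
    moreover have "FOb G ` Obj D \<subseteq> Obj C" using G by (auto simp: is_functor_def)
    ultimately show "\<exists>A. A \<subseteq> Obj C \<and> small U A \<and>
      (\<forall>Y \<in> Obj C. \<exists>e. is_iso C e \<and> Dom C e \<in> A \<and> Cod C e = Y)"
      using small_image[OF D(2)] by blast
  qed (use assms category_axioms in auto)
qed

section \<open>Presheaves and natural transformations\<close>

context category
begin

lemma Act_in [simp]:
  assumes "is_presheaf C P" "f \<in> Mor C" "Cod C f = X" "s \<in> At P X"
  shows "Act P f s \<in> At P (Dom C f)"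
  using assms by (fastforce simp: is_presheaf_def)

lemma Act_Id [simp]:
  assumes "is_presheaf C P" "X \<in> Obj C" "s \<in> At P X"
  shows "Act P (Id C X) s = s"
  using assms by (simp add: is_presheaf_def)

lemma Act_Act [simp]:
  assumes "is_presheaf C P" "f \<in> Mor C" "g \<in> Mor C" "Cod C f = Dom C g" "s \<in> At P (Cod C g)"
  shows "Act P f (Act P g s) = Act P (Comp C g f) s"
  using assms by (simp add: is_presheaf_def)

end

definition ext_trans ::
  "('o, 'm) cat \<Rightarrow> ('o, 'm, 'a) presheaf \<Rightarrow> ('o \<Rightarrow> 'a \<Rightarrow> 'b) \<Rightarrow> ('o \<Rightarrow> 'a \<Rightarrow> 'b)" where
  "ext_trans C P \<phi> = (\<lambda>X \<in> Obj C. \<lambda>s \<in> At P X. \<phi> X s)"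

lemma ext_trans_apply [simp]: "X \<in> Obj C \<Longrightarrow> s \<in> At P X \<Longrightarrow> ext_trans C P \<phi> X s = \<phi> X s"
  by (simp add: ext_trans_def)

lemma ext_trans_cong:
  assumes "\<And>X s. X \<in> Obj C \<Longrightarrow> s \<in> At P X \<Longrightarrow> \<phi> X s = \<psi> X s"
  shows "ext_trans C P \<phi> = ext_trans C P \<psi>"
  using assms by (auto simp: ext_trans_def cong: restrict_cong)

context category
begin

lemma ext_trans_in:
  assumes "\<And>X s. X \<in> Obj C \<Longrightarrow> s \<in> At P X \<Longrightarrow> \<phi> X s \<in> At Q X"
    and "\<And>f s. f \<in> Mor C \<Longrightarrow> s \<in> At P (Cod C f) \<Longrightarrow>
      \<phi> (Dom C f) (Act P f s) = Act Q f (\<phi> (Cod C f) s)"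
    and "is_presheaf C P"
  shows "ext_trans C P \<phi> \<in> nat_trans C P Q"
  using assms by (auto simp: nat_trans_def ext_trans_def)

lemma nat_trans_in:
  "\<alpha> \<in> nat_trans C P Q \<Longrightarrow> X \<in> Obj C \<Longrightarrow> s \<in> At P X \<Longrightarrow> \<alpha> X s \<in> At Q X"
  by (auto simp: nat_trans_def)

lemma nat_trans_natural:
  "\<alpha> \<in> nat_trans C P Q \<Longrightarrow> f \<in> Mor C \<Longrightarrow> s \<in> At P (Cod C f) \<Longrightarrow>
    \<alpha> (Dom C f) (Act P f s) = Act Q f (\<alpha> (Cod C f) s)"
  by (auto simp: nat_trans_def)

lemma nat_trans_eqI:
  assumes "\<alpha> \<in> nat_trans C P Q" "\<beta> \<in> nat_trans C P Q'"
    and "\<And>X s. X \<in> Obj C \<Longrightarrow> s \<in> At P X \<Longrightarrow> \<alpha> X s = \<beta> X s"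
  shows "\<alpha> = \<beta>"
proof (rule extensionalityI[where A = "Obj C"])
  show "\<alpha> \<in> extensional (Obj C)" "\<beta> \<in> extensional (Obj C)"
    using assms(1,2) by (simp_all add: nat_trans_def PiE_iff)
  show "\<alpha> X = \<beta> X" if "X \<in> Obj C" for X
    using assms that
    by (intro extensionalityI[where A = "At P X"]) (auto simp: nat_trans_def PiE_iff)
qed

lemma ext_trans_nat_trans:
  assumes \<alpha>: "\<alpha> \<in> nat_trans C P Q"
  shows "ext_trans C P \<alpha> = \<alpha>"
proof (rule extensionalityI[where A = "Obj C"])
  fix X assume X: "X \<in> Obj C"
  show "ext_trans C P \<alpha> X = \<alpha> X"
    by (rule extensionalityI[where A = "At P X"])
      (use \<alpha> X in \<open>auto simp: ext_trans_def nat_trans_def PiE_iff\<close>)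
qed (use \<alpha> in \<open>auto simp: ext_trans_def nat_trans_def PiE_iff\<close>)

lemma comp_trans_in:
  assumes "\<alpha> \<in> nat_trans C P Q" "\<beta> \<in> nat_trans C Q R" "is_presheaf C P"
  shows "ext_trans C P (\<lambda>X s. \<beta> X (\<alpha> X s)) \<in> nat_trans C P R"
  using nat_trans_in[OF assms(1)] nat_trans_in[OF assms(2)] assms(3)
  by (intro ext_trans_in) (auto simp: nat_trans_natural[OF assms(1)] nat_trans_natural[OF assms(2)])

lemma presheaves_is_presheaf [simp]: "P \<in> presheaves C \<Longrightarrow> is_presheaf C P"
  by (simp add: presheaves_def)

end

section \<open>The category of presheaves\<close>

lemma psh_cat_simps [simp]:
  "Obj (psh_cat C) = presheaves C"
  "(P, Q, \<alpha>) \<in> Mor (psh_cat C) \<longleftrightarrow> P \<in> presheaves C \<and> Q \<in> presheaves C \<and> \<alpha> \<in> nat_trans C P Q"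
  "Dom (psh_cat C) (P, Q, \<alpha>) = P" "Cod (psh_cat C) (P, Q, \<alpha>) = Q"
  "Id (psh_cat C) P = (P, P, ext_trans C P (\<lambda>X s. s))"
  "Comp (psh_cat C) (Q', R, \<beta>) (P, Q, \<alpha>) = (P, R, ext_trans C P (\<lambda>X s. \<beta> X (\<alpha> X s)))"
  by (auto simp: psh_cat_def ext_trans_def)

lemma hom_psh_cat:
  "m \<in> hom (psh_cat C) P Q \<longleftrightarrow>
    P \<in> presheaves C \<and> Q \<in> presheaves C \<and> (\<exists>\<alpha> \<in> nat_trans C P Q. m = (P, Q, \<alpha>))"
  by (cases m) (auto simp: hom_def)

lemma hom_psh_cat_iff [simp]:
  "(P', Q', \<alpha>) \<in> hom (psh_cat C) P Q \<longleftrightarrow>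
    P' = P \<and> Q' = Q \<and> P \<in> presheaves C \<and> Q \<in> presheaves C \<and> \<alpha> \<in> nat_trans C P Q"
  by (auto simp: hom_psh_cat)

lemma Mor_psh_catE:
  assumes "m \<in> Mor (psh_cat C)"
  obtains P Q \<alpha> where "m = (P, Q, \<alpha>)" "P \<in> presheaves C" "Q \<in> presheaves C" "\<alpha> \<in> nat_trans C P Q"
  using assms by (cases m) auto

context category
begin

lemma id_trans_in: "is_presheaf C P \<Longrightarrow> ext_trans C P (\<lambda>X s. s) \<in> nat_trans C P P"
  by (intro ext_trans_in) auto

lemma category_psh_cat: "category (psh_cat C)"
proof
  fix f assume "f \<in> Mor (psh_cat C)"
  then show "Dom (psh_cat C) f \<in> Obj (psh_cat C)" "Cod (psh_cat C) f \<in> Obj (psh_cat C)"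
    by (cases f; simp)+
next
  fix P assume "P \<in> Obj (psh_cat C)"
  then show "Id (psh_cat C) P \<in> hom (psh_cat C) P P" by (simp add: id_trans_in)
next
  fix f P Q assume "f \<in> hom (psh_cat C) P Q"
  then obtain \<alpha> where f: "f = (P, Q, \<alpha>)" "P \<in> presheaves C" "Q \<in> presheaves C"
    "\<alpha> \<in> nat_trans C P Q" by (auto simp: hom_psh_cat)
  have P: "is_presheaf C P" using f by simp
  show "Comp (psh_cat C) f (Id (psh_cat C) P) = f" "Comp (psh_cat C) (Id (psh_cat C) Q) f = f"
    using f comp_trans_in[OF id_trans_in[OF P] f(4) P]
      comp_trans_in[OF f(4) id_trans_in[of Q] P] nat_trans_in[OF f(4)]
    by (auto intro!: nat_trans_eqI)
next
  fix f g P Q R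
  assume f: "f \<in> hom (psh_cat C) P Q" and g: "g \<in> hom (psh_cat C) Q R"
  then obtain \<alpha> \<beta> where fg: "f = (P, Q, \<alpha>)" "g = (Q, R, \<beta>)" "\<alpha> \<in> nat_trans C P Q"
    "\<beta> \<in> nat_trans C Q R" by (auto simp: hom_psh_cat)
  show "Comp (psh_cat C) g f \<in> hom (psh_cat C) P R"
    using f g fg comp_trans_in[OF fg(3,4)] by auto
  fix h S assume h: "h \<in> hom (psh_cat C) R S"
  then obtain \<gamma> where h': "h = (R, S, \<gamma>)" "\<gamma> \<in> nat_trans C R S" by (auto simp: hom_psh_cat)
  have "ext_trans C P (\<lambda>X s. \<gamma> X (ext_trans C P (\<lambda>X s. \<beta> X (\<alpha> X s)) X s)) =
    ext_trans C P (\<lambda>X s. ext_trans C Q (\<lambda>X s. \<gamma> X (\<beta> X s)) X (\<alpha> X s))"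
    using nat_trans_in[OF fg(3)] by (intro ext_trans_cong) auto
  then show "Comp (psh_cat C) h (Comp (psh_cat C) g f) = Comp (psh_cat C) (Comp (psh_cat C) h g) f"
    using fg h' by simp
qed

lemma inverse_trans:
  assumes P: "is_presheaf C P" and Q: "is_presheaf C Q" and \<alpha>: "\<alpha> \<in> nat_trans C P Q"
    and bij: "\<And>X. X \<in> Obj C \<Longrightarrow> bij_betw (\<alpha> X) (At P X) (At Q X)"
  shows "ext_trans C Q (\<lambda>X. inv_into (At P X) (\<alpha> X)) \<in> nat_trans C Q P"
proof (rule ext_trans_in[OF _ _ Q])
  fix X t assume "X \<in> Obj C" "t \<in> At Q X"
  then show "inv_into (At P X) (\<alpha> X) t \<in> At P X"
    using bij by (metis bij_betw_def inv_into_into)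
next
  fix f t assume f: "f \<in> Mor C" and t: "t \<in> At Q (Cod C f)"
  then obtain s where s: "s \<in> At P (Cod C f)" "t = \<alpha> (Cod C f) s"
    using bij[of "Cod C f"] by (auto simp: bij_betw_def)
  have "Act Q f t = \<alpha> (Dom C f) (Act P f s)" using s f nat_trans_natural[OF \<alpha>] by simp
  then show "inv_into (At P (Dom C f)) (\<alpha> (Dom C f)) (Act Q f t) =
      Act P f (inv_into (At P (Cod C f)) (\<alpha> (Cod C f)) t)"
    using s f P bij[of "Cod C f"] bij[of "Dom C f"] by (simp add: bij_betw_def)
qed

lemma is_iso_psh_cat:
  "is_iso (psh_cat C) (P, Q, \<alpha>) \<longleftrightarrow> P \<in> presheaves C \<and> Q \<in> presheaves C \<and>
    \<alpha> \<in> nat_trans C P Q \<and> (\<forall>X \<in> Obj C. bij_betw (\<alpha> X) (At P X) (At Q X))"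
proof (intro iffI conjI ballI)
  assume iso: "is_iso (psh_cat C) (P, Q, \<alpha>)"
  then show PQ: "P \<in> presheaves C" "Q \<in> presheaves C" "\<alpha> \<in> nat_trans C P Q"
    by (auto simp: is_iso_def)
  from iso obtain \<beta> where \<beta>: "\<beta> \<in> nat_trans C Q P"
    and e: "ext_trans C P (\<lambda>X s. \<beta> X (\<alpha> X s)) = ext_trans C P (\<lambda>X s. s)"
      "ext_trans C Q (\<lambda>X s. \<alpha> X (\<beta> X s)) = ext_trans C Q (\<lambda>X s. s)"
    by (auto simp: is_iso_def hom_psh_cat)
  fix X assume X: "X \<in> Obj C"
  have "\<beta> X (\<alpha> X s) = s" if "s \<in> At P X" for s
    using fun_cong[OF fun_cong[OF e(1), of X], of s] X that by simp
  moreover have "\<alpha> X (\<beta> X s) = s" if "s \<in> At Q X" for s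
    using fun_cong[OF fun_cong[OF e(2), of X], of s] X that by simp
  ultimately show "bij_betw (\<alpha> X) (At P X) (At Q X)"
    using X nat_trans_in[OF PQ(3)] nat_trans_in[OF \<beta>]
    by (intro bij_betw_byWitness[where f' = "\<beta> X"]) auto
next
  assume asm: "P \<in> presheaves C \<and> Q \<in> presheaves C \<and>
    \<alpha> \<in> nat_trans C P Q \<and> (\<forall>X \<in> Obj C. bij_betw (\<alpha> X) (At P X) (At Q X))"
  then have \<beta>: "ext_trans C Q (\<lambda>X. inv_into (At P X) (\<alpha> X)) \<in> nat_trans C Q P" (is "?\<beta> \<in> _")
    by (intro inverse_trans) auto
  have 1: "?\<beta> X (\<alpha> X s) = s" if "X \<in> Obj C" "s \<in> At P X" for X s
    using that asm nat_trans_in[of \<alpha> P Q X s] by (auto simp: bij_betw_def)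
  have 2: "\<alpha> X (?\<beta> X s) = s" if "X \<in> Obj C" "s \<in> At Q X" for X s
    using that asm by (auto simp: bij_betw_def f_inv_into_f)
  have P: "is_presheaf C P" and Q: "is_presheaf C Q" using asm by auto
  have "ext_trans C P (\<lambda>X s. ?\<beta> X (\<alpha> X s)) = ext_trans C P (\<lambda>X s. s)"
    using 1 by (intro ext_trans_cong) auto
  moreover have "ext_trans C Q (\<lambda>X s. \<alpha> X (?\<beta> X s)) = ext_trans C Q (\<lambda>X s. s)"
    using 2 by (intro ext_trans_cong) auto
  ultimately show "is_iso (psh_cat C) (P, Q, \<alpha>)"
    using asm \<beta> by (auto simp: is_iso_def intro!: bexI[of _ "(Q, P, ?\<beta>)"])
qed

end

section \<open>Replacing a presheaf with small values by one valued in the universe\<close>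

definition encode :: "'a set \<Rightarrow> 'a \<Rightarrow> 'u" where
  "encode A = (SOME f. inj_on f A)"

definition shrink :: "('o, 'm) cat \<Rightarrow> ('o, 'm, 'a) presheaf \<Rightarrow> ('o, 'm, 'u) presheaf" where
  "shrink C P =
    \<lparr>At = (\<lambda>X \<in> Obj C. encode (At P X) ` At P X),
     Act = (\<lambda>f \<in> Mor C. \<lambda>u \<in> encode (At P (Cod C f)) ` At P (Cod C f).
       encode (At P (Dom C f)) (Act P f (inv_into (At P (Cod C f)) (encode (At P (Cod C f))) u)))\<rparr>"

definition up :: "('o, 'm) cat \<Rightarrow> ('o, 'm, 'a) presheaf \<Rightarrow> 'o \<Rightarrow> 'a \<Rightarrow> 'u" where
  "up C P = ext_trans C P (\<lambda>X. encode (At P X))"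

definition down :: "('o, 'm) cat \<Rightarrow> ('o, 'm, 'a) presheaf \<Rightarrow> 'o \<Rightarrow> 'u \<Rightarrow> 'a" where
  "down C P = ext_trans C (shrink C P) (\<lambda>X. inv_into (At P X) (up C P X))"

context small_category
begin

definition small_presheaf :: "('o, 'm, 'a) presheaf \<Rightarrow> bool" where
  "small_presheaf P \<longleftrightarrow> is_presheaf C P \<and> (\<forall>X \<in> Obj C. small U (At P X))"

lemma small_presheaf_is_presheaf: "small_presheaf P \<Longrightarrow> is_presheaf C P"
  by (simp add: small_presheaf_def)

lemma presheaves_iff: "P \<in> presheaves C \<longleftrightarrow> small_presheaf (P :: ('o, 'm, 'u) presheaf)"
  by (simp add: presheaves_def small_presheaf_def small_def del: presheaves_is_presheaf)

lemma inj_on_encode: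
  assumes "small U A"
  shows "inj_on (encode A :: 'a \<Rightarrow> 'u) A"
proof -
  have "|A| \<le>o |UNIV :: 'u set|"
    using assms ordLess_imp_ordLeq by (auto simp: small_def)
  then have "\<exists>f :: 'a \<Rightarrow> 'u. inj_on f A"
    using card_of_ordLeq[of A "UNIV :: 'u set"] by auto
  then show ?thesis unfolding encode_def by (rule someI_ex)
qed

context
  fixes P :: "('o, 'm, 'a) presheaf"
  assumes P: "small_presheaf P"
begin

lemma up_bij:
  assumes "X \<in> Obj C"
  shows "bij_betw (up C P X :: 'a \<Rightarrow> 'u) (At P X) (At (shrink C P) X)"
proof -
  have "inj_on (encode (At P X) :: 'a \<Rightarrow> 'u) (At P X)"
    using P assms by (intro inj_on_encode) (auto simp: small_presheaf_def)
  then show ?thesis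
    using assms by (auto simp: bij_betw_def shrink_def up_def inj_on_def)
qed

lemma Act_shrink:
  assumes "f \<in> Mor C" "s \<in> At P (Cod C f)"
  shows "Act (shrink C P :: ('o, 'm, 'u) presheaf) f (up C P (Cod C f) s) =
    up C P (Dom C f) (Act P f s)"
proof -
  have "inj_on (encode (At P (Cod C f)) :: 'a \<Rightarrow> 'u) (At P (Cod C f))"
    using P assms by (intro inj_on_encode) (auto simp: small_presheaf_def)
  then show ?thesis
    using assms P by (auto simp: shrink_def up_def small_presheaf_def)
qed

lemma shrink_in_presheaves: "(shrink C P :: ('o, 'm, 'u) presheaf) \<in> presheaves C"
proof -
  have pre: "is_presheaf C P" using P by (simp add: small_presheaf_def)
  have "is_presheaf C (shrink C P :: ('o, 'm, 'u) presheaf)" (is "is_presheaf C ?S")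
    unfolding is_presheaf_def
  proof (intro conjI ballI impI)
    show "At ?S \<in> extensional (Obj C)" by (simp add: shrink_def)
    have "Act ?S f u \<in> At ?S (Dom C f)" if f: "f \<in> Mor C" and u: "u \<in> At ?S (Cod C f)" for f u
    proof -
      obtain s where "s \<in> At P (Cod C f)" "u = up C P (Cod C f) s"
        using up_bij[of "Cod C f"] u f by (auto simp: bij_betw_def)
      then show ?thesis
        using Act_shrink[of f s] f up_bij[of "Dom C f"] pre by (auto simp: bij_betw_def)
    qed
    then show "Act ?S \<in> (\<Pi>\<^sub>E f \<in> Mor C. At ?S (Cod C f) \<rightarrow>\<^sub>E At ?S (Dom C f))"
      by (auto simp: PiE_iff extensional_def) (auto simp: shrink_def)
  next
    fix X u assume X: "X \<in> Obj C" and u: "u \<in> At ?S X"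
    then obtain s where "s \<in> At P X" "u = up C P X s"
      using up_bij[of X] by (auto simp: bij_betw_def)
    then show "Act ?S (Id C X) u = u"
      using Act_shrink[of "Id C X" s] X pre by simp
  next
    fix f g u assume f: "f \<in> Mor C" and g: "g \<in> Mor C" and fg: "Cod C f = Dom C g"
      and u: "u \<in> At ?S (Cod C g)"
    then obtain s where s: "s \<in> At P (Cod C g)" "u = up C P (Cod C g) s"
      using up_bij[of "Cod C g"] by (auto simp: bij_betw_def)
    then show "Act ?S (Comp C g f) u = Act ?S f (Act ?S g u)"
      using Act_shrink[of g s] Act_shrink[of f "Act P g s"] Act_shrink[of "Comp C g f" s] f g fg pre
      by simp
  qed
  moreover have "small U (At ?S X)" if "X \<in> Obj C" for X
    using P that small_image by (auto simp: shrink_def small_presheaf_def)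
  ultimately show ?thesis by (simp add: presheaves_iff small_presheaf_def)
qed

lemma up_in: "(up C P :: 'o \<Rightarrow> 'a \<Rightarrow> 'u) \<in> nat_trans C P (shrink C P)"
proof -
  have "up C P \<in> extensional (Obj C)" "\<And>X. X \<in> Obj C \<Longrightarrow> up C P X \<in> extensional (At P X)"
    by (auto simp: up_def ext_trans_def)
  then show ?thesis
    using up_bij Act_shrink by (auto simp: nat_trans_def PiE_iff bij_betw_def)
qed

lemma down_in: "(down C P :: 'o \<Rightarrow> 'u \<Rightarrow> 'a) \<in> nat_trans C (shrink C P) P"
  unfolding down_def
  using inverse_trans[OF _ _ up_in] up_bij P shrink_in_presheaves
  by (auto simp: small_presheaf_def)

lemma down_up [simp]: "X \<in> Obj C \<Longrightarrow> s \<in> At P X \<Longrightarrow> down C P X (up C P X s :: 'u) = s"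
  using up_bij[of X] nat_trans_in[OF up_in, of X s] by (auto simp: down_def bij_betw_def)

lemma up_down [simp]:
  "X \<in> Obj C \<Longrightarrow> u \<in> At (shrink C P) X \<Longrightarrow> up C P X (down C P X (u :: 'u)) = u"
  using up_bij[of X] up_in by (auto simp: down_def bij_betw_def f_inv_into_f)

end

end

section \<open>Sieves as sets of arrows\<close>

context category
begin

definition is_sieve :: "'o \<Rightarrow> 'm set \<Rightarrow> bool" where
  "is_sieve X S \<longleftrightarrow> (\<forall>f \<in> S. f \<in> Mor C \<and> Cod C f = X) \<and>
    (\<forall>f \<in> S. \<forall>g \<in> Mor C. Cod C g = Dom C f \<longrightarrow> Comp C f g \<in> S)"

definition sieve_of :: "'m set \<Rightarrow> ('o, 'm, 'm) presheaf" where
  "sieve_of S =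
    \<lparr>At = (\<lambda>Y \<in> Obj C. {f \<in> S. Dom C f = Y}),
     Act = (\<lambda>g \<in> Mor C. \<lambda>f \<in> {f \<in> S. Dom C f = Cod C g}. Comp C f g)\<rparr>"

definition arrows :: "('o, 'm, 'm) presheaf \<Rightarrow> 'm set" where
  "arrows K = {f \<in> Mor C. f \<in> At K (Dom C f)}"

definition into :: "'o \<Rightarrow> 'm set" where
  "into X = {f \<in> Mor C. Cod C f = X}"

definition pull :: "'m \<Rightarrow> 'm set \<Rightarrow> 'm set" where
  "pull x S = {g \<in> Mor C. Cod C g = Dom C x \<and> Comp C x g \<in> S}"

lemma is_sieveD:
  assumes "is_sieve X S" "f \<in> S"
  shows "f \<in> Mor C" "Cod C f = X" "Dom C f \<in> Obj C"
    "g \<in> Mor C \<Longrightarrow> Cod C g = Dom C f \<Longrightarrow> Comp C f g \<in> S"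
  using assms by (auto simp: is_sieve_def)

lemma is_sieve_into: "is_sieve X (into X)"
  by (auto simp: is_sieve_def into_def)

lemma is_sieve_pull:
  assumes "is_sieve (Cod C x) S" "x \<in> Mor C"
  shows "is_sieve (Dom C x) (pull x S)"
proof -
  have "Comp C x (Comp C f g) \<in> S"
    if "f \<in> Mor C" "Cod C f = Dom C x" "Comp C x f \<in> S" "g \<in> Mor C" "Cod C g = Dom C f" for f g
    using is_sieveD(4)[OF assms(1) that(3), of g] that assms by simp
  then show ?thesis by (auto simp: is_sieve_def pull_def)
qed

lemma pull_Id: "is_sieve X S \<Longrightarrow> X \<in> Obj C \<Longrightarrow> pull (Id C X) S = S"
  by (auto simp: is_sieve_def pull_def)

lemma pull_pull:
  assumes "x \<in> Mor C" "y \<in> Mor C" "Cod C y = Dom C x"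
  shows "pull y (pull x S) = pull (Comp C x y) S"
  using assms by (auto simp: pull_def)

lemma pull_member: "is_sieve X S \<Longrightarrow> f \<in> S \<Longrightarrow> pull f S = into (Dom C f)"
  by (auto simp: is_sieve_def pull_def into_def)

lemma At_sieve_of: "Y \<in> Obj C \<Longrightarrow> At (sieve_of S) Y = {f \<in> S. Dom C f = Y}"
  by (simp add: sieve_of_def)

lemma Act_sieve_of:
  "g \<in> Mor C \<Longrightarrow> f \<in> S \<Longrightarrow> Dom C f = Cod C g \<Longrightarrow> Act (sieve_of S) g f = Comp C f g"
  by (simp add: sieve_of_def)

lemma yoneda_eq: "yoneda C X = sieve_of (into X)"
  by (auto simp: yoneda_def sieve_of_def into_def hom_def fun_eq_iff restrict_def)

lemma is_presheaf_sieve_of: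
  assumes "is_sieve X S"
  shows "is_presheaf C (sieve_of S)"
  unfolding is_presheaf_def
proof (intro conjI ballI impI)
  show "Act (sieve_of S) \<in> (\<Pi>\<^sub>E f \<in> Mor C. At (sieve_of S) (Cod C f) \<rightarrow>\<^sub>E At (sieve_of S) (Dom C f))"
    using is_sieveD[OF assms] by (auto simp: PiE_iff extensional_def sieve_of_def)
qed (use is_sieveD[OF assms] in \<open>auto simp: At_sieve_of Act_sieve_of\<close>, simp add: sieve_of_def)

lemma sieve_of_in_sieves:
  assumes "is_sieve X S" "X \<in> Obj C"
  shows "(X, sieve_of S) \<in> sieves C"
  using is_presheaf_sieve_of[OF assms(1)] assms is_sieveD[OF assms(1)]
  by (auto simp: sieves_def subpresheaf_def yoneda_eq At_sieve_of Act_sieve_of into_def)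

lemma sievesE:
  assumes "(X, K) \<in> sieves C"
  obtains S where "X \<in> Obj C" "is_sieve X S" "K = sieve_of S"
proof -
  have X: "X \<in> Obj C" and K: "is_presheaf C K"
    and sub: "\<And>Y. Y \<in> Obj C \<Longrightarrow> At K Y \<subseteq> hom C Y X"
    and act: "\<And>f s. f \<in> Mor C \<Longrightarrow> s \<in> At K (Cod C f) \<Longrightarrow> Act K f s = Comp C s f"
  proof -
    show "X \<in> Obj C" "is_presheaf C K" and *: "\<And>Y. Y \<in> Obj C \<Longrightarrow> At K Y \<subseteq> hom C Y X"
      using assms by (auto simp: sieves_def subpresheaf_def yoneda_def)
    fix f s assume f: "f \<in> Mor C" "s \<in> At K (Cod C f)"
    then have "s \<in> hom C (Cod C f) X" using *[of "Cod C f"] by auto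
    then show "Act K f s = Comp C s f"
      using assms f by (auto simp: sieves_def subpresheaf_def yoneda_def)
  qed
  have sieve: "is_sieve X (arrows K)"
    unfolding is_sieve_def
  proof (intro conjI ballI impI)
    fix f assume "f \<in> arrows K"
    then have f: "f \<in> Mor C" "f \<in> At K (Dom C f)" by (auto simp: arrows_def)
    then show "f \<in> Mor C" "Cod C f = X" using sub[of "Dom C f"] by (auto simp: hom_def)
    fix g assume g: "g \<in> Mor C" "Cod C g = Dom C f"
    then have "Act K g f \<in> At K (Dom C g)" "Act K g f = Comp C f g"
      using Act_in[OF K g(1,2) f(2)] act[of g f] f by auto
    then show "Comp C f g \<in> arrows K" using f g by (simp add: arrows_def)
  qed
  have At: "At K Y = {f \<in> arrows K. Dom C f = Y}" if "Y \<in> Obj C" for Y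
    using sub[OF that] by (auto simp: arrows_def hom_def)
  have ext: "At K \<in> extensional (Obj C)" "Act K \<in> extensional (Mor C)"
    "\<And>g. g \<in> Mor C \<Longrightarrow> Act K g \<in> extensional (At K (Cod C g))"
    using K unfolding is_presheaf_def PiE_iff by blast+
  have "At K = At (sieve_of (arrows K))"
    by (rule extensionalityI[OF ext(1)]) (simp_all add: sieve_of_def At)
  moreover have "Act K = Act (sieve_of (arrows K))"
  proof (rule extensionalityI[OF ext(2)])
    fix g assume g: "g \<in> Mor C"
    show "Act K g = Act (sieve_of (arrows K)) g"
    proof (rule extensionalityI[OF ext(3)[OF g]])
      show "Act (sieve_of (arrows K)) g \<in> extensional (At K (Cod C g))"
        using g by (simp add: sieve_of_def At)
      fix f assume "f \<in> At K (Cod C g)"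
      then show "Act K g f = Act (sieve_of (arrows K)) g f"
        using act[OF g] g At[of "Cod C g"] by (simp add: sieve_of_def)
    qed
  qed (simp add: sieve_of_def)
  ultimately have "K = sieve_of (arrows K)" by simp
  then show ?thesis using that X sieve by blast
qed

lemma sieve_pullback_eq:
  assumes "x \<in> Mor C" "is_sieve (Cod C x) S"
  shows "sieve_pullback C x (sieve_of S) = sieve_of (pull x S)"
proof -
  have "{g \<in> hom C Y (Dom C x). Comp C x g \<in> At (sieve_of S) Y} = {f \<in> pull x S. Dom C f = Y}"
    if "Y \<in> Obj C" for Y
    using that assms by (auto simp: hom_def pull_def At_sieve_of)
  then show ?thesis
    by (auto simp: sieve_pullback_def sieve_of_def Let_def cong: restrict_cong)
qed

section \<open>The sheaf condition\<close>

definition compatible :: "('o, 'm, 'a) presheaf \<Rightarrow> 'm set \<Rightarrow> ('m \<Rightarrow> 'a) \<Rightarrow> bool" where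
  "compatible P S \<phi> \<longleftrightarrow> (\<forall>f \<in> S. \<phi> f \<in> At P (Dom C f)) \<and>
    (\<forall>f \<in> S. \<forall>g \<in> Mor C. Cod C g = Dom C f \<longrightarrow> \<phi> (Comp C f g) = Act P g (\<phi> f))"

definition separated_on :: "('o, 'm, 'a) presheaf \<Rightarrow> 'o \<Rightarrow> 'm set \<Rightarrow> bool" where
  "separated_on P X S \<longleftrightarrow>
    (\<forall>s \<in> At P X. \<forall>t \<in> At P X. (\<forall>f \<in> S. Act P f s = Act P f t) \<longrightarrow> s = t)"

definition sheaf_on :: "('o, 'm, 'a) presheaf \<Rightarrow> 'o \<Rightarrow> 'm set \<Rightarrow> bool" where
  "sheaf_on P X S \<longleftrightarrow> separated_on P X S \<and>
    (\<forall>\<phi>. compatible P S \<phi> \<longrightarrow> (\<exists>s \<in> At P X. \<forall>f \<in> S. Act P f s = \<phi> f))"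

definition universal_sheaf_on :: "('o, 'm, 'a) presheaf \<Rightarrow> 'o \<Rightarrow> 'm set \<Rightarrow> bool" where
  "universal_sheaf_on P X S \<longleftrightarrow>
    (\<forall>x \<in> Mor C. Cod C x = X \<longrightarrow> sheaf_on P (Dom C x) (pull x S))"

lemma sheaf_on_sep:
  assumes "sheaf_on P X S" "s \<in> At P X" "t \<in> At P X" "\<And>f. f \<in> S \<Longrightarrow> Act P f s = Act P f t"
  shows "s = t"
  using assms by (auto simp: sheaf_on_def separated_on_def)

lemma sheaf_on_glue:
  assumes "sheaf_on P X S" "\<And>f. f \<in> S \<Longrightarrow> \<phi> f \<in> At P (Dom C f)"
    "\<And>f g. f \<in> S \<Longrightarrow> g \<in> Mor C \<Longrightarrow> Cod C g = Dom C f \<Longrightarrow> \<phi> (Comp C f g) = Act P g (\<phi> f)"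
  obtains s where "s \<in> At P X" "\<And>f. f \<in> S \<Longrightarrow> Act P f s = \<phi> f"
  using assms unfolding sheaf_on_def compatible_def by blast

lemma compatible_trans:
  assumes "is_sieve X S" "compatible P S \<phi>"
  shows "ext_trans C (sieve_of S) (\<lambda>Y f. \<phi> f) \<in> nat_trans C (sieve_of S) P"
  using assms is_sieveD[OF assms(1)]
  by (intro ext_trans_in is_presheaf_sieve_of[OF assms(1)])
    (auto simp: compatible_def At_sieve_of Act_sieve_of)

lemma trans_compatible:
  assumes "is_sieve X S" "\<alpha> \<in> nat_trans C (sieve_of S) P"
  shows "compatible P S (\<lambda>f. \<alpha> (Dom C f) f)"
  unfolding compatible_def
proof (intro conjI ballI impI)
  fix f assume f: "f \<in> S"
  then show "\<alpha> (Dom C f) f \<in> At P (Dom C f)"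
    using is_sieveD[OF assms(1)] nat_trans_in[OF assms(2)] by (auto simp: At_sieve_of)
  fix g assume g: "g \<in> Mor C" "Cod C g = Dom C f"
  then show "\<alpha> (Dom C (Comp C f g)) (Comp C f g) = Act P g (\<alpha> (Dom C f) f)"
    using f is_sieveD[OF assms(1)] nat_trans_natural[OF assms(2), of g f]
    by (auto simp: At_sieve_of Act_sieve_of)
qed

text \<open>A transformation out of a sieve is the same as a compatible family indexed by its arrows.\<close>

lemma restriction_bij_iff:
  assumes P: "is_presheaf C P" and X: "X \<in> Obj C" and S: "is_sieve X S"
  shows "restriction_bij C P X (sieve_of S) \<longleftrightarrow> sheaf_on P X S"
proof -
  let ?r = "\<lambda>s. ext_trans C (sieve_of S) (\<lambda>Y f. Act P f s)"
  have r: "restrict_trans C (sieve_of S) (yoneda_map C P X s) = ?r s" for s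
    unfolding restrict_trans_def ext_trans_def
    using is_sieveD[OF S]
    by (auto simp: yoneda_map_def At_sieve_of hom_def cong: restrict_cong)
  have app: "f \<in> S \<Longrightarrow> ext_trans C (sieve_of S) (\<lambda>Y. \<phi>) (Dom C f) f = \<phi> f" for \<phi> :: "'m \<Rightarrow> 'a" and f
    using is_sieveD[OF S] by (simp add: At_sieve_of)
  have eq_iff: "ext_trans C (sieve_of S) (\<lambda>Y. \<phi>) = ext_trans C (sieve_of S) (\<lambda>Y. \<psi>) \<longleftrightarrow>
      (\<forall>f \<in> S. \<phi> f = \<psi> f)" for \<phi> \<psi> :: "'m \<Rightarrow> 'a"
  proof
    assume eq: "ext_trans C (sieve_of S) (\<lambda>Y. \<phi>) = ext_trans C (sieve_of S) (\<lambda>Y. \<psi>)"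
    show "\<forall>f \<in> S. \<phi> f = \<psi> f"
    proof
      fix f assume "f \<in> S"
      then show "\<phi> f = \<psi> f" using app[of f \<phi>] app[of f \<psi>] eq by simp
    qed
  qed (auto intro!: ext_trans_cong simp: At_sieve_of)
  have r_in: "?r s \<in> nat_trans C (sieve_of S) P" if "s \<in> At P X" for s
    using that P is_sieveD[OF S] by (intro compatible_trans[OF S]) (auto simp: compatible_def)
  have onto: "\<exists>\<phi>. compatible P S \<phi> \<and> \<alpha> = ext_trans C (sieve_of S) (\<lambda>Y. \<phi>)"
    if "\<alpha> \<in> nat_trans C (sieve_of S) P" for \<alpha>
  proof (intro exI conjI)
    show c: "compatible P S (\<lambda>f. \<alpha> (Dom C f) f)" using S that by (rule trans_compatible)
    show "\<alpha> = ext_trans C (sieve_of S) (\<lambda>Y f. \<alpha> (Dom C f) f)"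
      by (rule nat_trans_eqI[OF that compatible_trans[OF S c]]) (auto simp: At_sieve_of)
  qed
  have "inj_on ?r (At P X) \<longleftrightarrow> separated_on P X S"
    by (auto simp: inj_on_def separated_on_def eq_iff)
  moreover have "nat_trans C (sieve_of S) P \<subseteq> ?r ` At P X \<longleftrightarrow>
      (\<forall>\<phi>. compatible P S \<phi> \<longrightarrow> (\<exists>s \<in> At P X. \<forall>f \<in> S. Act P f s = \<phi> f))"
  proof (intro iffI allI impI subsetI)
    fix \<phi> assume sub: "nat_trans C (sieve_of S) P \<subseteq> ?r ` At P X" and \<phi>: "compatible P S \<phi>"
    have "ext_trans C (sieve_of S) (\<lambda>Y. \<phi>) \<in> ?r ` At P X"
      using sub compatible_trans[OF S \<phi>] by blast
    then obtain s where s: "s \<in> At P X" "ext_trans C (sieve_of S) (\<lambda>Y. \<phi>) = ?r s" by blast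
    then have "\<forall>f \<in> S. Act P f s = \<phi> f" using eq_iff[of \<phi> "\<lambda>f. Act P f s"] by simp
    then show "\<exists>s \<in> At P X. \<forall>f \<in> S. Act P f s = \<phi> f" using s by blast
  next
    fix \<alpha> assume all: "\<forall>\<phi>. compatible P S \<phi> \<longrightarrow> (\<exists>s \<in> At P X. \<forall>f \<in> S. Act P f s = \<phi> f)"
      and "\<alpha> \<in> nat_trans C (sieve_of S) P"
    then obtain \<phi> where \<phi>: "compatible P S \<phi>" "\<alpha> = ext_trans C (sieve_of S) (\<lambda>Y. \<phi>)"
      using onto by blast
    then obtain s where "s \<in> At P X" "\<forall>f \<in> S. Act P f s = \<phi> f" using all by blast
    then show "\<alpha> \<in> ?r ` At P X" using \<phi> eq_iff[of \<phi> "\<lambda>f. Act P f s"] by auto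
  qed
  ultimately show ?thesis
    unfolding restriction_bij_def r bij_betw_def sheaf_on_def using r_in by blast
qed

lemma duality_rel_iff:
  assumes "X \<in> Obj C" "is_sieve X S"
  shows "((X, sieve_of S), P) \<in> duality_rel C \<longleftrightarrow> P \<in> presheaves C \<and> universal_sheaf_on P X S"
proof -
  have "restriction_bij C P (Dom C x) (sieve_pullback C x (sieve_of S)) \<longleftrightarrow>
      sheaf_on P (Dom C x) (pull x S)"
    if "P \<in> presheaves C" "x \<in> Mor C" "Cod C x = X" for x
    using that assms by (simp add: sieve_pullback_eq restriction_bij_iff is_sieve_pull)
  then show ?thesis
    using sieve_of_in_sieves[OF assms(2,1)]
    by (auto simp: duality_rel_def universal_sheaf_on_def)
qed

lemma universal_sheaf_on_sheaf_on:
  assumes "universal_sheaf_on P X S" "is_sieve X S" "X \<in> Obj C"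
  shows "sheaf_on P X S"
  using assms(1,3) pull_Id[OF assms(2,3)] Id_Mor[OF assms(3)] unfolding universal_sheaf_on_def
  by metis

lemma universal_sheaf_on_into:
  assumes "is_presheaf C P" "X \<in> Obj C"
  shows "universal_sheaf_on P X (into X)"
  unfolding universal_sheaf_on_def
proof (intro ballI impI)
  fix x assume x: "x \<in> Mor C" "Cod C x = X"
  have Id: "Id C (Dom C x) \<in> into (Dom C x)" using x by (simp add: into_def)
  have "pull x (into X) = into (Dom C x)" using x by (auto simp: pull_def into_def)
  moreover have "sheaf_on P (Dom C x) (into (Dom C x))"
    unfolding sheaf_on_def separated_on_def
  proof (intro conjI ballI allI impI)
    fix s t assume "s \<in> At P (Dom C x)" "t \<in> At P (Dom C x)"
      "\<forall>f \<in> into (Dom C x). Act P f s = Act P f t"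
    then show "s = t" using Id assms x by (metis Act_Id Dom_Cod_Obj(1))
  next
    fix \<phi> assume \<phi>: "compatible P (into (Dom C x)) \<phi>"
    show "\<exists>s \<in> At P (Dom C x). \<forall>f \<in> into (Dom C x). Act P f s = \<phi> f"
    proof (intro bexI[of _ "\<phi> (Id C (Dom C x))"] ballI)
      show "\<phi> (Id C (Dom C x)) \<in> At P (Dom C x)" using \<phi> Id x by (force simp: compatible_def)
      fix f assume "f \<in> into (Dom C x)"
      then show "Act P f (\<phi> (Id C (Dom C x))) = \<phi> f"
        using \<phi> Id x unfolding compatible_def into_def
        by (metis (mono_tags, lifting) Comp_Id_Mor(2) Dom_Cod_Obj(1) Id_Mor(2) mem_Collect_eq)
    qed
  qed
  ultimately show "sheaf_on P (Dom C x) (pull x (into X))" by simp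
qed

lemma universal_sheaf_on_pull:
  assumes "universal_sheaf_on P (Cod C x) S" "x \<in> Mor C"
  shows "universal_sheaf_on P (Dom C x) (pull x S)"
  unfolding universal_sheaf_on_def
proof (intro ballI impI)
  fix y assume y: "y \<in> Mor C" "Cod C y = Dom C x"
  then have "sheaf_on P (Dom C (Comp C x y)) (pull (Comp C x y) S)"
    using assms unfolding universal_sheaf_on_def by (metis Comp_Mor(1,3))
  then show "sheaf_on P (Dom C y) (pull y (pull x S))" using assms y by (simp add: pull_pull)
qed

text \<open>This is the reason why universal sheaf conditions form a topology.  Given a compatible family \<open>\<phi>\<close> on \<open>R\<close>, gluing over each \<open>pull f R\<close> with \<open>f \<in> S\<close> extends
  it to a compatible family \<open>\<psi>\<close> on \<open>S\<close>, which is glued in turn.\<close>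

lemma sheaf_on_trans:
  assumes P: "is_presheaf C P" and X: "X \<in> Obj C" and S: "is_sieve X S" and R: "is_sieve X R"
    and uS: "universal_sheaf_on P X S"
    and uR: "\<And>f. f \<in> S \<Longrightarrow> universal_sheaf_on P (Dom C f) (pull f R)"
  shows "sheaf_on P X R"
proof -
  have sS: "sheaf_on P X S" using uS S X by (rule universal_sheaf_on_sheaf_on)
  have sR: "sheaf_on P (Dom C f) (pull f R)" if "f \<in> S" for f
    by (rule universal_sheaf_on_sheaf_on) (use uR that is_sieveD[OF S that] is_sieve_pull[of f R] R in auto)
  note SD = is_sieveD[OF S] and RD = is_sieveD[OF R]
  show ?thesis
    unfolding sheaf_on_def separated_on_def
  proof (intro conjI ballI allI impI)
    fix s t assume s: "s \<in> At P X" and t: "t \<in> At P X" and eq: "\<forall>f \<in> R. Act P f s = Act P f t"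
    show "s = t"
    proof (rule sheaf_on_sep[OF sS s t])
      fix f assume f: "f \<in> S"
      show "Act P f s = Act P f t"
      proof (rule sheaf_on_sep[OF sR[OF f]])
        show "Act P f s \<in> At P (Dom C f)" "Act P f t \<in> At P (Dom C f)"
          using P s t SD[OF f] by auto
        fix g assume "g \<in> pull f R"
        then show "Act P g (Act P f s) = Act P g (Act P f t)"
          using eq P s t SD[OF f] by (auto simp: pull_def)
      qed
    qed
  next
    fix \<phi> assume \<phi>: "compatible P R \<phi>"
    have "\<exists>s \<in> At P (Dom C f). \<forall>g \<in> pull f R. Act P g s = \<phi> (Comp C f g)" if f: "f \<in> S" for f
    proof -
      have "compatible P (pull f R) (\<lambda>g. \<phi> (Comp C f g))"
        using \<phi> SD[OF f] unfolding compatible_def pull_def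
        by clarsimp (metis Comp_Mor(2) Comp_assoc_Mor)
      then show ?thesis using sR[OF f] by (auto simp: sheaf_on_def)
    qed
    then obtain \<psi> where \<psi>: "\<And>f. f \<in> S \<Longrightarrow> \<psi> f \<in> At P (Dom C f)"
      "\<And>f g. f \<in> S \<Longrightarrow> g \<in> pull f R \<Longrightarrow> Act P g (\<psi> f) = \<phi> (Comp C f g)"
      by metis
    have \<psi>_comp: "\<psi> (Comp C f h) = Act P h (\<psi> f)"
      if f: "f \<in> S" and h: "h \<in> Mor C" "Cod C h = Dom C f" for f h
    proof -
      have fh: "Comp C f h \<in> S" using SD(4)[OF f] h by simp
      note fM = SD(1)[OF f]
      show ?thesis
      proof (rule sheaf_on_sep[OF sR[OF fh]])
        show "\<psi> (Comp C f h) \<in> At P (Dom C (Comp C f h))" using \<psi>(1) fh by simp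
        show "Act P h (\<psi> f) \<in> At P (Dom C (Comp C f h))" using \<psi>(1)[OF f] h fM P by simp
        fix g assume g: "g \<in> pull (Comp C f h) R"
        then have "Comp C h g \<in> pull f R" using h fM by (auto simp: pull_def)
        then have "Act P (Comp C h g) (\<psi> f) = \<phi> (Comp C f (Comp C h g))" using \<psi>(2) f by simp
        then show "Act P g (\<psi> (Comp C f h)) = Act P g (Act P h (\<psi> f))"
          using \<psi>(2)[OF fh g] g h fM P \<psi>(1)[OF f] by (simp add: pull_def)
      qed
    qed
    obtain s where s: "s \<in> At P X" "\<And>f. f \<in> S \<Longrightarrow> Act P f s = \<psi> f"
      using sheaf_on_glue[OF sS \<psi>(1) \<psi>_comp] by blast
    have "Act P l s = \<phi> l" if l: "l \<in> R" for l
    proof (rule sheaf_on_sep)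
      show "sheaf_on P (Dom C l) (pull l S)"
        using uS RD[OF l] by (auto simp: universal_sheaf_on_def)
      show "Act P l s \<in> At P (Dom C l)" using P s RD[OF l] by simp
      show "\<phi> l \<in> At P (Dom C l)" using \<phi> l by (simp add: compatible_def)
      fix h assume "h \<in> pull l S"
      then have h: "h \<in> Mor C" "Cod C h = Dom C l" and lh: "Comp C l h \<in> S" by (auto simp: pull_def)
      have lhR: "Comp C l h \<in> R" using RD(4)[OF l] h by simp
      have "Id C (Dom C h) \<in> pull (Comp C l h) R"
        using lhR h RD[OF l] by (auto simp: pull_def)
      then have "Act P (Id C (Dom C h)) (\<psi> (Comp C l h)) = \<phi> (Comp C l h)"
        using \<psi>(2)[OF lh] h RD[OF l] by simp
      moreover have "\<psi> (Comp C l h) \<in> At P (Dom C h)" using \<psi>(1)[OF lh] h RD[OF l] by simp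
      moreover have "Act P h (Act P l s) = \<psi> (Comp C l h)" using s lh h RD[OF l] P by simp
      ultimately have "Act P h (Act P l s) = \<phi> (Comp C l h)" using P h by simp
      then show "Act P h (Act P l s) = Act P h (\<phi> l)"
        using \<phi> l h by (simp add: compatible_def)
    qed
    then show "\<exists>s \<in> At P X. \<forall>f \<in> R. Act P f s = \<phi> f" using s by blast
  qed
qed

lemma universal_sheaf_on_trans:
  assumes P: "is_presheaf C P" and X: "X \<in> Obj C" and S: "is_sieve X S" and R: "is_sieve X R"
    and uS: "universal_sheaf_on P X S"
    and uR: "\<And>f. f \<in> S \<Longrightarrow> universal_sheaf_on P (Dom C f) (pull f R)"
  shows "universal_sheaf_on P X R"
  unfolding universal_sheaf_on_def
proof (intro ballI impI)
  fix x assume x: "x \<in> Mor C" "Cod C x = X"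
  show "sheaf_on P (Dom C x) (pull x R)"
  proof (rule sheaf_on_trans[OF P])
    show "universal_sheaf_on P (Dom C x) (pull x S)"
      using universal_sheaf_on_pull[of P x S] uS x by simp
    fix f assume "f \<in> pull x S"
    then have f: "f \<in> Mor C" "Cod C f = Dom C x" "Comp C x f \<in> S" by (auto simp: pull_def)
    show "universal_sheaf_on P (Dom C f) (pull f (pull x R))"
      using uR[OF f(3)] x f by (simp add: pull_pull)
  qed (use x S R is_sieve_pull[of x] in auto)
qed

section \<open>Topologies\<close>

lemma grothendieck_topologyI:
  assumes "J \<subseteq> sieves C"
    and "\<And>X. X \<in> Obj C \<Longrightarrow> (X, sieve_of (into X)) \<in> J"
    and "\<And>x S. x \<in> Mor C \<Longrightarrow> is_sieve (Cod C x) S \<Longrightarrow> (Cod C x, sieve_of S) \<in> J \<Longrightarrow>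
      (Dom C x, sieve_of (pull x S)) \<in> J"
    and "\<And>X S R. X \<in> Obj C \<Longrightarrow> is_sieve X S \<Longrightarrow> is_sieve X R \<Longrightarrow> (X, sieve_of S) \<in> J \<Longrightarrow>
      (\<And>f. f \<in> S \<Longrightarrow> (Dom C f, sieve_of (pull f R)) \<in> J) \<Longrightarrow> (X, sieve_of R) \<in> J"
  shows "grothendieck_topology C J"
  unfolding grothendieck_topology_def
proof (intro conjI allI impI ballI)
  fix X K x assume "(X, K) \<in> J" and x: "x \<in> Mor C" "Cod C x = X"
  moreover from this obtain S where "is_sieve X S" "K = sieve_of S"
    using assms(1) by (blast elim: sievesE)
  ultimately show "(Dom C x, sieve_pullback C x K) \<in> J"
    using assms(3)[of x S] by (auto simp: sieve_pullback_eq)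
next
  fix X K L assume *: "(X, K) \<in> J \<and> (X, L) \<in> sieves C \<and>
      (\<forall>Y \<in> Obj C. \<forall>x \<in> At K Y. (Y, sieve_pullback C x L) \<in> J)"
  then obtain S where X: "X \<in> Obj C" and S: "is_sieve X S" "K = sieve_of S"
    using assms(1) by (blast elim: sievesE)
  obtain R where R: "is_sieve X R" "L = sieve_of R"
    using * by (blast elim: sievesE)
  have "(Dom C f, sieve_of (pull f R)) \<in> J" if f: "f \<in> S" for f
    using *[THEN conjunct2, THEN conjunct2, rule_format, of "Dom C f" f] is_sieveD[OF S(1) f] f S R
    by (auto simp: At_sieve_of sieve_pullback_eq)
  then show "(X, L) \<in> J" using assms(4) X S R * by blast
qed (use assms in \<open>auto simp: yoneda_eq\<close>)

lemma G_R_iff: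
  assumes "I \<subseteq> presheaves C" "X \<in> Obj C" "is_sieve X S"
  shows "(X, sieve_of S) \<in> G_R C I \<longleftrightarrow> (\<forall>P \<in> I. universal_sheaf_on P X S)"
  using assms sieve_of_in_sieves[OF assms(3,2)] by (auto simp: G_R_def duality_rel_iff)

lemma G_R_topology:
  assumes I: "I \<subseteq> presheaves C"
  shows "grothendieck_topology C (G_R C I)"
proof (rule grothendieck_topologyI)
  have pre: "P \<in> I \<Longrightarrow> is_presheaf C P" for P using I by auto
  show "G_R C I \<subseteq> sieves C" by (auto simp: G_R_def)
  show "(X, sieve_of (into X)) \<in> G_R C I" if "X \<in> Obj C" for X
    using that pre by (simp add: G_R_iff[OF I] is_sieve_into universal_sheaf_on_into)
  show "(Dom C x, sieve_of (pull x S)) \<in> G_R C I"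
    if "x \<in> Mor C" "is_sieve (Cod C x) S" "(Cod C x, sieve_of S) \<in> G_R C I" for x S
    using that by (simp add: G_R_iff[OF I] is_sieve_pull universal_sheaf_on_pull)
  fix X S R
  assume X: "X \<in> Obj C" and S: "is_sieve X S" and R: "is_sieve X R" and SG: "(X, sieve_of S) \<in> G_R C I"
    and RG: "\<And>f. f \<in> S \<Longrightarrow> (Dom C f, sieve_of (pull f R)) \<in> G_R C I"
  have "universal_sheaf_on P (Dom C f) (pull f R)" if "f \<in> S" "P \<in> I" for f P
    using that RG[OF that(1)] is_sieveD[OF S that(1)] is_sieve_pull[of f R] R
    by (simp add: G_R_iff[OF I])
  moreover have "universal_sheaf_on P X S" if "P \<in> I" for P
    using SG that X S by (simp add: G_R_iff[OF I])
  ultimately have "universal_sheaf_on P X R" if "P \<in> I" for P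
    using universal_sheaf_on_trans[OF pre X S R] that by blast
  then show "(X, sieve_of R) \<in> G_R C I" using X R by (simp add: G_R_iff[OF I])
qed

end

text \<open>A property of arrows with a common codomain holds locally if it holds on a covering sieve.  The
  rules of this modality replace most manipulations of covering sieves: the axioms on pullbacks and on
  composition of coverings become \<open>loc_pull\<close> and \<open>loc_bind\<close>.\<close>

locale topology = category C for C :: "('o, 'm) cat" +
  fixes J :: "('o, 'm) sieve set"
  assumes topology: "grothendieck_topology C J"
begin

definition covers :: "'o \<Rightarrow> 'm set \<Rightarrow> bool" where
  "covers X S \<longleftrightarrow> X \<in> Obj C \<and> is_sieve X S \<and> (X, sieve_of S) \<in> J"

definition loc :: "'o \<Rightarrow> ('m \<Rightarrow> bool) \<Rightarrow> bool" where
  "loc X \<Phi> \<longleftrightarrow> (\<exists>S. covers X S \<and> (\<forall>f \<in> S. \<Phi> f))"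

lemma J_sieves: "J \<subseteq> sieves C"
  using topology by (simp add: grothendieck_topology_def)

lemma JE:
  assumes "(X, K) \<in> J"
  obtains S where "covers X S" "K = sieve_of S"
  using assms J_sieves by (auto simp: covers_def elim: sievesE)

lemma coversD:
  assumes "covers X S" "f \<in> S"
  shows "f \<in> Mor C" "Cod C f = X" "Dom C f \<in> Obj C"
    "g \<in> Mor C \<Longrightarrow> Cod C g = Dom C f \<Longrightarrow> Comp C f g \<in> S"
  using assms is_sieveD by (auto simp: covers_def)

lemma covers_into: "X \<in> Obj C \<Longrightarrow> covers X (into X)"
proof -
  assume X: "X \<in> Obj C"
  then have "(X, yoneda C X) \<in> J" using topology unfolding grothendieck_topology_def by blast
  then show "covers X (into X)" using X by (simp add: covers_def is_sieve_into yoneda_eq)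
qed

lemma covers_pull:
  assumes "covers (Cod C x) S" "x \<in> Mor C"
  shows "covers (Dom C x) (pull x S)"
proof -
  have "(Dom C x, sieve_pullback C x (sieve_of S)) \<in> J"
    using topology assms unfolding grothendieck_topology_def covers_def by blast
  then show ?thesis using assms by (simp add: covers_def is_sieve_pull sieve_pullback_eq)
qed

lemma covers_trans:
  assumes "covers X S" "is_sieve X R" "\<And>f. f \<in> S \<Longrightarrow> covers (Dom C f) (pull f R)"
  shows "covers X R"
proof -
  have X: "X \<in> Obj C" "is_sieve X S" "(X, sieve_of S) \<in> J" using assms by (auto simp: covers_def)
  have "(Y, sieve_pullback C x (sieve_of R)) \<in> J"
    if "Y \<in> Obj C" "x \<in> At (sieve_of S) Y" for Y x
    using that assms(2,3) is_sieveD[OF X(2), of x]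
    by (auto simp: At_sieve_of sieve_pullback_eq covers_def)
  then have "(X, sieve_of R) \<in> J"
    using topology X sieve_of_in_sieves[OF assms(2) X(1)]
    unfolding grothendieck_topology_def by blast
  then show ?thesis using X assms by (simp add: covers_def)
qed

lemma covers_superset:
  assumes "covers X S" "is_sieve X R" "S \<subseteq> R"
  shows "covers X R"
proof (rule covers_trans[OF assms(1,2)])
  fix f assume f: "f \<in> S"
  then have "pull f R = into (Dom C f)" using assms pull_member by blast
  then show "covers (Dom C f) (pull f R)" using covers_into coversD[OF assms(1) f] by simp
qed

lemma loc_mono:
  assumes "loc X \<Phi>" "\<And>f. f \<in> Mor C \<Longrightarrow> Cod C f = X \<Longrightarrow> \<Phi> f \<Longrightarrow> \<Psi> f"
  shows "loc X \<Psi>"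
  using assms coversD unfolding loc_def by metis

lemma loc_all:
  assumes "X \<in> Obj C" "\<And>f. f \<in> Mor C \<Longrightarrow> Cod C f = X \<Longrightarrow> \<Phi> f"
  shows "loc X \<Phi>"
  using assms covers_into by (auto simp: loc_def into_def)

lemma loc_pull:
  assumes "loc (Cod C x) \<Phi>" "x \<in> Mor C"
  shows "loc (Dom C x) (\<lambda>f. \<Phi> (Comp C x f))"
proof -
  obtain S where "covers (Cod C x) S" "\<forall>f \<in> S. \<Phi> f" using assms by (auto simp: loc_def)
  then show ?thesis
    using covers_pull assms(2) unfolding loc_def
    by (intro exI[of _ "pull x S"]) (auto simp: pull_def)
qed

text \<open>The composites of a covering sieve with covering sieves of its members again form a covering
  sieve; in particular \<open>\<Phi>\<close> need not be stable under composition.\<close>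

lemma loc_bind:
  assumes "loc X (\<lambda>f. loc (Dom C f) (\<lambda>g. \<Phi> (Comp C f g)))"
  shows "loc X \<Phi>"
proof -
  obtain S where S: "covers X S" and "\<forall>f \<in> S. loc (Dom C f) (\<lambda>g. \<Phi> (Comp C f g))"
    using assms by (auto simp: loc_def)
  then obtain T where T: "\<And>f. f \<in> S \<Longrightarrow> covers (Dom C f) (T f)"
    "\<And>f g. f \<in> S \<Longrightarrow> g \<in> T f \<Longrightarrow> \<Phi> (Comp C f g)"
    unfolding loc_def by metis
  note SD = coversD[OF S]
  define R where "R = (\<Union>f \<in> S. Comp C f ` T f)"
  have "\<exists>f' \<in> S. \<exists>g' \<in> T f'. Comp C (Comp C f g) h = Comp C f' g'"
    if "f \<in> S" "g \<in> T f" "h \<in> Mor C" "Cod C h = Dom C g" for f g h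
  proof (intro bexI)
    note TD = coversD[OF T(1)[OF that(1)] that(2)]
    show "Comp C (Comp C f g) h = Comp C f (Comp C g h)" using that SD TD by simp
    show "Comp C g h \<in> T f" using TD(4) that by simp
  qed (fact that)
  then have R: "is_sieve X R"
    using SD coversD[OF T(1)] by (fastforce simp: is_sieve_def R_def)
  have "covers X R"
  proof (rule covers_trans[OF S R])
    fix f assume f: "f \<in> S"
    show "covers (Dom C f) (pull f R)"
    proof (rule covers_superset[OF T(1)[OF f]])
      show "is_sieve (Dom C f) (pull f R)" using is_sieve_pull[of f R] R SD f by simp
      show "T f \<subseteq> pull f R" using coversD[OF T(1)[OF f]] f by (auto simp: pull_def R_def)
    qed
  qed
  moreover have "\<forall>f \<in> R. \<Phi> f" using T by (auto simp: R_def)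
  ultimately show ?thesis by (auto simp: loc_def)
qed

lemma loc_conj:
  assumes "loc X \<Phi>" "loc X \<Psi>"
  shows "loc X (\<lambda>f. \<Phi> f \<and> \<Psi> f)"
proof (rule loc_bind)
  obtain S where S: "covers X S" "\<forall>f \<in> S. \<Phi> f" using assms by (auto simp: loc_def)
  have "loc (Dom C f) (\<lambda>g. \<Phi> (Comp C f g) \<and> \<Psi> (Comp C f g))" if f: "f \<in> S" for f
    by (rule loc_mono[OF loc_pull[of f \<Psi>]]) (use assms S coversD[OF S(1) f] in auto)
  then show "loc X (\<lambda>f. loc (Dom C f) (\<lambda>g. \<Phi> (Comp C f g) \<and> \<Psi> (Comp C f g)))"
    using S unfolding loc_def[of X] by blast
qed

lemma loc_finite_ball:
  assumes "finite I" "X \<in> Obj C" "\<And>i. i \<in> I \<Longrightarrow> loc X (\<Phi> i)"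
  shows "loc X (\<lambda>f. \<forall>i \<in> I. \<Phi> i f)"
  using assms(1,3)
proof (induction I)
  case empty
  then show ?case using assms(2) by (auto intro: loc_all)
next
  case (insert i I)
  then show ?case using loc_conj[of X "\<Phi> i" "\<lambda>f. \<forall>i \<in> I. \<Phi> i f"] by simp
qed

lemma loc_into_iff:
  assumes "is_sieve X S"
  shows "loc X (\<lambda>f. f \<in> S) \<longleftrightarrow> covers X S"
  using assms covers_superset unfolding loc_def by blast

text \<open>Unlike \<open>sheaves\<close>, this makes sense for values in any type, in particular for the sheafification
  before it is moved into the universe.\<close>

definition is_sheaf :: "('o, 'm, 'a) presheaf \<Rightarrow> bool" where
  "is_sheaf P \<longleftrightarrow> is_presheaf C P \<and> (\<forall>X S. covers X S \<longrightarrow> sheaf_on P X S)"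

lemma is_sheaf_is_presheaf: "is_sheaf P \<Longrightarrow> is_presheaf C P"
  by (simp add: is_sheaf_def)

lemma is_sheaf_universal: "is_sheaf P \<Longrightarrow> covers X S \<Longrightarrow> universal_sheaf_on P X S"
  using covers_pull by (auto simp: is_sheaf_def universal_sheaf_on_def)

lemma is_sheaf_sep:
  assumes P: "is_sheaf P" and s: "s \<in> At P X" and t: "t \<in> At P X"
    and l: "loc X (\<lambda>f. Act P f s = Act P f t)"
  shows "s = t"
proof -
  obtain S where "covers X S" "\<forall>f \<in> S. Act P f s = Act P f t" using l by (auto simp: loc_def)
  then show ?thesis using P s t sheaf_on_sep unfolding is_sheaf_def by metis
qed

lemma sheaves_iff: "P \<in> sheaves C J \<longleftrightarrow> P \<in> presheaves C \<and> is_sheaf P"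
proof -
  have "(\<forall>(X, K) \<in> J. restriction_bij C P X K) \<longleftrightarrow> (\<forall>X S. covers X S \<longrightarrow> sheaf_on P X S)"
    if P: "is_presheaf C P"
  proof (intro iffI allI impI ballI)
    fix X S assume "\<forall>(X, K) \<in> J. restriction_bij C P X K" "covers X S"
    then show "sheaf_on P X S" using restriction_bij_iff[OF P, of X S] unfolding covers_def by blast
  next
    fix t assume all: "\<forall>X S. covers X S \<longrightarrow> sheaf_on P X S" and t: "t \<in> J"
    obtain X K where XK: "t = (X, K)" by (cases t)
    then obtain S where S: "covers X S" "K = sieve_of S" using t by (auto elim: JE)
    then have "restriction_bij C P X K"
      using all restriction_bij_iff[OF P, of X S] unfolding covers_def by blast
    then show "case t of (X, K) \<Rightarrow> restriction_bij C P X K" using XK by simp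
  qed
  then show ?thesis by (auto simp: sheaves_def is_sheaf_def)
qed

lemma F_R_iff: "P \<in> F_R C J \<longleftrightarrow> P \<in> presheaves C \<and> is_sheaf P"
proof -
  have "(\<forall>t \<in> J. (t, P) \<in> duality_rel C) \<longleftrightarrow> (\<forall>X S. covers X S \<longrightarrow> sheaf_on P X S)"
    if P: "P \<in> presheaves C"
  proof (intro iffI allI impI ballI)
    fix X S assume "\<forall>t \<in> J. (t, P) \<in> duality_rel C" and c: "covers X S"
    then have "universal_sheaf_on P X S" by (auto simp: covers_def duality_rel_iff)
    then show "sheaf_on P X S" using c by (auto simp: covers_def intro: universal_sheaf_on_sheaf_on)
  next
    fix t assume all: "\<forall>X S. covers X S \<longrightarrow> sheaf_on P X S" and "t \<in> J"
    then obtain X S where "t = (X, sieve_of S)" and c: "covers X S" by (cases t) (auto elim!: JE)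
    moreover have "universal_sheaf_on P X S"
      using is_sheaf_universal[of P, OF _ c] all P by (simp add: is_sheaf_def)
    ultimately show "(t, P) \<in> duality_rel C" using P by (auto simp: covers_def duality_rel_iff)
  qed
  then show ?thesis by (auto simp: F_R_def is_sheaf_def)
qed

end

context category
begin

lemma compatible_trans_image:
  assumes "\<alpha> \<in> nat_trans C P Q" "compatible P S \<phi>" "is_sieve X S"
  shows "compatible Q S (\<lambda>f. \<alpha> (Dom C f) (\<phi> f))"
  unfolding compatible_def
proof (intro conjI ballI impI)
  fix f assume f: "f \<in> S"
  note fD = is_sieveD[OF assms(3) f]
  have \<phi>f: "\<phi> f \<in> At P (Dom C f)" using assms(2) f by (simp add: compatible_def)
  then show "\<alpha> (Dom C f) (\<phi> f) \<in> At Q (Dom C f)" using nat_trans_in[OF assms(1)] fD by simp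
  fix g assume g: "g \<in> Mor C" "Cod C g = Dom C f"
  have "\<phi> (Comp C f g) = Act P g (\<phi> f)" using assms(2) f g by (simp add: compatible_def)
  then show "\<alpha> (Dom C (Comp C f g)) (\<phi> (Comp C f g)) = Act Q g (\<alpha> (Dom C f) (\<phi> f))"
    using nat_trans_natural[OF assms(1) g(1)] g fD \<phi>f by simp
qed

lemma sheaf_on_iso:
  assumes Q: "is_presheaf C Q" and P: "is_presheaf C P"
    and \<alpha>: "\<alpha> \<in> nat_trans C P Q" and bij: "\<And>X. X \<in> Obj C \<Longrightarrow> bij_betw (\<alpha> X) (At P X) (At Q X)"
    and S: "is_sieve X S" "X \<in> Obj C" and sh: "sheaf_on P X S"
  shows "sheaf_on Q X S"
proof -
  define \<beta> where "\<beta> = ext_trans C Q (\<lambda>X. inv_into (At P X) (\<alpha> X))"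
  have \<beta>: "\<beta> \<in> nat_trans C Q P" unfolding \<beta>_def by (rule inverse_trans[OF P Q \<alpha> bij])
  have \<alpha>\<beta>: "\<alpha> Y (\<beta> Y t) = t" if "Y \<in> Obj C" "t \<in> At Q Y" for Y t
    using that bij[of Y] by (auto simp: \<beta>_def bij_betw_def f_inv_into_f)
  note SD = is_sieveD[OF S(1)]
  show ?thesis
    unfolding sheaf_on_def separated_on_def
  proof (intro conjI ballI allI impI)
    fix s t assume s: "s \<in> At Q X" and t: "t \<in> At Q X" and eq: "\<forall>f \<in> S. Act Q f s = Act Q f t"
    have "\<beta> X s = \<beta> X t"
    proof (rule sheaf_on_sep[OF sh])
      fix f assume f: "f \<in> S"
      then show "Act P f (\<beta> X s) = Act P f (\<beta> X t)"
        using eq s t SD[OF f] nat_trans_natural[OF \<beta>, of f s] nat_trans_natural[OF \<beta>, of f t] by simp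
    qed (use s t S nat_trans_in[OF \<beta>] in auto)
    then show "s = t" using \<alpha>\<beta> s t S by metis
  next
    fix \<phi> assume \<phi>: "compatible Q S \<phi>"
    then obtain s where s: "s \<in> At P X" "\<forall>f \<in> S. Act P f s = \<beta> (Dom C f) (\<phi> f)"
      using sh compatible_trans_image[OF \<beta> \<phi> S(1)] by (auto simp: sheaf_on_def)
    have "Act Q f (\<alpha> X s) = \<phi> f" if f: "f \<in> S" for f
      using nat_trans_natural[OF \<alpha>, of f s] s SD[OF f] f \<alpha>\<beta> \<phi> by (auto simp: compatible_def)
    then show "\<exists>s \<in> At Q X. \<forall>f \<in> S. Act Q f s = \<phi> f"
      using nat_trans_in[OF \<alpha> S(2) s(1)] by blast
  qed
qed

end

lemma (in topology) is_sheaf_iso: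
  assumes "is_sheaf P" "is_presheaf C Q" "\<alpha> \<in> nat_trans C P Q"
    "\<And>X. X \<in> Obj C \<Longrightarrow> bij_betw (\<alpha> X) (At P X) (At Q X)"
  shows "is_sheaf Q"
  using assms sheaf_on_iso[OF assms(2) _ assms(3,4)] by (auto simp: is_sheaf_def covers_def)

section \<open>Sheafification\<close>

context topology
begin

definition loc_eq :: "('o, 'm, 'a) presheaf \<Rightarrow> 'o \<Rightarrow> 'a \<Rightarrow> 'a \<Rightarrow> bool" where
  "loc_eq P X s t \<longleftrightarrow> loc X (\<lambda>f. Act P f s = Act P f t)"

lemma loc_eq_refl: "X \<in> Obj C \<Longrightarrow> loc_eq P X s s"
  by (simp add: loc_eq_def loc_all)

lemma loc_eq_trans_image:
  assumes "\<alpha> \<in> nat_trans C P Q" "loc_eq P X s t" "s \<in> At P X" "t \<in> At P X"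
  shows "loc_eq Q X (\<alpha> X s) (\<alpha> X t)"
  unfolding loc_eq_def
proof (rule loc_mono)
  show "loc X (\<lambda>f. Act P f s = Act P f t)" using assms by (simp add: loc_eq_def)
  show "Act Q f (\<alpha> X s) = Act Q f (\<alpha> X t)"
    if "f \<in> Mor C" "Cod C f = X" "Act P f s = Act P f t" for f
    using nat_trans_natural[OF assms(1) that(1), of s] nat_trans_natural[OF assms(1) that(1), of t]
      that assms(3,4) by simp
qed

lemma is_sheaf_loc_eq:
  "is_sheaf P \<Longrightarrow> loc_eq P X s t \<Longrightarrow> s \<in> At P X \<Longrightarrow> t \<in> At P X \<Longrightarrow> s = t"
  by (auto simp: loc_eq_def intro: is_sheaf_sep)

text \<open>A section over \<open>X\<close> of the associated sheaf is represented by a canonical object, the set of all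
  pairs \<open>(f, s)\<close> such that \<open>s\<close> represents its restriction along \<open>f\<close>.  Such sets are the
  closed subpresheaves of \<open>y(X) \<times> P\<close> that are functional up to local equality and whose domain
  covers \<open>X\<close>; no quotient and no iteration of a plus construction is needed.\<close>

definition pairs :: "('o, 'm, 'a) presheaf \<Rightarrow> 'o \<Rightarrow> ('m \<times> 'a) set" where
  "pairs P X = {(f, s). f \<in> Mor C \<and> Cod C f = X \<and> s \<in> At P (Dom C f)}"

definition presection :: "('o, 'm, 'a) presheaf \<Rightarrow> 'o \<Rightarrow> ('m \<times> 'a) set \<Rightarrow> bool" where
  "presection P X B \<longleftrightarrow> X \<in> Obj C \<and> B \<subseteq> pairs P X \<and>
    (\<forall>f s g. (f, s) \<in> B \<and> g \<in> Mor C \<and> Cod C g = Dom C f \<longrightarrow> (Comp C f g, Act P g s) \<in> B) \<and>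
    (\<forall>f s t. (f, s) \<in> B \<and> (f, t) \<in> B \<longrightarrow> loc_eq P (Dom C f) s t) \<and>
    loc X (\<lambda>f. \<exists>s. (f, s) \<in> B)"

definition closed_under :: "('o, 'm, 'a) presheaf \<Rightarrow> 'o \<Rightarrow> ('m \<times> 'a) set \<Rightarrow> bool" where
  "closed_under P X B \<longleftrightarrow> (\<forall>(f, s) \<in> pairs P X.
    loc (Dom C f) (\<lambda>g. (Comp C f g, Act P g s) \<in> B) \<longrightarrow> (f, s) \<in> B)"

definition is_section :: "('o, 'm, 'a) presheaf \<Rightarrow> 'o \<Rightarrow> ('m \<times> 'a) set \<Rightarrow> bool" where
  "is_section P X G \<longleftrightarrow> presection P X G \<and> closed_under P X G"

definition closure :: "('o, 'm, 'a) presheaf \<Rightarrow> 'o \<Rightarrow> ('m \<times> 'a) set \<Rightarrow> ('m \<times> 'a) set" where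
  "closure P X B = {(f, s) \<in> pairs P X. loc (Dom C f) (\<lambda>g. (Comp C f g, Act P g s) \<in> B)}"

definition res :: "'m \<Rightarrow> ('m \<times> 'a) set \<Rightarrow> ('m \<times> 'a) set" where
  "res x G = {(g, t). g \<in> Mor C \<and> Cod C g = Dom C x \<and> (Comp C x g, t) \<in> G}"

lemma presectionI:
  assumes "X \<in> Obj C"
    "\<And>f s. (f, s) \<in> B \<Longrightarrow> f \<in> Mor C \<and> Cod C f = X \<and> s \<in> At P (Dom C f)"
    "\<And>f s g. (f, s) \<in> B \<Longrightarrow> g \<in> Mor C \<Longrightarrow> Cod C g = Dom C f \<Longrightarrow> (Comp C f g, Act P g s) \<in> B"
    "\<And>f s t. (f, s) \<in> B \<Longrightarrow> (f, t) \<in> B \<Longrightarrow> loc_eq P (Dom C f) s t"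
    "loc X (\<lambda>f. \<exists>s. (f, s) \<in> B)"
  shows "presection P X B"
  using assms unfolding presection_def pairs_def by blast

lemma presectionD:
  assumes "presection P X B"
  shows "X \<in> Obj C" "(f, s) \<in> B \<Longrightarrow> f \<in> Mor C" "(f, s) \<in> B \<Longrightarrow> Cod C f = X"
    "(f, s) \<in> B \<Longrightarrow> s \<in> At P (Dom C f)"
    "(f, s) \<in> B \<Longrightarrow> g \<in> Mor C \<Longrightarrow> Cod C g = Dom C f \<Longrightarrow> (Comp C f g, Act P g s) \<in> B"
    "(f, s) \<in> B \<Longrightarrow> (f, t) \<in> B \<Longrightarrow> loc_eq P (Dom C f) s t"
    "loc X (\<lambda>f. \<exists>s. (f, s) \<in> B)"
  using assms unfolding presection_def pairs_def by blast+

lemma is_section_presection: "is_section P X G \<Longrightarrow> presection P X G"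
  by (simp add: is_section_def)

lemmas is_sectionD = presectionD[OF is_section_presection]

lemma is_section_closed:
  assumes "is_section P X G" "f \<in> Mor C" "Cod C f = X" "s \<in> At P (Dom C f)"
    "loc (Dom C f) (\<lambda>g. (Comp C f g, Act P g s) \<in> G)"
  shows "(f, s) \<in> G"
  using assms unfolding is_section_def closed_under_def pairs_def by blast

text \<open>Functionality and local totality leave no room between nested sections, so an inclusion
  suffices for an equality.\<close>

lemma section_subset_eq:
  assumes P: "is_presheaf C P" and G: "presection P X G" and H: "is_section P X H"
    and sub: "H \<subseteq> G" and G': "is_section P X G"
  shows "H = G"
proof
  show "G \<subseteq> H"
  proof clarify
    fix f s assume fs: "(f, s) \<in> G"
    note fD = presectionD(2-4)[OF G fs]
    show "(f, s) \<in> H"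
    proof (rule is_section_closed[OF H])
      have "loc (Dom C f) (\<lambda>g. \<exists>t. (Comp C f g, t) \<in> H)"
        using loc_pull[of f "\<lambda>g. \<exists>t. (g, t) \<in> H"] is_sectionD(7)[OF H] fD by simp
      then have "loc (Dom C f) (\<lambda>g. loc (Dom C g) (\<lambda>h. (Comp C f (Comp C g h), Act P (Comp C g h) s) \<in> H))"
      proof (rule loc_mono)
        fix g assume g: "g \<in> Mor C" "Cod C g = Dom C f" "\<exists>t. (Comp C f g, t) \<in> H"
        then obtain t where t: "(Comp C f g, t) \<in> H" by blast
        have tP: "t \<in> At P (Dom C g)" using is_sectionD(4)[OF H t] g fD by simp
        have "(Comp C f g, Act P g s) \<in> G" using presectionD(5)[OF G fs] g by simp
        then have "loc_eq P (Dom C g) t (Act P g s)"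
          using presectionD(6)[OF G, of "Comp C f g" t] t sub g fD by auto
        then show "loc (Dom C g) (\<lambda>h. (Comp C f (Comp C g h), Act P (Comp C g h) s) \<in> H)"
          unfolding loc_eq_def
        proof (rule loc_mono)
          fix h assume h: "h \<in> Mor C" "Cod C h = Dom C g" "Act P h t = Act P h (Act P g s)"
          show "(Comp C f (Comp C g h), Act P (Comp C g h) s) \<in> H"
            using is_sectionD(5)[OF H t, of h] h g fD P by simp
        qed
      qed
      then show "loc (Dom C f) (\<lambda>g. (Comp C f g, Act P g s) \<in> H)"
        by (rule loc_bind)
    qed (use fD in auto)
  qed
qed fact

lemma closure_superset:
  assumes "presection P X B"
  shows "B \<subseteq> closure P X B"
  using presectionD[OF assms] by (auto simp: closure_def pairs_def intro!: loc_all)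

lemma is_section_closure:
  assumes P: "is_presheaf C P" and B: "presection P X B"
  shows "is_section P X (closure P X B)"
  unfolding is_section_def
proof
  note BD = presectionD[OF B]
  show "presection P X (closure P X B)"
  proof (rule presectionI)
    fix f s assume "(f, s) \<in> closure P X B"
    then show fD: "f \<in> Mor C \<and> Cod C f = X \<and> s \<in> At P (Dom C f)"
      by (auto simp: closure_def pairs_def)
    have l: "loc (Dom C f) (\<lambda>g. (Comp C f g, Act P g s) \<in> B)"
      using \<open>(f, s) \<in> closure P X B\<close> by (simp add: closure_def)
    {
      fix g assume g: "g \<in> Mor C" "Cod C g = Dom C f"
      have "loc (Dom C g) (\<lambda>h. (Comp C f (Comp C g h), Act P (Comp C g h) s) \<in> B)"
        using loc_pull[of g "\<lambda>g. (Comp C f g, Act P g s) \<in> B"] l g by simp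
      then have "loc (Dom C g) (\<lambda>h. (Comp C (Comp C f g) h, Act P h (Act P g s)) \<in> B)"
        by (rule loc_mono) (use g fD P in simp)
      then show "(Comp C f g, Act P g s) \<in> closure P X B"
        using g fD P by (simp add: closure_def pairs_def)
    }
    fix t assume "(f, t) \<in> closure P X B"
    then have t: "t \<in> At P (Dom C f)" "loc (Dom C f) (\<lambda>g. (Comp C f g, Act P g t) \<in> B)"
      by (auto simp: closure_def pairs_def)
    have "loc (Dom C f) (\<lambda>g. loc (Dom C g) (\<lambda>h. Act P (Comp C g h) s = Act P (Comp C g h) t))"
    proof (rule loc_mono[OF loc_conj[OF l t(2)]])
      fix g assume g: "g \<in> Mor C" "Cod C g = Dom C f"
        and b: "(Comp C f g, Act P g s) \<in> B \<and> (Comp C f g, Act P g t) \<in> B"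
      have "loc_eq P (Dom C g) (Act P g s) (Act P g t)"
        using BD(6)[of "Comp C f g" "Act P g s" "Act P g t"] b g fD by simp
      then show "loc (Dom C g) (\<lambda>h. Act P (Comp C g h) s = Act P (Comp C g h) t)"
        unfolding loc_eq_def by (rule loc_mono) (use g fD t P in simp)
    qed
    then show "loc_eq P (Dom C f) s t"
      unfolding loc_eq_def by (rule loc_bind)
  next
    show "loc X (\<lambda>f. \<exists>s. (f, s) \<in> closure P X B)"
      by (rule loc_mono[OF BD(7)]) (use closure_superset[OF B] in blast)
  qed (fact BD)
  show "closed_under P X (closure P X B)"
    unfolding closed_under_def
  proof clarify
    fix f s assume fs: "(f, s) \<in> pairs P X"
      and l: "loc (Dom C f) (\<lambda>g. (Comp C f g, Act P g s) \<in> closure P X B)"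
    have fD: "f \<in> Mor C" "Cod C f = X" "s \<in> At P (Dom C f)" using fs by (auto simp: pairs_def)
    have "loc (Dom C f) (\<lambda>g. loc (Dom C g) (\<lambda>h. (Comp C f (Comp C g h), Act P (Comp C g h) s) \<in> B))"
    proof (rule loc_mono[OF l])
      fix g assume g: "g \<in> Mor C" "Cod C g = Dom C f" "(Comp C f g, Act P g s) \<in> closure P X B"
      then have "loc (Dom C g) (\<lambda>h. (Comp C (Comp C f g) h, Act P h (Act P g s)) \<in> B)"
        using fD by (simp add: closure_def)
      then show "loc (Dom C g) (\<lambda>h. (Comp C f (Comp C g h), Act P (Comp C g h) s) \<in> B)"
        by (rule loc_mono) (use g fD P in simp)
    qed
    then have "loc (Dom C f) (\<lambda>g. (Comp C f g, Act P g s) \<in> B)" by (rule loc_bind)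
    then show "(f, s) \<in> closure P X B" using fs by (simp add: closure_def)
  qed
qed

lemma closure_eqI:
  assumes P: "is_presheaf C P" and B: "presection P X B" and G: "is_section P X G" and sub: "B \<subseteq> G"
  shows "closure P X B = G"
proof (rule section_subset_eq[OF P is_section_presection[OF G] is_section_closure[OF P B] _ G])
  show "closure P X B \<subseteq> G"
  proof clarify
    fix f s assume "(f, s) \<in> closure P X B"
    then have "f \<in> Mor C" "Cod C f = X" "s \<in> At P (Dom C f)"
      "loc (Dom C f) (\<lambda>g. (Comp C f g, Act P g s) \<in> B)"
      by (auto simp: closure_def pairs_def)
    then show "(f, s) \<in> G"
      using sub by (intro is_section_closed[OF G]) (auto elim: loc_mono)
  qed
qed

lemma section_eqI:
  assumes P: "is_presheaf C P" and G: "is_section P X G" and H: "is_section P X H" and sub: "G \<subseteq> H"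
  shows "G = H"
  using section_subset_eq[OF P is_section_presection[OF H] G sub H] .

lemma is_section_res:
  assumes P: "is_presheaf C P" and G: "is_section P (Cod C x) G" and x: "x \<in> Mor C"
  shows "is_section P (Dom C x) (res x G)"
  unfolding is_section_def
proof
  note GD = is_sectionD[OF G]
  have wf: "f \<in> Mor C \<and> Cod C f = Dom C x \<and> s \<in> At P (Dom C f)" if "(f, s) \<in> res x G" for f s
    using that GD(4)[of "Comp C x f" s] x by (auto simp: res_def)
  show "presection P (Dom C x) (res x G)"
  proof (rule presectionI)
    fix f s g assume "(f, s) \<in> res x G" "g \<in> Mor C" "Cod C g = Dom C f"
    then show "(Comp C f g, Act P g s) \<in> res x G"
      using GD(5)[of "Comp C x f" s g] x by (auto simp: res_def)
  next
    fix f s t assume "(f, s) \<in> res x G" "(f, t) \<in> res x G"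
    then show "loc_eq P (Dom C f) s t"
      using GD(6)[of "Comp C x f" s t] x by (auto simp: res_def)
  next
    have "loc (Dom C x) (\<lambda>f. \<exists>s. (Comp C x f, s) \<in> G)"
      by (rule loc_pull[OF GD(7) x])
    then show "loc (Dom C x) (\<lambda>f. \<exists>s. (f, s) \<in> res x G)"
      by (rule loc_mono) (auto simp: res_def)
  qed (use x wf in auto)
  show "closed_under P (Dom C x) (res x G)"
    unfolding closed_under_def
  proof clarify
    fix f s assume fs: "(f, s) \<in> pairs P (Dom C x)"
      and l: "loc (Dom C f) (\<lambda>g. (Comp C f g, Act P g s) \<in> res x G)"
    then have f: "f \<in> Mor C" "Cod C f = Dom C x" "s \<in> At P (Dom C f)" by (auto simp: pairs_def)
    have "(Comp C x f, s) \<in> G"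
    proof (rule is_section_closed[OF G])
      show "loc (Dom C (Comp C x f)) (\<lambda>g. (Comp C (Comp C x f) g, Act P g s) \<in> G)"
        using f x l by (auto simp: res_def elim!: loc_mono)
    qed (use f x in auto)
    then show "(f, s) \<in> res x G" using f by (simp add: res_def)
  qed
qed

lemma res_Id: "is_section P X G \<Longrightarrow> res (Id C X) G = G"
  using is_sectionD by (fastforce simp: res_def)

lemma res_res:
  assumes "f \<in> Mor C" "g \<in> Mor C" "Cod C f = Dom C g"
  shows "res f (res g G) = res (Comp C g f) G"
  using assms by (auto simp: res_def)

definition sheafify :: "('o, 'm, 'a) presheaf \<Rightarrow> ('o, 'm, ('m \<times> 'a) set) presheaf" where
  "sheafify P =
    \<lparr>At = (\<lambda>X \<in> Obj C. {G. is_section P X G}),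
     Act = (\<lambda>x \<in> Mor C. \<lambda>G \<in> {G. is_section P (Cod C x) G}. res x G)\<rparr>"

lemma At_sheafify [simp]: "X \<in> Obj C \<Longrightarrow> At (sheafify P) X = {G. is_section P X G}"
  by (simp add: sheafify_def)

lemma Act_sheafify [simp]:
  "x \<in> Mor C \<Longrightarrow> is_section P (Cod C x) G \<Longrightarrow> Act (sheafify P) x G = res x G"
  by (simp add: sheafify_def)

lemma is_presheaf_sheafify:
  assumes "is_presheaf C P"
  shows "is_presheaf C (sheafify P)"
  unfolding is_presheaf_def
proof (intro conjI ballI impI)
  show "Act (sheafify P) \<in> (\<Pi>\<^sub>E f \<in> Mor C. At (sheafify P) (Cod C f) \<rightarrow>\<^sub>E At (sheafify P) (Dom C f))"
    using is_section_res[OF assms] by (auto simp: PiE_iff) (auto simp: sheafify_def)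
next
  fix f g G assume "f \<in> Mor C" "g \<in> Mor C" "Cod C f = Dom C g" "G \<in> At (sheafify P) (Cod C g)"
  then show "Act (sheafify P) (Comp C g f) G = Act (sheafify P) f (Act (sheafify P) g G)"
    using is_section_res[OF assms, of g G] by (simp add: res_res)
qed (simp_all add: res_Id, simp add: sheafify_def)

subsection \<open>The unit\<close>

definition unit :: "('o, 'm, 'a) presheaf \<Rightarrow> 'o \<Rightarrow> 'a \<Rightarrow> ('m \<times> 'a) set" where
  "unit P = ext_trans C P (\<lambda>X s. closure P X {(f, Act P f s) | f. f \<in> into X})"

lemma presection_principal:
  assumes "is_presheaf C P" "X \<in> Obj C" "s \<in> At P X"
  shows "presection P X {(f, Act P f s) | f. f \<in> into X}"
  by (rule presectionI) (use assms in \<open>auto simp: into_def loc_eq_refl intro!: loc_all\<close>)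

lemma is_section_unit:
  assumes "is_presheaf C P" "X \<in> Obj C" "s \<in> At P X"
  shows "is_section P X (unit P X s)"
  using is_section_closure[OF assms(1) presection_principal[OF assms]] assms
  by (simp add: unit_def)

lemma unit_eq_iff:
  assumes P: "is_presheaf C P" and G: "is_section P X G" and s: "s \<in> At P X"
  shows "unit P X s = G \<longleftrightarrow> (Id C X, s) \<in> G"
proof
  have X: "X \<in> Obj C" using is_sectionD(1)[OF G] .
  note pre = presection_principal[OF P X s]
  {
    assume "unit P X s = G"
    moreover have "(Id C X, Act P (Id C X) s) \<in> unit P X s"
      using closure_superset[OF pre] X s by (auto simp: unit_def into_def)
    ultimately show "(Id C X, s) \<in> G" using P X s by simp
  next
    assume G1: "(Id C X, s) \<in> G"
    have "(f, Act P f s) \<in> G" if "f \<in> into X" for f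
      using is_sectionD(5)[OF G G1, of f] that X by (simp add: into_def)
    then show "unit P X s = G" using closure_eqI[OF P pre G] X s by (auto simp: unit_def)
  }
qed

lemma unit_res_iff:
  assumes P: "is_presheaf C P" and G: "is_section P (Cod C f) G" and f: "f \<in> Mor C"
    and t: "t \<in> At P (Dom C f)"
  shows "unit P (Dom C f) t = res f G \<longleftrightarrow> (f, t) \<in> G"
  using unit_eq_iff[OF P is_section_res[OF P G f] t] f by (auto simp: res_def)

lemma unit_in:
  assumes P: "is_presheaf C P"
  shows "unit P \<in> nat_trans C P (sheafify P)"
proof -
  have "unit P = ext_trans C P (unit P)" by (simp add: unit_def ext_trans_def cong: restrict_cong)
  moreover have "ext_trans C P (unit P) \<in> nat_trans C P (sheafify P)"
  proof (rule ext_trans_in[OF _ _ P])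
    show "unit P X s \<in> At (sheafify P) X" if "X \<in> Obj C" "s \<in> At P X" for X s
      using that is_section_unit[OF P] by simp
    fix f s assume f: "f \<in> Mor C" and s: "s \<in> At P (Cod C f)"
    have sec: "is_section P (Cod C f) (unit P (Cod C f) s)" using f s is_section_unit[OF P] by simp
    then have "(Id C (Cod C f), s) \<in> unit P (Cod C f) s" using unit_eq_iff[OF P _ s] by blast
    from is_sectionD(5)[OF sec this, of f] have "(f, Act P f s) \<in> unit P (Cod C f) s" using f by simp
    then show "unit P (Dom C f) (Act P f s) = Act (sheafify P) f (unit P (Cod C f) s)"
      using unit_res_iff[OF P sec f, of "Act P f s"] f s P sec by simp
  qed
  ultimately show ?thesis by simp
qed

lemma unit_eq_unit:
  assumes P: "is_presheaf C P" and X: "X \<in> Obj C" and s: "s \<in> At P X" and t: "t \<in> At P X"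
    and eq: "unit P X s = unit P X t"
  shows "loc_eq P X s t"
proof -
  have "(Id C X, s) \<in> unit P X s" "(Id C X, t) \<in> unit P X s"
    using unit_eq_iff[OF P is_section_unit[OF P X s]] s t eq by auto
  then show ?thesis using is_sectionD(6)[OF is_section_unit[OF P X s], of "Id C X" s t] X by simp
qed

subsection \<open>The sheaf property\<close>

text \<open>Separatedness is the closedness of sections.  A compatible family \<open>\<phi>\<close> is glued by collecting the
  pairs \<open>(f, t)\<close> in which \<open>t\<close> represents the whole of \<open>\<phi> f\<close>.\<close>

lemma is_sheaf_sheafify:
  assumes P: "is_presheaf C P"
  shows "is_sheaf (sheafify P)"
  unfolding is_sheaf_def
proof (intro conjI allI impI is_presheaf_sheafify[OF P])
  fix X S assume S: "covers X S"
  have X: "X \<in> Obj C" using S by (simp add: covers_def)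
  note SD = coversD[OF S]
  show "sheaf_on (sheafify P) X S"
    unfolding sheaf_on_def separated_on_def
  proof (intro conjI ballI allI impI)
    fix G H assume "G \<in> At (sheafify P) X" "H \<in> At (sheafify P) X"
      and eq: "\<forall>f \<in> S. Act (sheafify P) f G = Act (sheafify P) f H"
    then have G: "is_section P X G" and H: "is_section P X H" using X by auto
    have res: "res f G = res f H" if "f \<in> S" for f
      using that eq SD[OF that] G H by auto
    have "G \<subseteq> H"
    proof clarify
      fix f s assume fs: "(f, s) \<in> G"
      note fD = is_sectionD(2-4)[OF G fs]
      have "covers (Dom C f) (pull f S)" using covers_pull S fD by simp
      moreover have "(Comp C f g, Act P g s) \<in> H" if "g \<in> pull f S" for g
      proof -
        have g: "g \<in> Mor C" "Cod C g = Dom C f" "Comp C f g \<in> S" using that by (auto simp: pull_def)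
        have "(Id C (Dom C g), Act P g s) \<in> res (Comp C f g) G"
          using is_sectionD(5)[OF G fs g(1,2)] g fD by (simp add: res_def)
        then have "(Id C (Dom C g), Act P g s) \<in> res (Comp C f g) H" unfolding res[OF g(3)] .
        then show ?thesis using g fD by (simp add: res_def)
      qed
      ultimately show "(f, s) \<in> H"
        using fD by (intro is_section_closed[OF H]) (auto simp: loc_def)
    qed
    then show "G = H" by (rule section_eqI[OF P G H])
  next
    fix \<phi> assume \<phi>: "compatible (sheafify P) S \<phi>"
    have sec: "is_section P (Dom C f) (\<phi> f)" if "f \<in> S" for f
      using \<phi> that SD(3)[OF that] by (auto simp: compatible_def)
    have res: "\<phi> (Comp C f g) = res g (\<phi> f)" if "f \<in> S" "g \<in> Mor C" "Cod C g = Dom C f" for f g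
      using \<phi> that sec[OF that(1)] by (simp add: compatible_def)
    define B where "B = {(f, t). f \<in> S \<and> (Id C (Dom C f), t) \<in> \<phi> f}"
    have mem: "(Comp C f g, t) \<in> B" if "f \<in> S" "(g, t) \<in> \<phi> f" for f g t
    proof -
      note g = is_sectionD(2-4)[OF sec[OF that(1)] that(2)]
      show ?thesis
        using that g SD[OF that(1)] res[OF that(1), of g] by (simp add: B_def res_def)
    qed
    have B: "presection P X B"
    proof (rule presectionI[OF X])
      fix f s assume "(f, s) \<in> B"
      then have f: "f \<in> S" and s: "(Id C (Dom C f), s) \<in> \<phi> f" by (auto simp: B_def)
      note fD = SD[OF f]
      show "f \<in> Mor C \<and> Cod C f = X \<and> s \<in> At P (Dom C f)"
        using fD is_sectionD(4)[OF sec[OF f] s] by simp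
      show "(Comp C f g, Act P g s) \<in> B" if "g \<in> Mor C" "Cod C g = Dom C f" for g
        using is_sectionD(5)[OF sec[OF f] s, of g] that fD by (intro mem[OF f]) simp
      fix t assume "(f, t) \<in> B"
      then show "loc_eq P (Dom C f) s t"
        using is_sectionD(6)[OF sec[OF f] s] fD by (simp add: B_def)
    next
      have "loc (Dom C f) (\<lambda>g. \<exists>s. (Comp C f g, s) \<in> B)" if f: "f \<in> S" for f
        by (rule loc_mono[OF is_sectionD(7)[OF sec[OF f]]]) (use mem[OF f] in blast)
      then have "loc X (\<lambda>f. loc (Dom C f) (\<lambda>g. \<exists>s. (Comp C f g, s) \<in> B))"
        using S unfolding loc_def[of X] by blast
      then show "loc X (\<lambda>f. \<exists>s. (f, s) \<in> B)" by (rule loc_bind)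
    qed
    have G: "is_section P X (closure P X B)" by (rule is_section_closure[OF P B])
    have "Act (sheafify P) f (closure P X B) = \<phi> f" if f: "f \<in> S" for f
    proof -
      note fD = SD[OF f]
      have "\<phi> f \<subseteq> res f (closure P X B)"
        using mem[OF f] is_sectionD(2,3)[OF sec[OF f]] closure_superset[OF B] by (auto simp: res_def)
      then have "\<phi> f = res f (closure P X B)"
        using is_section_res[OF P _ fD(1), of "closure P X B"] G fD
        by (intro section_eqI[OF P sec[OF f]]) auto
      then show ?thesis using G fD by simp
    qed
    then show "\<exists>G \<in> At (sheafify P) X. \<forall>f \<in> S. Act (sheafify P) f G = \<phi> f"
      using G X by auto
  qed
qed

subsection \<open>Functoriality\<close>

definition sheafify_map ::
  "('o, 'm, 'a) presheaf \<Rightarrow> ('o, 'm, 'b) presheaf \<Rightarrow> ('o \<Rightarrow> 'a \<Rightarrow> 'b) \<Rightarrow>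
    'o \<Rightarrow> ('m \<times> 'a) set \<Rightarrow> ('m \<times> 'b) set" where
  "sheafify_map P Q \<alpha> = ext_trans C (sheafify P)
    (\<lambda>X G. closure Q X {(f, \<alpha> (Dom C f) s) | f s. (f, s) \<in> G})"

context
  fixes P :: "('o, 'm, 'a) presheaf" and Q :: "('o, 'm, 'b) presheaf" and \<alpha>
  assumes P: "is_presheaf C P" and Q: "is_presheaf C Q" and \<alpha>: "\<alpha> \<in> nat_trans C P Q"
begin

lemma presection_image:
  assumes G: "is_section P X G"
  shows "presection Q X {(f, \<alpha> (Dom C f) s) | f s. (f, s) \<in> G}" (is "presection Q X ?B")
proof (rule presectionI)
  note GD = is_sectionD[OF G]
  show "X \<in> Obj C" using GD by simp
  show "loc X (\<lambda>f. \<exists>s. (f, s) \<in> ?B)" by (rule loc_mono[OF GD(7)]) blast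
  fix f u assume "(f, u) \<in> ?B"
  then obtain s where s: "(f, s) \<in> G" "u = \<alpha> (Dom C f) s" by blast
  note f = GD(2-4)[OF s(1)]
  show "f \<in> Mor C \<and> Cod C f = X \<and> u \<in> At Q (Dom C f)"
    using f s nat_trans_in[OF \<alpha>] by auto
  show "(Comp C f g, Act Q g u) \<in> ?B" if g: "g \<in> Mor C" "Cod C g = Dom C f" for g
  proof -
    have "Act Q g u = \<alpha> (Dom C (Comp C f g)) (Act P g s)"
      using nat_trans_natural[OF \<alpha> g(1), of s] f s g by simp
    then show ?thesis using GD(5)[OF s(1) g] by blast
  qed
  fix v assume "(f, v) \<in> ?B"
  then obtain t where t: "(f, t) \<in> G" "v = \<alpha> (Dom C f) t" by blast
  then show "loc_eq Q (Dom C f) u v"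
    using loc_eq_trans_image[OF \<alpha> GD(6)[OF s(1) t(1)]] f GD(4)[OF t(1)] s by simp
qed

lemma is_section_sheafify_map:
  assumes G: "is_section P X G"
  shows "is_section Q X (sheafify_map P Q \<alpha> X G)"
  using is_section_closure[OF Q presection_image[OF G]] is_sectionD(1)[OF G] G
  by (simp add: sheafify_map_def)

lemma sheafify_map_eq_iff:
  assumes G: "is_section P X G" and H: "is_section Q X H"
  shows "sheafify_map P Q \<alpha> X G = H \<longleftrightarrow> (\<forall>f s. (f, s) \<in> G \<longrightarrow> (f, \<alpha> (Dom C f) s) \<in> H)"
proof -
  have eq: "sheafify_map P Q \<alpha> X G = closure Q X {(f, \<alpha> (Dom C f) s) | f s. (f, s) \<in> G}"
    using is_sectionD(1)[OF G] G by (simp add: sheafify_map_def)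
  show ?thesis
  proof
    assume "sheafify_map P Q \<alpha> X G = H"
    then show "\<forall>f s. (f, s) \<in> G \<longrightarrow> (f, \<alpha> (Dom C f) s) \<in> H"
      using closure_superset[OF presection_image[OF G]] unfolding eq by blast
  next
    assume "\<forall>f s. (f, s) \<in> G \<longrightarrow> (f, \<alpha> (Dom C f) s) \<in> H"
    then show "sheafify_map P Q \<alpha> X G = H"
      unfolding eq by (intro closure_eqI[OF Q presection_image[OF G] H]) blast
  qed
qed

lemma sheafify_map_mem:
  assumes "is_section P X G" "(f, s) \<in> G"
  shows "(f, \<alpha> (Dom C f) s) \<in> sheafify_map P Q \<alpha> X G"
  using sheafify_map_eq_iff[OF assms(1) is_section_sheafify_map[OF assms(1)]] assms(2) by blast

lemma sheafify_map_in: "sheafify_map P Q \<alpha> \<in> nat_trans C (sheafify P) (sheafify Q)"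
proof -
  have "sheafify_map P Q \<alpha> = ext_trans C (sheafify P) (sheafify_map P Q \<alpha>)"
    by (simp add: sheafify_map_def ext_trans_def cong: restrict_cong)
  moreover have "ext_trans C (sheafify P) (sheafify_map P Q \<alpha>) \<in> nat_trans C (sheafify P) (sheafify Q)"
  proof (rule ext_trans_in[OF _ _ is_presheaf_sheafify[OF P]])
    show "sheafify_map P Q \<alpha> X G \<in> At (sheafify Q) X" if "X \<in> Obj C" "G \<in> At (sheafify P) X" for X G
      using that is_section_sheafify_map by simp
    fix x G assume x: "x \<in> Mor C" and "G \<in> At (sheafify P) (Cod C x)"
    then have G: "is_section P (Cod C x) G" by simp
    have "sheafify_map P Q \<alpha> (Dom C x) (res x G) = res x (sheafify_map P Q \<alpha> (Cod C x) G)"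
    proof (subst sheafify_map_eq_iff[OF is_section_res[OF P G x]
          is_section_res[OF Q is_section_sheafify_map[OF G] x]], intro allI impI)
      fix g s assume "(g, s) \<in> res x G"
      then show "(g, \<alpha> (Dom C g) s) \<in> res x (sheafify_map P Q \<alpha> (Cod C x) G)"
        using sheafify_map_mem[OF G, of "Comp C x g" s] x by (simp add: res_def)
    qed
    then show "sheafify_map P Q \<alpha> (Dom C x) (Act (sheafify P) x G) =
        Act (sheafify Q) x (sheafify_map P Q \<alpha> (Cod C x) G)"
      using G x is_section_sheafify_map by simp
  qed
  ultimately show ?thesis by simp
qed

lemma sheafify_map_unit:
  assumes "X \<in> Obj C" "s \<in> At P X"
  shows "sheafify_map P Q \<alpha> X (unit P X s) = unit Q X (\<alpha> X s)"
proof -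
  have sec: "is_section P X (unit P X s)" using is_section_unit[OF P] assms by simp
  have "(Id C X, s) \<in> unit P X s" using unit_eq_iff[OF P sec assms(2)] by simp
  from sheafify_map_mem[OF sec this] show ?thesis
    using unit_eq_iff[OF Q is_section_sheafify_map[OF sec], of "\<alpha> X s"] assms
      nat_trans_in[OF \<alpha>] by simp
qed

end

lemma sheafify_map_id:
  assumes P: "is_presheaf C P" and G: "is_section P X G"
  shows "sheafify_map P P (ext_trans C P (\<lambda>X s. s)) X G = G"
  using sheafify_map_eq_iff[OF P P id_trans_in[OF P] G G] is_sectionD(2,4)[OF G] by auto

lemma sheafify_map_comp:
  assumes P: "is_presheaf C P" and Q: "is_presheaf C Q" and R: "is_presheaf C R"
    and \<alpha>: "\<alpha> \<in> nat_trans C P Q" and \<beta>: "\<beta> \<in> nat_trans C Q R" and G: "is_section P X G"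
  shows "sheafify_map P R (ext_trans C P (\<lambda>X s. \<beta> X (\<alpha> X s))) X G =
    sheafify_map Q R \<beta> X (sheafify_map P Q \<alpha> X G)"
proof (subst sheafify_map_eq_iff[OF P R comp_trans_in[OF \<alpha> \<beta> P] G], goal_cases)
  case 1
  show ?case using is_section_sheafify_map[OF Q R \<beta> is_section_sheafify_map[OF P Q \<alpha> G]] .
next
  case 2
  show ?case
    using sheafify_map_mem[OF Q R \<beta> is_section_sheafify_map[OF P Q \<alpha> G] sheafify_map_mem[OF P Q \<alpha> G]]
      is_sectionD(2,4)[OF G] by auto
qed

subsection \<open>The universal property\<close>

context
  fixes P :: "('o, 'm, 'a) presheaf" and Q :: "('o, 'm, 'b) presheaf" and \<alpha>
  assumes P: "is_presheaf C P" and Q: "is_sheaf Q" and \<alpha>: "\<alpha> \<in> nat_trans C P Q"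
begin

definition glued :: "'o \<Rightarrow> ('m \<times> 'a) set \<Rightarrow> 'b \<Rightarrow> bool" where
  "glued X G q \<longleftrightarrow> q \<in> At Q X \<and> (\<forall>f s. (f, s) \<in> G \<longrightarrow> Act Q f q = \<alpha> (Dom C f) s)"

text \<open>Two representatives of \<open>G\<close> at the same arrow are locally equal, so they have the same image in the
  separated presheaf \<open>Q\<close>; these images form a compatible family on the domain of \<open>G\<close>.\<close>

lemma glued_ex1:
  assumes G: "is_section P X G"
  shows "\<exists>!q. glued X G q"
proof -
  note GD = is_sectionD[OF G]
  have QP: "is_presheaf C Q" using Q by (rule is_sheaf_is_presheaf)
  define S where "S = {f. \<exists>s. (f, s) \<in> G}"
  have sieve: "is_sieve X S" using GD(2,3,5) unfolding is_sieve_def S_def by blast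
  have cov: "covers X S" using GD(7) loc_into_iff[OF sieve] by (simp add: S_def)
  then have sh: "sheaf_on Q X S" using Q by (simp add: is_sheaf_def)
  define \<phi> where "\<phi> f = \<alpha> (Dom C f) (SOME s. (f, s) \<in> G)" for f
  have \<phi>: "\<phi> f = \<alpha> (Dom C f) s" if fs: "(f, s) \<in> G" for f s
  proof -
    define t where "t = (SOME s. (f, s) \<in> G)"
    have t: "(f, t) \<in> G" unfolding t_def using fs by (rule someI)
    have "loc_eq Q (Dom C f) (\<alpha> (Dom C f) t) (\<alpha> (Dom C f) s)"
      using loc_eq_trans_image[OF \<alpha> GD(6)[OF t fs]] GD(4) t fs by simp
    then show ?thesis
      using is_sheaf_loc_eq[OF Q] nat_trans_in[OF \<alpha>] GD(2,4)[OF t] GD(4)[OF fs]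
      by (simp add: \<phi>_def t_def[symmetric])
  qed
  obtain q where q: "q \<in> At Q X" "\<And>f. f \<in> S \<Longrightarrow> Act Q f q = \<phi> f"
  proof (rule sheaf_on_glue[OF sh, of \<phi>])
    fix f assume "f \<in> S"
    then obtain s where s: "(f, s) \<in> G" by (auto simp: S_def)
    note f = GD(2-4)[OF s]
    show "\<phi> f \<in> At Q (Dom C f)" using \<phi>[OF s] nat_trans_in[OF \<alpha>] f by simp
    fix g assume g: "g \<in> Mor C" "Cod C g = Dom C f"
    show "\<phi> (Comp C f g) = Act Q g (\<phi> f)"
      using \<phi>[OF s] \<phi>[OF GD(5)[OF s g]] nat_trans_natural[OF \<alpha> g(1), of s] f g by simp
  qed blast
  show ?thesis
  proof (rule ex1I)
    have "Act Q f q = \<alpha> (Dom C f) s" if "(f, s) \<in> G" for f s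
      using q(2)[of f] \<phi>[OF that] that by (auto simp: S_def)
    then show "glued X G q" using q by (simp add: glued_def)
    fix q' assume q': "glued X G q'"
    show "q' = q"
    proof (rule sheaf_on_sep[OF sh])
      fix f assume "f \<in> S"
      then obtain s where s: "(f, s) \<in> G" by (auto simp: S_def)
      then show "Act Q f q' = Act Q f q" using q' q(2)[OF \<open>f \<in> S\<close>] \<phi>[OF s] by (simp add: glued_def)
    qed (use q q' in \<open>simp_all add: glued_def\<close>)
  qed
qed

definition lift :: "'o \<Rightarrow> ('m \<times> 'a) set \<Rightarrow> 'b" where
  "lift = ext_trans C (sheafify P) (\<lambda>X G. THE q. glued X G q)"

lemma glued_lift:
  assumes "is_section P X G"
  shows "glued X G (lift X G)"
  using theI'[OF glued_ex1[OF assms]] is_sectionD(1)[OF assms] assms by (simp add: lift_def)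

lemma lift_eqI: "is_section P X G \<Longrightarrow> glued X G q \<Longrightarrow> lift X G = q"
  using glued_ex1 glued_lift by blast

lemma lift_in: "lift \<in> nat_trans C (sheafify P) Q"
proof -
  have "lift = ext_trans C (sheafify P) lift"
    by (simp add: lift_def ext_trans_def cong: restrict_cong)
  moreover have "ext_trans C (sheafify P) lift \<in> nat_trans C (sheafify P) Q"
  proof (rule ext_trans_in[OF _ _ is_presheaf_sheafify[OF P]])
    show "lift X G \<in> At Q X" if "X \<in> Obj C" "G \<in> At (sheafify P) X" for X G
      using that glued_lift[of X G] by (simp add: glued_def)
    fix x G assume x: "x \<in> Mor C" and "G \<in> At (sheafify P) (Cod C x)"
    then have G: "is_section P (Cod C x) G" by simp
    have "glued (Dom C x) (res x G) (Act Q x (lift (Cod C x) G))"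
      using glued_lift[OF G] x is_sheaf_is_presheaf[OF Q] by (auto simp: glued_def res_def)
    then show "lift (Dom C x) (Act (sheafify P) x G) = Act Q x (lift (Cod C x) G)"
      using lift_eqI[OF is_section_res[OF P G x]] x G by simp
  qed
  ultimately show ?thesis by simp
qed

lemma lift_unit:
  assumes "X \<in> Obj C" "s \<in> At P X"
  shows "lift X (unit P X s) = \<alpha> X s"
proof -
  have sec: "is_section P X (unit P X s)" using is_section_unit[OF P] assms by simp
  have "(Id C X, s) \<in> unit P X s" using unit_eq_iff[OF P sec assms(2)] by simp
  then have "Act Q (Id C X) (lift X (unit P X s)) = \<alpha> X s" "lift X (unit P X s) \<in> At Q X"
    using glued_lift[OF sec] assms by (auto simp: glued_def)
  then show ?thesis using assms is_sheaf_is_presheaf[OF Q] by simp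
qed

end

text \<open>Every section lies locally in the image of the unit.\<close>

lemma unit_epi:
  assumes P: "is_presheaf C P" and Q: "is_sheaf Q"
    and \<beta>: "\<beta> \<in> nat_trans C (sheafify P) Q" and \<gamma>: "\<gamma> \<in> nat_trans C (sheafify P) Q"
    and eq: "\<And>X s. X \<in> Obj C \<Longrightarrow> s \<in> At P X \<Longrightarrow> \<beta> X (unit P X s) = \<gamma> X (unit P X s)"
  shows "\<beta> = \<gamma>"
proof (rule nat_trans_eqI[OF \<beta> \<gamma>])
  fix X G assume X: "X \<in> Obj C" and "G \<in> At (sheafify P) X"
  then have G: "is_section P X G" by simp
  show "\<beta> X G = \<gamma> X G"
  proof (rule is_sheaf_sep[OF Q])
    show "\<beta> X G \<in> At Q X" "\<gamma> X G \<in> At Q X" using nat_trans_in[OF \<beta>] nat_trans_in[OF \<gamma>] X G by auto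
    show "loc X (\<lambda>f. Act Q f (\<beta> X G) = Act Q f (\<gamma> X G))"
    proof (rule loc_mono[OF is_sectionD(7)[OF G]])
      fix f assume f: "f \<in> Mor C" "Cod C f = X" "\<exists>s. (f, s) \<in> G"
      then obtain s where s: "(f, s) \<in> G" by blast
      have sP: "s \<in> At P (Dom C f)" using is_sectionD(4)[OF G s] .
      have "unit P (Dom C f) s = res f G" using unit_res_iff[OF P _ f(1) sP] G s f by blast
      then have "Act (sheafify P) f G = unit P (Dom C f) s" using f G by simp
      then show "Act Q f (\<beta> X G) = Act Q f (\<gamma> X G)"
        using nat_trans_natural[OF \<beta> f(1), of G] nat_trans_natural[OF \<gamma> f(1), of G] f G X eq sP
        by simp
    qed
  qed
qed

lemma unit_bij:
  assumes P: "is_sheaf P" and X: "X \<in> Obj C"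
  shows "bij_betw (unit P X) (At P X) (At (sheafify P) X)"
proof -
  have pre: "is_presheaf C P" using P by (rule is_sheaf_is_presheaf)
  have "G \<in> unit P X ` At P X" if G: "is_section P X G" for G
  proof -
    obtain q where q: "q \<in> At P X" "\<And>f s. (f, s) \<in> G \<Longrightarrow> Act P f q = s"
      using glued_ex1[OF pre P id_trans_in[OF pre] G] is_sectionD(2,4)[OF G]
      by (auto simp: glued_def[OF pre P id_trans_in[OF pre]])
    have "(Id C X, q) \<in> G"
    proof (rule is_section_closed[OF G])
      show "loc (Dom C (Id C X)) (\<lambda>g. (Comp C (Id C X) g, Act P g q) \<in> G)"
        using X q(2) is_sectionD(7)[OF G] by (auto elim!: loc_mono)
    qed (use X q in auto)
    then show ?thesis using unit_eq_iff[OF pre G q(1)] q by blast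
  qed
  moreover have "inj_on (unit P X) (At P X)"
    using unit_eq_unit[OF pre X] is_sheaf_loc_eq[OF P] by (intro inj_onI) blast
  ultimately show ?thesis
    using X is_section_unit[OF pre X] by (auto simp: bij_betw_def)
qed

end

section \<open>Limits of presheaves\<close>

lemma is_functor_full_subcatD: "E \<subseteq> Obj A \<Longrightarrow> is_functor K (full_subcat A E) D \<Longrightarrow> is_functor K A D"
  by (auto simp: is_functor_def hom_def)

lemma is_cone_full_subcatD: "E \<subseteq> Obj A \<Longrightarrow> is_cone (full_subcat A E) K D L \<pi> \<Longrightarrow> is_cone A K D L \<pi>"
  by (auto simp: is_cone_def hom_def)

lemma functor_psh_catE:
  assumes "is_functor K (psh_cat C) D"
  obtains d where "\<And>i. i \<in> Obj K \<Longrightarrow> FOb D i \<in> presheaves C"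
    "\<And>k. k \<in> Mor K \<Longrightarrow> d k \<in> nat_trans C (FOb D (Dom K k)) (FOb D (Cod K k))"
    "\<And>k. k \<in> Mor K \<Longrightarrow> FMor D k = (FOb D (Dom K k), FOb D (Cod K k), d k)"
proof
  show "FOb D i \<in> presheaves C" if "i \<in> Obj K" for i
    using assms that by (auto simp: is_functor_def)
  fix k assume "k \<in> Mor K"
  then have "FMor D k \<in> hom (psh_cat C) (FOb D (Dom K k)) (FOb D (Cod K k))"
    using assms by (auto simp: is_functor_def)
  then show "snd (snd (FMor D k)) \<in> nat_trans C (FOb D (Dom K k)) (FOb D (Cod K k))"
    "FMor D k = (FOb D (Dom K k), FOb D (Cod K k), snd (snd (FMor D k)))"
    by (auto simp: hom_psh_cat)
qed

lemma cone_psh_catE: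
  assumes "is_cone (psh_cat C) K D L \<pi>"
  obtains p where "L \<in> presheaves C" "\<And>i. i \<in> Obj K \<Longrightarrow> p i \<in> nat_trans C L (FOb D i)"
    "\<And>i. i \<in> Obj K \<Longrightarrow> \<pi> i = (L, FOb D i, p i)"
proof
  show "L \<in> presheaves C" using assms by (simp add: is_cone_def)
  fix i assume "i \<in> Obj K"
  then have "\<pi> i \<in> hom (psh_cat C) L (FOb D i)" using assms by (simp add: is_cone_def)
  then show "snd (snd (\<pi> i)) \<in> nat_trans C L (FOb D i)" "\<pi> i = (L, FOb D i, snd (snd (\<pi> i)))"
    by (auto simp: hom_psh_cat)
qed

context category
begin

definition pointwise_limit ::
  "('i, 'k) cat \<Rightarrow> ('i \<Rightarrow> ('o, 'm, 'a) presheaf) \<Rightarrow> ('k \<Rightarrow> 'o \<Rightarrow> 'a \<Rightarrow> 'a) \<Rightarrow>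
    ('o, 'm, 'b) presheaf \<Rightarrow> ('i \<Rightarrow> 'o \<Rightarrow> 'b \<Rightarrow> 'a) \<Rightarrow> bool" where
  "pointwise_limit K D d L \<pi> \<longleftrightarrow> (\<forall>X \<in> Obj C. \<forall>a.
    (\<forall>i \<in> Obj K. a i \<in> At (D i) X) \<and> (\<forall>k \<in> Mor K. d k X (a (Dom K k)) = a (Cod K k)) \<longrightarrow>
    (\<exists>!l. l \<in> At L X \<and> (\<forall>i \<in> Obj K. \<pi> i X l = a i)))"

lemma pointwise_limitD:
  assumes "pointwise_limit K D d L \<pi>" "X \<in> Obj C"
    "\<And>i. i \<in> Obj K \<Longrightarrow> a i \<in> At (D i) X"
    "\<And>k. k \<in> Mor K \<Longrightarrow> d k X (a (Dom K k)) = a (Cod K k)"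
  shows "\<exists>!l. l \<in> At L X \<and> (\<forall>i \<in> Obj K. \<pi> i X l = a i)"
  using assms unfolding pointwise_limit_def by blast

lemma limit_of_pointwise_limit:
  assumes E: "E \<subseteq> presheaves C"
    and cone: "is_cone (full_subcat (psh_cat C) E) K D L \<pi>"
    and lim: "pointwise_limit K (FOb D) (\<lambda>k. snd (snd (FMor D k))) L (\<lambda>i. snd (snd (\<pi> i)))"
    and K: "category K" and D: "is_functor K (full_subcat (psh_cat C) E) D"
  shows "is_limit (full_subcat (psh_cat C) E) K D L \<pi>"
  unfolding is_limit_def
proof (intro conjI allI impI)
  interpret K: category K by fact
  fix M \<rho> assume \<rho>: "is_cone (full_subcat (psh_cat C) E) K D M \<rho>"
  have ME: "M \<in> E" and LE: "L \<in> E" using \<rho> cone by (auto simp: is_cone_def)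
  then have M: "is_presheaf C M" and L: "is_presheaf C L" using E by auto
  note full = is_cone_full_subcatD[of E "psh_cat C", unfolded psh_cat_simps, OF E]
  obtain r where r: "\<And>i. i \<in> Obj K \<Longrightarrow> r i \<in> nat_trans C M (FOb D i)"
    "\<And>i. i \<in> Obj K \<Longrightarrow> \<rho> i = (M, FOb D i, r i)" using full[OF \<rho>] by (rule cone_psh_catE) blast
  obtain p where p: "\<And>i. i \<in> Obj K \<Longrightarrow> p i \<in> nat_trans C L (FOb D i)"
    "\<And>i. i \<in> Obj K \<Longrightarrow> \<pi> i = (L, FOb D i, p i)" using full[OF cone] by (rule cone_psh_catE) blast
  obtain d where d: "\<And>k. k \<in> Mor K \<Longrightarrow> FMor D k = (FOb D (Dom K k), FOb D (Cod K k), d k)"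
    using is_functor_full_subcatD[OF _ D] E by (auto elim: functor_psh_catE)
  have d_r: "d k X (r (Dom K k) X m) = r (Cod K k) X m"
    if "k \<in> Mor K" "X \<in> Obj C" "m \<in> At M X" for k X m
  proof -
    have "Comp (psh_cat C) (FMor D k) (\<rho> (Dom K k)) = \<rho> (Cod K k)"
      using \<rho> that by (auto simp: is_cone_def)
    then have "ext_trans C M (\<lambda>X m. d k X (r (Dom K k) X m)) = r (Cod K k)"
      using that r(2) d by simp
    from fun_cong[OF fun_cong[OF this, of X], of m] show ?thesis using that by simp
  qed
  have ex1: "\<exists>!l. l \<in> At L X \<and> (\<forall>i \<in> Obj K. p i X l = r i X m)" if "X \<in> Obj C" "m \<in> At M X" for X m
    using pointwise_limitD[OF lim that(1), of "\<lambda>i. r i X m"] that r(1) d d_r p(2) nat_trans_in[OF r(1)]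
    by simp
  define u where "u = ext_trans C M (\<lambda>X m. THE l. l \<in> At L X \<and> (\<forall>i \<in> Obj K. p i X l = r i X m))"
  have u: "u X m \<in> At L X" "\<And>i. i \<in> Obj K \<Longrightarrow> p i X (u X m) = r i X m"
    if "X \<in> Obj C" "m \<in> At M X" for X m
    using theI'[OF ex1[OF that]] that by (auto simp: u_def)
  have u_eqI: "l = u X m"
    if "X \<in> Obj C" "m \<in> At M X" "l \<in> At L X" "\<And>i. i \<in> Obj K \<Longrightarrow> p i X l = r i X m" for X m l
    using ex1[OF that(1,2)] u[OF that(1,2)] that(3,4) by blast
  have u_in: "u \<in> nat_trans C M L"
  proof -
    have "u = ext_trans C M u" by (simp add: u_def ext_trans_def cong: restrict_cong)
    moreover have "ext_trans C M u \<in> nat_trans C M L"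
    proof (rule ext_trans_in[OF u(1) _ M])
      fix f m assume f: "f \<in> Mor C" and m: "m \<in> At M (Cod C f)"
      have mf: "Act M f m \<in> At M (Dom C f)" using M f m by simp
      have um: "u (Cod C f) m \<in> At L (Cod C f)" using u(1) f m by simp
      have "p i (Dom C f) (Act L f (u (Cod C f) m)) = r i (Dom C f) (Act M f m)" if i: "i \<in> Obj K" for i
        using nat_trans_natural[OF p(1)[OF i] f um] nat_trans_natural[OF r(1)[OF i] f m] u(2) f m i
        by simp
      then show "u (Dom C f) (Act M f m) = Act L f (u (Cod C f) m)"
        using u_eqI[OF _ mf, of "Act L f (u (Cod C f) m)"] um L f by simp
    qed
    ultimately show ?thesis by simp
  qed
  show "\<exists>!u. u \<in> hom (full_subcat (psh_cat C) E) M L \<and>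
      (\<forall>i \<in> Obj K. Comp (full_subcat (psh_cat C) E) (\<pi> i) u = \<rho> i)"
  proof (rule ex1I)
    have "ext_trans C M (\<lambda>X m. p i X (u X m)) = r i" if i: "i \<in> Obj K" for i
      using u(2)[OF _ _ i] by (intro nat_trans_eqI[OF comp_trans_in[OF u_in p(1)[OF i] M] r(1)[OF i]]) auto
    then show "(M, L, u) \<in> hom (full_subcat (psh_cat C) E) M L \<and>
      (\<forall>i \<in> Obj K. Comp (full_subcat (psh_cat C) E) (\<pi> i) (M, L, u) = \<rho> i)"
      using ME LE E u_in p(2) r(2) by (auto simp: hom_full_subcat_iff)
    fix v assume v: "v \<in> hom (full_subcat (psh_cat C) E) M L \<and>
      (\<forall>i \<in> Obj K. Comp (full_subcat (psh_cat C) E) (\<pi> i) v = \<rho> i)"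
    then obtain w where w: "v = (M, L, w)" "w \<in> nat_trans C M L"
      by (auto simp: hom_full_subcat_iff hom_psh_cat)
    have "w = u"
    proof (rule nat_trans_eqI[OF w(2) u_in])
      fix X m assume Xm: "X \<in> Obj C" "m \<in> At M X"
      have "p i X (w X m) = r i X m" if i: "i \<in> Obj K" for i
      proof -
        have "ext_trans C M (\<lambda>X m. p i X (w X m)) = r i"
          using v i p(2) r(2) w by auto
        from fun_cong[OF fun_cong[OF this, of X], of m] show ?thesis using Xm by simp
      qed
      then show "w X m = u X m" using u_eqI[OF Xm nat_trans_in[OF w(2) Xm]] by simp
    qed
    then show "v = (M, L, u)" using w by simp
  qed
qed (fact cone)

lemma pointwise_limit_iso:
  assumes lim: "pointwise_limit K D d L \<pi>"
    and K: "category K"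
    and D': "\<And>i X. i \<in> Obj K \<Longrightarrow> X \<in> Obj C \<Longrightarrow> bij_betw (\<delta> i X) (At (D i) X) (At (D' i) X)"
    and L': "\<And>X. X \<in> Obj C \<Longrightarrow> bij_betw (\<mu> X) (At L X) (At L' X)"
    and d': "\<And>k X s. k \<in> Mor K \<Longrightarrow> X \<in> Obj C \<Longrightarrow> s \<in> At (D (Dom K k)) X \<Longrightarrow>
      d' k X (\<delta> (Dom K k) X s) = \<delta> (Cod K k) X (d k X s)"
    and \<pi>': "\<And>i X l. i \<in> Obj K \<Longrightarrow> X \<in> Obj C \<Longrightarrow> l \<in> At L X \<Longrightarrow> \<pi>' i X (\<mu> X l) = \<delta> i X (\<pi> i X l)"
    and d_in: "\<And>k X s. k \<in> Mor K \<Longrightarrow> X \<in> Obj C \<Longrightarrow> s \<in> At (D (Dom K k)) X \<Longrightarrow>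
      d k X s \<in> At (D (Cod K k)) X"
    and \<pi>_in: "\<And>i X l. i \<in> Obj K \<Longrightarrow> X \<in> Obj C \<Longrightarrow> l \<in> At L X \<Longrightarrow> \<pi> i X l \<in> At (D i) X"
  shows "pointwise_limit K D' d' L' \<pi>'"
  unfolding pointwise_limit_def
proof (intro ballI allI impI)
  interpret K: category K by fact
  fix X a' assume X: "X \<in> Obj C" and a': "(\<forall>i \<in> Obj K. a' i \<in> At (D' i) X) \<and>
    (\<forall>k \<in> Mor K. d' k X (a' (Dom K k)) = a' (Cod K k))"
  have "\<exists>s. s \<in> At (D i) X \<and> a' i = \<delta> i X s" if "i \<in> Obj K" for i
    using a' that D'[OF that X] unfolding bij_betw_def by blast
  then obtain a where a: "\<And>i. i \<in> Obj K \<Longrightarrow> a i \<in> At (D i) X"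
    "\<And>i. i \<in> Obj K \<Longrightarrow> a' i = \<delta> i X (a i)" by metis
  have inj: "\<delta> i X s = \<delta> i X t \<Longrightarrow> s = t" if "i \<in> Obj K" "s \<in> At (D i) X" "t \<in> At (D i) X" for i s t
    using D'[OF that(1) X] that by (auto simp: bij_betw_def inj_on_def)
  have ex1: "\<exists>!l. l \<in> At L X \<and> (\<forall>i \<in> Obj K. \<pi> i X l = a i)"
  proof (rule pointwise_limitD[OF lim X])
    fix k assume k: "k \<in> Mor K"
    show "d k X (a (Dom K k)) = a (Cod K k)"
      by (rule inj[of "Cod K k"]) (use k a a' d'[OF k X, of "a (Dom K k)"] d_in[OF k X] in auto)
  qed (use a in auto)
  then obtain l where l: "l \<in> At L X" "\<forall>i \<in> Obj K. \<pi> i X l = a i" by blast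
  show "\<exists>!l'. l' \<in> At L' X \<and> (\<forall>i \<in> Obj K. \<pi>' i X l' = a' i)"
  proof (rule ex1I)
    show "\<mu> X l \<in> At L' X \<and> (\<forall>i \<in> Obj K. \<pi>' i X (\<mu> X l) = a' i)"
      using l L'[OF X] \<pi>' X a by (auto simp: bij_betw_def)
    fix l' assume l': "l' \<in> At L' X \<and> (\<forall>i \<in> Obj K. \<pi>' i X l' = a' i)"
    then obtain m where m: "m \<in> At L X" "l' = \<mu> X m" using L'[OF X] unfolding bij_betw_def by blast
    have "\<pi> i X m = a i" if i: "i \<in> Obj K" for i
      by (rule inj[OF i]) (use i m l' \<pi>'[OF i X m(1)] a \<pi>_in[OF i X] in auto)
    then have "m = l" using ex1 l m by auto
    then show "l' = \<mu> X l" using m by simp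
  qed
qed

end

context small_category
begin

text \<open>The copy of a representable presheaf with values in the universe, and the transformation that
  corresponds to an element by the Yoneda lemma.\<close>

definition repr :: "'o \<Rightarrow> ('o, 'm, 'u) presheaf" where
  "repr X = shrink C (sieve_of (into X))"

definition point :: "'o \<Rightarrow> ('o, 'm, 'u) presheaf \<Rightarrow> 'u \<Rightarrow> 'o \<Rightarrow> 'u \<Rightarrow> 'u" where
  "point X P s = ext_trans C (repr X) (\<lambda>Y u. Act P (down C (sieve_of (into X)) Y u) s)"

definition generic :: "'o \<Rightarrow> 'u" where
  "generic X = up C (sieve_of (into X)) X (Id C X)"

lemma small_presheaf_sieve_of:
  assumes S: "is_sieve X S" and X: "X \<in> Obj C"
  shows "small_presheaf (sieve_of S)"
  unfolding small_presheaf_def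
proof (intro conjI ballI is_presheaf_sieve_of[OF S])
  fix Y assume Y: "Y \<in> Obj C"
  have "At (sieve_of S) Y \<subseteq> hom C Y X"
    using S Y by (auto simp: At_sieve_of is_sieve_def hom_def)
  then show "small U (At (sieve_of S) Y)"
    using hom_small[OF Y X] small_subset by blast
qed

lemmas small_presheaf_into = small_presheaf_sieve_of[OF is_sieve_into]

lemma repr_in: "X \<in> Obj C \<Longrightarrow> repr X \<in> presheaves C"
  unfolding repr_def by (rule shrink_in_presheaves[OF small_presheaf_into])

lemma generic_in: "X \<in> Obj C \<Longrightarrow> generic X \<in> At (repr X) X"
  unfolding generic_def repr_def
  by (rule nat_trans_in[OF up_in[OF small_presheaf_into]]) (simp_all add: At_sieve_of into_def)

lemma point_in:
  assumes X: "X \<in> Obj C" and P: "is_presheaf C P" and s: "s \<in> At P X"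
  shows "point X P s \<in> nat_trans C (repr X) P"
  unfolding point_def
proof (rule ext_trans_in)
  let ?y = "sieve_of (into X)"
  have down: "down C ?y Y u \<in> Mor C" "Dom C (down C ?y Y u) = Y" "Cod C (down C ?y Y u) = X"
    if "Y \<in> Obj C" "u \<in> At (repr X) Y" for Y u
    using nat_trans_in[OF down_in[OF small_presheaf_into[OF X]], of Y u] that
    by (auto simp: repr_def At_sieve_of into_def)
  show "Act P (down C ?y Y u) s \<in> At P Y" if "Y \<in> Obj C" "u \<in> At (repr X) Y" for Y u
    using Act_in[OF P down(1,3)[OF that] s] down[OF that] by simp
  fix f u assume f: "f \<in> Mor C" and u: "u \<in> At (repr X) (Cod C f)"
  have "down C ?y (Dom C f) (Act (repr X) f u) = Comp C (down C ?y (Cod C f) u) f"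
    using nat_trans_natural[OF down_in[OF small_presheaf_into[OF X]] f, of u] u f down[of "Cod C f" u]
    by (simp add: repr_def Act_sieve_of into_def)
  then show "Act P (down C ?y (Dom C f) (Act (repr X) f u)) s = Act P f (Act P (down C ?y (Cod C f) u) s)"
    using f u down[of "Cod C f" u] P s by simp
qed (use X repr_in in simp)

lemma point_generic:
  assumes "X \<in> Obj C" "is_presheaf C P" "s \<in> At P X"
  shows "point X P s X (generic X) = s"
  using assms generic_in[of X] down_up[OF small_presheaf_into, of X X "Id C X"]
  by (simp add: point_def generic_def At_sieve_of into_def)

lemma repr_trans_eqI:
  assumes X: "X \<in> Obj C" and \<alpha>: "\<alpha> \<in> nat_trans C (repr X) P" and \<beta>: "\<beta> \<in> nat_trans C (repr X) P"
    and eq: "\<alpha> X (generic X) = \<beta> X (generic X)"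
  shows "\<alpha> = \<beta>"
proof (rule nat_trans_eqI[OF \<alpha> \<beta>])
  let ?y = "sieve_of (into X)"
  fix Y u assume Y: "Y \<in> Obj C" and u: "u \<in> At (repr X) Y"
  define f where "f = down C ?y Y u"
  have f: "f \<in> Mor C" "Dom C f = Y" "Cod C f = X"
    using nat_trans_in[OF down_in[OF small_presheaf_into[OF X]], of Y u] u Y
    by (auto simp: repr_def At_sieve_of into_def f_def)
  have "u = up C ?y Y f"
    using up_down[OF small_presheaf_into[OF X] Y] u by (simp add: repr_def f_def)
  also have "\<dots> = Act (repr X) f (generic X)"
    using Act_shrink[OF small_presheaf_into[OF X] f(1), of "Id C X"] f X
    by (simp add: repr_def generic_def At_sieve_of Act_sieve_of into_def)
  finally have "u = Act (repr X) f (generic X)" .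
  then show "\<alpha> Y u = \<beta> Y u"
    using nat_trans_natural[OF \<alpha> f(1), of "generic X"] nat_trans_natural[OF \<beta> f(1), of "generic X"]
      generic_in[OF X] f eq by simp
qed

text \<open>Compatible families of elements over \<open>X\<close> are cones with the representable presheaf of \<open>X\<close> as
  vertex, so every limit of presheaves is computed pointwise.\<close>

lemma limit_pointwise:
  assumes K: "category K" and D: "is_functor K (psh_cat C) D"
    and lim: "is_limit (psh_cat C) K D (L :: ('o, 'm, 'u) presheaf) \<pi>"
  shows "pointwise_limit K (FOb D) (\<lambda>k. snd (snd (FMor D k))) L (\<lambda>i. snd (snd (\<pi> i)))"
  unfolding pointwise_limit_def
proof (intro ballI allI impI)
  interpret K: category K by fact
  have cone: "is_cone (psh_cat C) K D L \<pi>" using lim by (simp add: is_limit_def)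
  obtain p where L: "L \<in> presheaves C" and p: "\<And>i. i \<in> Obj K \<Longrightarrow> p i \<in> nat_trans C L (FOb D i)"
    "\<And>i. i \<in> Obj K \<Longrightarrow> \<pi> i = (L, FOb D i, p i)" using cone by (rule cone_psh_catE) blast
  obtain d where DP: "\<And>i. i \<in> Obj K \<Longrightarrow> FOb D i \<in> presheaves C"
    and d: "\<And>k. k \<in> Mor K \<Longrightarrow> d k \<in> nat_trans C (FOb D (Dom K k)) (FOb D (Cod K k))"
    "\<And>k. k \<in> Mor K \<Longrightarrow> FMor D k = (FOb D (Dom K k), FOb D (Cod K k), d k)"
    using D by (rule functor_psh_catE) blast
  fix X a assume X: "X \<in> Obj C" and "(\<forall>i \<in> Obj K. a i \<in> At (FOb D i) X) \<and>
    (\<forall>k \<in> Mor K. snd (snd (FMor D k)) X (a (Dom K k)) = a (Cod K k))"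
  then have a: "\<And>i. i \<in> Obj K \<Longrightarrow> a i \<in> At (FOb D i) X"
    "\<And>k. k \<in> Mor K \<Longrightarrow> d k X (a (Dom K k)) = a (Cod K k)" using d(2) by auto
  note Y = repr_in[OF X] presheaves_is_presheaf[OF repr_in[OF X]] and gen = generic_in[OF X]
  define q where "q i = point X (FOb D i) (a i)" for i
  have q: "q i \<in> nat_trans C (repr X) (FOb D i)" "q i X (generic X) = a i" if "i \<in> Obj K" for i
    using point_in[OF X _ a(1)[OF that]] point_generic[OF X _ a(1)[OF that]] DP[OF that]
    by (auto simp: q_def)
  define \<rho> where "\<rho> i = (repr X, FOb D i, q i)" for i
  have "is_cone (psh_cat C) K D (repr X) \<rho>"
    unfolding is_cone_def
  proof (intro conjI ballI)
    fix k assume k: "k \<in> Mor K"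
    have "ext_trans C (repr X) (\<lambda>Z u. d k Z (q (Dom K k) Z u)) = q (Cod K k)"
      by (rule repr_trans_eqI[OF X comp_trans_in[OF q(1) d(1)[OF k] Y(2)] q(1)])
        (use k q(2) a X gen in auto)
    then show "Comp (psh_cat C) (FMor D k) (\<rho> (Dom K k)) = \<rho> (Cod K k)"
      using d(2)[OF k] by (simp add: \<rho>_def)
  qed (use Y q DP in \<open>auto simp: \<rho>_def\<close>)
  then have ex1: "\<exists>!u. u \<in> hom (psh_cat C) (repr X) L \<and> (\<forall>i \<in> Obj K. Comp (psh_cat C) (\<pi> i) u = \<rho> i)"
    using lim by (simp add: is_limit_def)
  have iff: "(\<forall>i \<in> Obj K. Comp (psh_cat C) (\<pi> i) (repr X, L, w) = \<rho> i) \<longleftrightarrow>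
      (\<forall>i \<in> Obj K. p i X (w X (generic X)) = a i)" if w: "w \<in> nat_trans C (repr X) L" for w
  proof (intro ball_cong refl)
    fix i assume i: "i \<in> Obj K"
    have "ext_trans C (repr X) (\<lambda>Z u. p i Z (w Z u)) = q i \<longleftrightarrow> p i X (w X (generic X)) = a i"
    proof
      assume "ext_trans C (repr X) (\<lambda>Z u. p i Z (w Z u)) = q i"
      from fun_cong[OF fun_cong[OF this, of X], of "generic X"]
      show "p i X (w X (generic X)) = a i" using q(2)[OF i] X gen by simp
    next
      assume "p i X (w X (generic X)) = a i"
      then show "ext_trans C (repr X) (\<lambda>Z u. p i Z (w Z u)) = q i"
        using q(2)[OF i] X gen
        by (intro repr_trans_eqI[OF X comp_trans_in[OF w p(1)[OF i] Y(2)] q(1)[OF i]]) simp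
    qed
    then show "Comp (psh_cat C) (\<pi> i) (repr X, L, w) = \<rho> i \<longleftrightarrow> p i X (w X (generic X)) = a i"
      using p(2)[OF i] by (simp add: \<rho>_def)
  qed
  obtain w where w: "w \<in> nat_trans C (repr X) L"
    "\<forall>i \<in> Obj K. Comp (psh_cat C) (\<pi> i) (repr X, L, w) = \<rho> i"
    using ex1 by (auto simp: hom_psh_cat)
  have "\<exists>!l. l \<in> At L X \<and> (\<forall>i \<in> Obj K. p i X l = a i)"
  proof (rule ex1I)
    show "w X (generic X) \<in> At L X \<and> (\<forall>i \<in> Obj K. p i X (w X (generic X)) = a i)"
      using nat_trans_in[OF w(1) X gen] w iff[OF w(1)] by blast
    fix l assume l: "l \<in> At L X \<and> (\<forall>i \<in> Obj K. p i X l = a i)"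
    have pl: "point X L l \<in> nat_trans C (repr X) L" "point X L l X (generic X) = l"
      using point_in[OF X _ conjunct1[OF l]] point_generic[OF X _ conjunct1[OF l]] L by auto
    then have "\<forall>i \<in> Obj K. Comp (psh_cat C) (\<pi> i) (repr X, L, point X L l) = \<rho> i"
      using iff l by simp
    then have "(repr X, L, point X L l) = (repr X, L, w)"
      using ex1 w pl(1) Y(1) L unfolding hom_psh_cat by blast
    then show "l = w X (generic X)" using pl(2) by simp
  qed
  then show "\<exists>!l. l \<in> At L X \<and> (\<forall>i \<in> Obj K. snd (snd (\<pi> i)) X l = a i)"
    using p(2) by simp
qed

end

text \<open>Sheafification preserves finite pointwise limits: the section with components \<open>\<Gamma> i\<close> consists of
  the pairs all of whose components lie in the \<open>\<Gamma> i\<close>.  Finiteness is what allows finitely many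
  local statements to be realised on one covering sieve.\<close>

lemma (in topology) sheafify_pointwise_limit:
  assumes K: "category K" "finite (Obj K)" "finite (Mor K)"
    and D: "\<And>i. i \<in> Obj K \<Longrightarrow> is_presheaf C (D i)"
    and d: "\<And>k. k \<in> Mor K \<Longrightarrow> d k \<in> nat_trans C (D (Dom K k)) (D (Cod K k))"
    and L: "is_presheaf C L" and p: "\<And>i. i \<in> Obj K \<Longrightarrow> p i \<in> nat_trans C L (D i)"
    and cone: "\<And>k X l. k \<in> Mor K \<Longrightarrow> X \<in> Obj C \<Longrightarrow> l \<in> At L X \<Longrightarrow>
      d k X (p (Dom K k) X l) = p (Cod K k) X l"
    and lim: "pointwise_limit K D d L p"
  shows "pointwise_limit K (\<lambda>i. sheafify (D i))
    (\<lambda>k. sheafify_map (D (Dom K k)) (D (Cod K k)) (d k)) (sheafify L) (\<lambda>i. sheafify_map L (D i) (p i))"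
  unfolding pointwise_limit_def
proof (intro ballI allI impI)
  interpret K: category K by fact
  fix X \<Gamma> assume X: "X \<in> Obj C" and "(\<forall>i \<in> Obj K. \<Gamma> i \<in> At (sheafify (D i)) X) \<and>
    (\<forall>k \<in> Mor K. sheafify_map (D (Dom K k)) (D (Cod K k)) (d k) X (\<Gamma> (Dom K k)) = \<Gamma> (Cod K k))"
  then have \<Gamma>: "\<And>i. i \<in> Obj K \<Longrightarrow> is_section (D i) X (\<Gamma> i)"
    and \<Gamma>_d: "\<And>k f s. k \<in> Mor K \<Longrightarrow> (f, s) \<in> \<Gamma> (Dom K k) \<Longrightarrow> (f, d k (Dom C f) s) \<in> \<Gamma> (Cod K k)"
    using sheafify_map_mem[OF D D d] by fastforce+
  note \<Gamma>D = is_sectionD[OF \<Gamma>]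
  define G where "G = {(f, l) \<in> pairs L X. \<forall>i \<in> Obj K. (f, p i (Dom C f) l) \<in> \<Gamma> i}"
  have Gf: "f \<in> Mor C" "Cod C f = X" "l \<in> At L (Dom C f)" if "(f, l) \<in> G" for f l
    using that by (auto simp: G_def pairs_def)
  have nat: "p i (Dom C g) (Act L g l) = Act (D i) g (p i (Cod C g) l)"
    if "i \<in> Obj K" "g \<in> Mor C" "l \<in> At L (Cod C g)" for i g l
    using nat_trans_natural[OF p] that by simp
  have L_eq: "l = l'" if Y: "Y \<in> Obj C" and l: "l \<in> At L Y" "l' \<in> At L Y"
    and eq: "\<And>i. i \<in> Obj K \<Longrightarrow> p i Y l = p i Y l'" for Y l l'
  proof -
    have "\<exists>!m. m \<in> At L Y \<and> (\<forall>i \<in> Obj K. p i Y m = p i Y l)"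
      by (rule pointwise_limitD[OF lim Y]) (use cone Y l nat_trans_in[OF p] in auto)
    then show ?thesis using l eq by auto
  qed
  have pre: "presection L X G"
  proof (rule presectionI[OF X])
    fix f l assume fl: "(f, l) \<in> G"
    note f = Gf[OF fl]
    show "f \<in> Mor C \<and> Cod C f = X \<and> l \<in> At L (Dom C f)" using f by simp
    show "(Comp C f g, Act L g l) \<in> G" if g: "g \<in> Mor C" "Cod C g = Dom C f" for g
    proof -
      have "(Comp C f g, p i (Dom C g) (Act L g l)) \<in> \<Gamma> i" if i: "i \<in> Obj K" for i
        using \<Gamma>D(5)[OF i _ g, of "p i (Dom C f) l"] nat[OF i g(1), of l] fl i f g by (simp add: G_def)
      then show ?thesis using f g L by (simp add: G_def pairs_def)
    qed
    fix l' assume fl': "(f, l') \<in> G"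
    note f' = Gf(3)[OF fl']
    have "loc (Dom C f) (\<lambda>g. Act (D i) g (p i (Dom C f) l) = Act (D i) g (p i (Dom C f) l'))"
      if i: "i \<in> Obj K" for i
      using \<Gamma>D(6)[OF i, of f "p i (Dom C f) l" "p i (Dom C f) l'"] fl fl' i
      by (simp add: loc_eq_def G_def)
    then have "loc (Dom C f) (\<lambda>g. \<forall>i \<in> Obj K.
        Act (D i) g (p i (Dom C f) l) = Act (D i) g (p i (Dom C f) l'))"
      using f by (intro loc_finite_ball[OF K(2)]) auto
    then show "loc_eq L (Dom C f) l l'"
      unfolding loc_eq_def
    proof (rule loc_mono)
      fix g assume g: "g \<in> Mor C" "Cod C g = Dom C f"
        "\<forall>i \<in> Obj K. Act (D i) g (p i (Dom C f) l) = Act (D i) g (p i (Dom C f) l')"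
      show "Act L g l = Act L g l'"
        by (rule L_eq[of "Dom C g"]) (use g f f' L nat in auto)
    qed
  next
    have "loc X (\<lambda>f. \<forall>i \<in> Obj K. \<exists>s. (f, s) \<in> \<Gamma> i)"
      using \<Gamma>D(7) X by (intro loc_finite_ball[OF K(2)]) auto
    then have "loc X (\<lambda>f. loc (Dom C f) (\<lambda>g. \<exists>l. (Comp C f g, l) \<in> G))"
    proof (rule loc_mono)
      fix f assume f: "f \<in> Mor C" "Cod C f = X" "\<forall>i \<in> Obj K. \<exists>s. (f, s) \<in> \<Gamma> i"
      \<comment> \<open>The chosen representatives form a compatible family only locally.\<close>
      then obtain t where t: "\<And>i. i \<in> Obj K \<Longrightarrow> (f, t i) \<in> \<Gamma> i" by metis
      have tD: "t i \<in> At (D i) (Dom C f)" if "i \<in> Obj K" for i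
        using \<Gamma>D(4)[OF that t[OF that]] .
      have "loc (Dom C f) (\<lambda>g. \<forall>k \<in> Mor K.
        Act (D (Cod K k)) g (d k (Dom C f) (t (Dom K k))) = Act (D (Cod K k)) g (t (Cod K k)))"
      proof (intro loc_finite_ball[OF K(3)])
        fix k assume k: "k \<in> Mor K"
        show "loc (Dom C f) (\<lambda>g. Act (D (Cod K k)) g (d k (Dom C f) (t (Dom K k))) =
            Act (D (Cod K k)) g (t (Cod K k)))"
          using \<Gamma>D(6)[OF _ \<Gamma>_d[OF k t] t] k by (simp add: loc_eq_def)
      qed (use f in simp)
      then show "loc (Dom C f) (\<lambda>g. \<exists>l. (Comp C f g, l) \<in> G)"
      proof (rule loc_mono)
        fix g assume g: "g \<in> Mor C" "Cod C g = Dom C f" and compat: "\<forall>k \<in> Mor K.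
          Act (D (Cod K k)) g (d k (Dom C f) (t (Dom K k))) = Act (D (Cod K k)) g (t (Cod K k))"
        have "\<exists>!l. l \<in> At L (Dom C g) \<and> (\<forall>i \<in> Obj K. p i (Dom C g) l = Act (D i) g (t i))"
        proof (rule pointwise_limitD[OF lim])
          show "Act (D i) g (t i) \<in> At (D i) (Dom C g)" if "i \<in> Obj K" for i
            using Act_in[OF D[OF that] g tD[OF that]] .
          show "d k (Dom C g) (Act (D (Dom K k)) g (t (Dom K k))) = Act (D (Cod K k)) g (t (Cod K k))"
            if k: "k \<in> Mor K" for k
            using nat_trans_natural[OF d[OF k] g(1), of "t (Dom K k)"] tD[of "Dom K k"] compat k g by simp
        qed (use g in simp)
        then obtain l where l: "l \<in> At L (Dom C g)" "\<forall>i \<in> Obj K. p i (Dom C g) l = Act (D i) g (t i)"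
          by blast
        have "(Comp C f g, l) \<in> G"
          using l f g \<Gamma>D(5)[OF _ t g] by (auto simp: G_def pairs_def)
        then show "\<exists>l. (Comp C f g, l) \<in> G" by blast
      qed
    qed
    then show "loc X (\<lambda>f. \<exists>l. (f, l) \<in> G)" by (rule loc_bind)
  qed
  have G: "is_section L X G"
    unfolding is_section_def closed_under_def
  proof (intro conjI pre, clarify)
    fix f l assume fl: "(f, l) \<in> pairs L X" and lo: "loc (Dom C f) (\<lambda>g. (Comp C f g, Act L g l) \<in> G)"
    have f: "f \<in> Mor C" "Cod C f = X" "l \<in> At L (Dom C f)" using fl by (auto simp: pairs_def)
    have "(f, p i (Dom C f) l) \<in> \<Gamma> i" if i: "i \<in> Obj K" for i
    proof (rule is_section_closed[OF \<Gamma>[OF i] f(1,2)])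
      show "p i (Dom C f) l \<in> At (D i) (Dom C f)" using nat_trans_in[OF p[OF i]] f by simp
      show "loc (Dom C f) (\<lambda>g. (Comp C f g, Act (D i) g (p i (Dom C f) l)) \<in> \<Gamma> i)"
      proof (rule loc_mono[OF lo])
        fix g assume g: "g \<in> Mor C" "Cod C g = Dom C f" "(Comp C f g, Act L g l) \<in> G"
        then have "(Comp C f g, p i (Dom C (Comp C f g)) (Act L g l)) \<in> \<Gamma> i"
          using i unfolding G_def by blast
        then show "(Comp C f g, Act (D i) g (p i (Dom C f) l)) \<in> \<Gamma> i"
          using g i f nat[OF i, of g l] by simp
      qed
    qed
    then show "(f, l) \<in> G" using fl by (simp add: G_def)
  qed
  show "\<exists>!H. H \<in> At (sheafify L) X \<and> (\<forall>i \<in> Obj K. sheafify_map L (D i) (p i) X H = \<Gamma> i)"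
  proof (rule ex1I)
    show "G \<in> At (sheafify L) X \<and> (\<forall>i \<in> Obj K. sheafify_map L (D i) (p i) X G = \<Gamma> i)"
      using G X sheafify_map_eq_iff[OF L D p G \<Gamma>] by (auto simp: G_def)
    fix H assume H: "H \<in> At (sheafify L) X \<and> (\<forall>i \<in> Obj K. sheafify_map L (D i) (p i) X H = \<Gamma> i)"
    then have HS: "is_section L X H" using X by simp
    have "(f, p i (Dom C f) l) \<in> \<Gamma> i" if "i \<in> Obj K" "(f, l) \<in> H" for i f l
      using sheafify_map_mem[OF L D[OF that(1)] p[OF that(1)] HS that(2)] H that by simp
    then have "H \<subseteq> G" using is_sectionD(2-4)[OF HS] by (auto simp: G_def pairs_def)
    then show "H = G" by (rule section_eqI[OF L HS G])
  qed
qed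

section \<open>The subtopos of sheaves\<close>

locale small_topology = topology C J + small_category C U
  for C :: "('o, 'm) cat" and J :: "('o, 'm) sieve set" and U :: "'u itself"
begin

text \<open>A section is stable under composition, hence determined by its pairs \<open>(f, s)\<close> with the domain
  of \<open>f\<close> in a small set of representatives of the objects.\<close>

lemma small_presheaf_sheafify:
  assumes P: "small_presheaf P"
  shows "small_presheaf (sheafify P)"
  unfolding small_presheaf_def
proof (intro conjI ballI)
  have pre: "is_presheaf C P" using P by (rule small_presheaf_is_presheaf)
  then show "is_presheaf C (sheafify P)" by (rule is_presheaf_sheafify)
  fix X assume X: "X \<in> Obj C"
  obtain A where A: "A \<subseteq> Obj C" "small U A"
    and rep: "\<And>Y. Y \<in> Obj C \<Longrightarrow> \<exists>e. is_iso C e \<and> Dom C e \<in> A \<and> Cod C e = Y"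
    using representatives by blast
  define B where "B = (\<Union>Z \<in> A. hom C Z X \<times> At P Z)"
  have "small U B"
    unfolding B_def using A X P universe
    by (intro small_UN small_Times hom_small) (auto simp: small_presheaf_def)
  then have "small U (Pow B)" using universe by (intro small_Pow)
  moreover have "G \<subseteq> H" if G: "is_section P X G" and H: "is_section P X H" and eq: "G \<inter> B = H \<inter> B" for G H
  proof clarify
    fix f s assume fs: "(f, s) \<in> G"
    note f = is_sectionD(2-4)[OF G fs]
    obtain e e' where e: "e \<in> Mor C" "Dom C e \<in> A" "Cod C e = Dom C f" "e' \<in> Mor C"
      "Dom C e' = Dom C f" "Cod C e' = Dom C e" "Comp C e e' = Id C (Dom C f)"
      using rep[of "Dom C f"] f by (metis Dom_Cod_Obj(1) is_isoE)
    have "(Comp C f e, Act P e s) \<in> G" using is_sectionD(5)[OF G fs] e by simp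
    moreover have "(Comp C f e, Act P e s) \<in> B"
      using e f pre Act_in[OF pre e(1,3) f(3)] by (auto simp: B_def hom_def intro!: bexI[of _ "Dom C e"])
    ultimately have "(Comp C f e, Act P e s) \<in> H" using eq by blast
    from is_sectionD(5)[OF H this, of e'] show "(f, s) \<in> H" using e f pre by simp
  qed
  then have "inj_on (\<lambda>G. G \<inter> B) {G. is_section P X G}"
    by (intro inj_onI) (metis mem_Collect_eq subset_antisym)
  ultimately have "small U {G. is_section P X G}" by (rule small_inj) auto
  then show "small U (At (sheafify P) X)" using X by simp
qed

text \<open>Two copies of the representable presheaf of \<open>X\<close> glued along the sieve \<open>S\<close>.  Its two generic
  elements agree on \<open>S\<close>, so they agree in the associated sheaf as soon as that sheaf is separated
  for \<open>S\<close>; but they agree locally only if \<open>S\<close> covers.\<close>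

definition doubled :: "'o \<Rightarrow> 'm set \<Rightarrow> ('o, 'm, 'm \<times> bool) presheaf" where
  "doubled X S =
    \<lparr>At = (\<lambda>Y \<in> Obj C. {(f, b). f \<in> hom C Y X \<and> (f \<in> S \<longrightarrow> \<not> b)}),
     Act = (\<lambda>g \<in> Mor C. \<lambda>(f, b) \<in> {(f, b). f \<in> hom C (Cod C g) X \<and> (f \<in> S \<longrightarrow> \<not> b)}.
       (Comp C f g, b \<and> Comp C f g \<notin> S))\<rparr>"

lemma small_presheaf_doubled:
  assumes S: "is_sieve X S" and X: "X \<in> Obj C"
  shows "small_presheaf (doubled X S)"
  unfolding small_presheaf_def is_presheaf_def
proof (intro conjI ballI impI)
  show "Act (doubled X S) \<in> (\<Pi>\<^sub>E f \<in> Mor C. At (doubled X S) (Cod C f) \<rightarrow>\<^sub>E At (doubled X S) (Dom C f))"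
    by (auto simp: PiE_iff doubled_def hom_def)
next
  fix f g and s :: "'m \<times> bool"
  assume "f \<in> Mor C" "g \<in> Mor C" "Cod C f = Dom C g" "s \<in> At (doubled X S) (Cod C g)"
  then show "Act (doubled X S) (Comp C g f) s = Act (doubled X S) f (Act (doubled X S) g s)"
    using is_sieveD(4)[OF S, of "Comp C (fst s) g" f] by (auto simp: doubled_def hom_def)
next
  fix Y assume Y: "Y \<in> Obj C"
  have "small U (hom C Y X \<times> (UNIV :: bool set))"
    using universe X Y by (intro small_Times hom_small small_finite) auto
  then show "small U (At (doubled X S) Y)"
    by (rule small_subset) (use Y in \<open>auto simp: doubled_def\<close>)
qed (auto simp: doubled_def hom_def)

lemma covers_if_sheaves_separated:
  assumes S: "is_sieve X S" and X: "X \<in> Obj C"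
    and sep: "\<And>P :: ('o, 'm, 'u) presheaf. P \<in> presheaves C \<Longrightarrow> is_sheaf P \<Longrightarrow> separated_on P X S"
  shows "covers X S"
proof -
  let ?D = "doubled X S"
  note small = small_presheaf_doubled[OF S X]
  note D = small_presheaf_is_presheaf[OF small] and aD = small_presheaf_sheafify[OF small]
  let ?P = "shrink C (sheafify ?D) :: ('o, 'm, 'u) presheaf"
  have P: "?P \<in> presheaves C" by (rule shrink_in_presheaves[OF aD])
  have "is_sheaf ?P"
    by (rule is_sheaf_iso[OF is_sheaf_sheafify[OF D] _ up_in[OF aD] up_bij[OF aD]]) (use P in simp)
  then have sepP: "separated_on ?P X S" using sep P by blast
  define \<iota> :: "'o \<Rightarrow> 'm \<times> bool \<Rightarrow> 'u" where "\<iota> Y s = up C (sheafify ?D) Y (unit ?D Y s)" for Y s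
  have \<iota>: "ext_trans C ?D \<iota> \<in> nat_trans C ?D ?P"
    unfolding \<iota>_def by (rule comp_trans_in[OF unit_in[OF D] up_in[OF aD] D])
  obtain s t where st: "s = (Id C X, False)" "t = (Id C X, True)" by blast
  show ?thesis
  proof (cases "Id C X \<in> S")
    \<comment> \<open>Here the two copies coincide and there is no second generic element.\<close>
    case True
    then have "S = into X"
      using pull_member[OF S True] pull_Id[OF S X] X by simp
    then show ?thesis using covers_into X by simp
  next
    case False
    then have stD: "s \<in> At ?D X" "t \<in> At ?D X"
      using st X by (auto simp: doubled_def hom_def)
    have act: "Act ?D f s = (f, False)" "Act ?D f t = (f, f \<notin> S)" if "f \<in> Mor C" "Cod C f = X" for f
      using that stD st X by (auto simp: doubled_def hom_def)
    have eq: "Act ?P f (\<iota> X s) = Act ?P f (\<iota> X t)" if f: "f \<in> S" for f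
    proof -
      note fD = is_sieveD[OF S f]
      have "Act ?D f s = Act ?D f t" using act fD f by simp
      then show ?thesis
        using nat_trans_natural[OF \<iota> fD(1), of s] nat_trans_natural[OF \<iota> fD(1), of t] stD fD X by simp
    qed
    have in_P: "\<iota> X s \<in> At ?P X" "\<iota> X t \<in> At ?P X"
      using nat_trans_in[OF \<iota> X] stD X by auto
    have "\<iota> X s = \<iota> X t" using sepP eq in_P unfolding separated_on_def by blast
    then have "unit ?D X s = unit ?D X t"
      using down_up[OF aD X] is_section_unit[OF D X] stD X unfolding \<iota>_def
      by (metis At_sheafify mem_Collect_eq)
    from unit_eq_unit[OF D X stD this] have "loc X (\<lambda>f. f \<in> S)"
      unfolding loc_eq_def by (rule loc_mono) (use act in auto)
    then show ?thesis using loc_into_iff[OF S] by simp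
  qed
qed

abbreviation (input) Sh :: "('o, 'm, 'u) presheaf set" where
  "Sh \<equiv> sheaves C J"

definition assoc_sheaf :: "('o, 'm, 'u) presheaf \<Rightarrow> ('o, 'm, 'u) presheaf" where
  "assoc_sheaf P = shrink C (sheafify P)"

definition assoc_map ::
  "('o, 'm, 'u) presheaf \<Rightarrow> ('o, 'm, 'u) presheaf \<Rightarrow> ('o \<Rightarrow> 'u \<Rightarrow> 'u) \<Rightarrow> 'o \<Rightarrow> 'u \<Rightarrow> 'u" where
  "assoc_map P Q \<alpha> = ext_trans C (assoc_sheaf P)
    (\<lambda>X u. up C (sheafify Q) X (sheafify_map P Q \<alpha> X (down C (sheafify P) X u)))"

definition assoc_unit :: "('o, 'm, 'u) presheaf \<Rightarrow> 'o \<Rightarrow> 'u \<Rightarrow> 'u" where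
  "assoc_unit P = ext_trans C P (\<lambda>X s. up C (sheafify P) X (unit P X s))"

definition assoc_func where
  "assoc_func = \<lparr>FOb = assoc_sheaf,
    FMor = (\<lambda>(P, Q, \<alpha>). (assoc_sheaf P, assoc_sheaf Q, assoc_map P Q \<alpha>))\<rparr>"

definition assoc_eta where
  "assoc_eta P = (P, assoc_sheaf P, assoc_unit P)"

lemma small_sheafify: "P \<in> presheaves C \<Longrightarrow> small_presheaf (sheafify (P :: ('o, 'm, 'u) presheaf))"
  using small_presheaf_sheafify presheaves_iff by blast

lemma assoc_sheaf_in: "P \<in> presheaves C \<Longrightarrow> assoc_sheaf P \<in> presheaves C"
  unfolding assoc_sheaf_def by (rule shrink_in_presheaves[OF small_sheafify])

lemma assoc_sheaf_sheaf:
  assumes P: "P \<in> presheaves C"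
  shows "assoc_sheaf P \<in> Sh"
proof -
  have "is_sheaf (assoc_sheaf P)"
    unfolding assoc_sheaf_def
    by (rule is_sheaf_iso[OF is_sheaf_sheafify _ up_in[OF small_sheafify] up_bij[OF small_sheafify]])
      (use P assoc_sheaf_in[OF P] in \<open>simp_all add: assoc_sheaf_def[symmetric]\<close>)
  then show ?thesis using assoc_sheaf_in[OF P] by (simp add: sheaves_iff)
qed

lemma down_section:
  assumes "P \<in> presheaves C" "X \<in> Obj C" "u \<in> At (assoc_sheaf P) X"
  shows "is_section P X (down C (sheafify P) X u)"
  using nat_trans_in[OF down_in[OF small_sheafify[OF assms(1)]] assms(2), of u] assms
  by (simp add: assoc_sheaf_def)

lemma assoc_map_up:
  assumes P: "P \<in> presheaves C" and X: "X \<in> Obj C" and G: "is_section P X G"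
  shows "assoc_map P Q \<alpha> X (up C (sheafify P) X G) = up C (sheafify Q) X (sheafify_map P Q \<alpha> X G)"
proof -
  have "up C (sheafify P) X G \<in> At (assoc_sheaf P) X"
    using nat_trans_in[OF up_in[OF small_sheafify[OF P]] X, of G] X G by (simp add: assoc_sheaf_def)
  then show ?thesis
    using down_up[OF small_sheafify[OF P] X, of G] X G by (simp add: assoc_map_def)
qed

lemma assoc_map_in:
  assumes P: "P \<in> presheaves C" and Q: "Q \<in> presheaves C" and \<alpha>: "\<alpha> \<in> nat_trans C P Q"
  shows "assoc_map P Q \<alpha> \<in> nat_trans C (assoc_sheaf P) (assoc_sheaf Q)"
proof -
  have *: "is_presheaf C (assoc_sheaf P)" using assoc_sheaf_in[OF P] by simp
  have "ext_trans C (assoc_sheaf P) (\<lambda>X u. sheafify_map P Q \<alpha> X (down C (sheafify P) X u))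
      \<in> nat_trans C (assoc_sheaf P) (sheafify Q)" (is "?m \<in> _")
    using comp_trans_in[OF down_in[OF small_sheafify[OF P]] sheafify_map_in[OF _ _ \<alpha>]] P Q *
    by (simp add: assoc_sheaf_def)
  from comp_trans_in[OF this up_in[OF small_sheafify[OF Q]] *]
  have "ext_trans C (assoc_sheaf P) (\<lambda>X s. up C (sheafify Q) X (?m X s))
      \<in> nat_trans C (assoc_sheaf P) (assoc_sheaf Q)" by (simp add: assoc_sheaf_def)
  also have "ext_trans C (assoc_sheaf P) (\<lambda>X s. up C (sheafify Q) X (?m X s)) = assoc_map P Q \<alpha>"
    unfolding assoc_map_def by (rule ext_trans_cong) simp
  finally show ?thesis .
qed

lemma assoc_unit_in:
  assumes P: "P \<in> presheaves C"
  shows "assoc_unit P \<in> nat_trans C P (assoc_sheaf P)"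
  unfolding assoc_unit_def assoc_sheaf_def
  by (rule comp_trans_in[OF unit_in up_in[OF small_sheafify]]) (use P in simp_all)

lemma assoc_functor: "is_functor (psh_cat C) (full_subcat (psh_cat C) Sh) assoc_func"
  unfolding is_functor_def
proof (intro conjI ballI impI)
  fix P :: "('o, 'm, 'u) presheaf" assume "P \<in> Obj (psh_cat C)"
  then have P: "P \<in> presheaves C" by simp
  then show "FOb assoc_func P \<in> Obj (full_subcat (psh_cat C) Sh)"
    using assoc_sheaf_sheaf by (simp add: assoc_func_def)
  have "assoc_map P P (ext_trans C P (\<lambda>X s. s)) = ext_trans C (assoc_sheaf P) (\<lambda>X s. s)"
    unfolding assoc_map_def
  proof (rule ext_trans_cong)
    fix X u assume X: "X \<in> Obj C" "u \<in> At (assoc_sheaf P) X"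
    then show "up C (sheafify P) X
        (sheafify_map P P (ext_trans C P (\<lambda>X s. s)) X (down C (sheafify P) X u)) = u"
      using sheafify_map_id[OF _ down_section[OF P X]] up_down[OF small_sheafify[OF P], of X u] P
      by (simp add: assoc_sheaf_def)
  qed
  then show "FMor assoc_func (Id (psh_cat C) P) =
      Id (full_subcat (psh_cat C) Sh) (FOb assoc_func P)"
    by (simp add: assoc_func_def)
next
  fix f :: "('o, 'm, 'u) presheaf \<times> ('o, 'm, 'u) presheaf \<times> ('o \<Rightarrow> 'u \<Rightarrow> 'u)"
  assume "f \<in> Mor (psh_cat C)"
  then obtain P Q \<alpha> where f: "f = (P, Q, \<alpha>)" "P \<in> presheaves C" "Q \<in> presheaves C"
    "\<alpha> \<in> nat_trans C P Q" by (rule Mor_psh_catE)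
  then show "FMor assoc_func f \<in> hom (full_subcat (psh_cat C) Sh)
      (FOb assoc_func (Dom (psh_cat C) f)) (FOb assoc_func (Cod (psh_cat C) f))"
    using assoc_map_in assoc_sheaf_sheaf assoc_sheaf_in
    by (simp add: assoc_func_def hom_full_subcat_iff)
  fix g assume "g \<in> Mor (psh_cat C)" and fg: "Cod (psh_cat C) f = Dom (psh_cat C) g"
  then obtain R \<beta> where g: "g = (Q, R, \<beta>)" "R \<in> presheaves C" "\<beta> \<in> nat_trans C Q R"
    using f by (auto elim!: Mor_psh_catE)
  have "assoc_map P R (ext_trans C P (\<lambda>X s. \<beta> X (\<alpha> X s))) =
    ext_trans C (assoc_sheaf P) (\<lambda>X u. assoc_map Q R \<beta> X (assoc_map P Q \<alpha> X u))"
    unfolding assoc_map_def[of P R]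
  proof (rule ext_trans_cong)
    fix X u assume X: "X \<in> Obj C" "u \<in> At (assoc_sheaf P) X"
    let ?G = "down C (sheafify P) X u"
    have G: "is_section P X ?G" using down_section[OF f(2) X] .
    have u: "u = up C (sheafify P) X ?G"
      using up_down[OF small_sheafify[OF f(2)], of X u] X by (simp add: assoc_sheaf_def)
    have "assoc_map P Q \<alpha> X u = up C (sheafify Q) X (sheafify_map P Q \<alpha> X ?G)"
      using assoc_map_up[OF f(2) X(1) G, of Q \<alpha>] u by simp
    moreover have "is_section Q X (sheafify_map P Q \<alpha> X ?G)"
      using is_section_sheafify_map[OF _ _ f(4) G] f by simp
    ultimately have "assoc_map Q R \<beta> X (assoc_map P Q \<alpha> X u) =
        up C (sheafify R) X (sheafify_map Q R \<beta> X (sheafify_map P Q \<alpha> X ?G))"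
      using assoc_map_up[OF f(3) X(1)] by simp
    then show "up C (sheafify R) X (sheafify_map P R (ext_trans C P (\<lambda>X s. \<beta> X (\<alpha> X s))) X ?G) =
        assoc_map Q R \<beta> X (assoc_map P Q \<alpha> X u)"
      using sheafify_map_comp[OF _ _ _ f(4) g(3) G] f g by simp
  qed
  then show "FMor assoc_func (Comp (psh_cat C) g f) =
      Comp (full_subcat (psh_cat C) Sh) (FMor assoc_func g) (FMor assoc_func f)"
    using f g by (simp add: assoc_func_def)
qed

lemma assoc_unit_natural:
  assumes P: "P \<in> presheaves C" and Q: "Q \<in> presheaves C" and \<alpha>: "\<alpha> \<in> nat_trans C P Q"
    and X: "X \<in> Obj C" and s: "s \<in> At P X"
  shows "assoc_unit Q X (\<alpha> X s) = assoc_map P Q \<alpha> X (assoc_unit P X s)"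
  using assoc_map_up[OF P X is_section_unit[OF _ X s], of Q \<alpha>] sheafify_map_unit[OF _ _ \<alpha> X s]
    nat_trans_in[OF \<alpha> X s] P Q X s
  by (simp add: assoc_unit_def)

lemma assoc_unit_bij:
  assumes P: "P \<in> presheaves C" and Q: "Q \<in> Sh"
  shows "bij_betw (\<lambda>g. Comp (psh_cat C) g (assoc_eta P))
    (hom (psh_cat C) (assoc_sheaf P) Q) (hom (psh_cat C) P Q)"
proof -
  have Qs: "is_sheaf Q" and QP: "Q \<in> presheaves C" using Q by (auto simp: sheaves_iff)
  have pre: "is_presheaf C P" using P by simp
  note aP = assoc_sheaf_in[OF P] and sm = small_sheafify[OF P]
  have comp_up: "ext_trans C (sheafify P) (\<lambda>X G. \<beta> X (up C (sheafify P) X G)) \<in> nat_trans C (sheafify P) Q"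
    if "\<beta> \<in> nat_trans C (assoc_sheaf P) Q" for \<beta>
    using comp_trans_in[OF up_in[OF sm], of \<beta> Q] that is_presheaf_sheafify[OF pre]
    by (simp add: assoc_sheaf_def)
  show ?thesis
    unfolding bij_betw_def
  proof (intro conjI inj_onI equalityI subsetI)
    fix g h assume "g \<in> hom (psh_cat C) (assoc_sheaf P) Q" "h \<in> hom (psh_cat C) (assoc_sheaf P) Q"
      and eq: "Comp (psh_cat C) g (assoc_eta P) = Comp (psh_cat C) h (assoc_eta P)"
    then obtain \<beta> \<gamma> where g: "g = (assoc_sheaf P, Q, \<beta>)" "\<beta> \<in> nat_trans C (assoc_sheaf P) Q"
      and h: "h = (assoc_sheaf P, Q, \<gamma>)" "\<gamma> \<in> nat_trans C (assoc_sheaf P) Q"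
      by (auto simp: hom_psh_cat)
    have e: "ext_trans C P (\<lambda>X s. \<beta> X (assoc_unit P X s)) =
        ext_trans C P (\<lambda>X s. \<gamma> X (assoc_unit P X s))"
      using eq g h by (simp add: assoc_eta_def)
    have "ext_trans C (sheafify P) (\<lambda>X G. \<beta> X (up C (sheafify P) X G)) =
        ext_trans C (sheafify P) (\<lambda>X G. \<gamma> X (up C (sheafify P) X G))"
    proof (rule unit_epi[OF pre Qs comp_up[OF g(2)] comp_up[OF h(2)]])
      fix X s assume X: "X \<in> Obj C" "s \<in> At P X"
      show "ext_trans C (sheafify P) (\<lambda>X G. \<beta> X (up C (sheafify P) X G)) X (unit P X s) =
        ext_trans C (sheafify P) (\<lambda>X G. \<gamma> X (up C (sheafify P) X G)) X (unit P X s)"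
        using fun_cong[OF fun_cong[OF e, of X], of s] X is_section_unit[OF pre X]
        by (simp add: assoc_unit_def)
    qed
    note e' = this
    have "\<beta> = \<gamma>"
    proof (rule nat_trans_eqI[OF g(2) h(2)])
      fix X u assume X: "X \<in> Obj C" "u \<in> At (assoc_sheaf P) X"
      have "u = up C (sheafify P) X (down C (sheafify P) X u)"
        using up_down[OF sm, of X u] X by (simp add: assoc_sheaf_def)
      then show "\<beta> X u = \<gamma> X u"
        using fun_cong[OF fun_cong[OF e', of X], of "down C (sheafify P) X u"] X
          down_section[OF P X] by simp
    qed
    then show "g = h" using g h by simp
  next
    fix f assume "f \<in> (\<lambda>g. Comp (psh_cat C) g (assoc_eta P)) ` hom (psh_cat C) (assoc_sheaf P) Q"
    then obtain \<beta> where "\<beta> \<in> nat_trans C (assoc_sheaf P) Q"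
      "f = Comp (psh_cat C) (assoc_sheaf P, Q, \<beta>) (assoc_eta P)" by (auto simp: hom_psh_cat)
    then show "f \<in> hom (psh_cat C) P Q"
      using comp_trans_in[OF assoc_unit_in[OF P] _ pre] P QP by (simp add: assoc_eta_def)
  next
    fix f assume "f \<in> hom (psh_cat C) P Q"
    then obtain \<alpha> where f: "f = (P, Q, \<alpha>)" "\<alpha> \<in> nat_trans C P Q" by (auto simp: hom_psh_cat)
    define \<beta> where "\<beta> = ext_trans C (assoc_sheaf P) (\<lambda>X u. lift P Q \<alpha> X (down C (sheafify P) X u))"
    have \<beta>: "\<beta> \<in> nat_trans C (assoc_sheaf P) Q"
      using comp_trans_in[OF down_in[OF sm] lift_in[OF pre Qs f(2)]] aP
      by (simp add: \<beta>_def assoc_sheaf_def)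
    have "ext_trans C P (\<lambda>X s. \<beta> X (assoc_unit P X s)) = \<alpha>"
    proof (rule nat_trans_eqI[OF comp_trans_in[OF assoc_unit_in[OF P] \<beta> pre] f(2)])
      fix X s assume X: "X \<in> Obj C" "s \<in> At P X"
      have "assoc_unit P X s \<in> At (assoc_sheaf P) X" using nat_trans_in[OF assoc_unit_in[OF P] X] .
      then show "ext_trans C P (\<lambda>X s. \<beta> X (assoc_unit P X s)) X s = \<alpha> X s"
        using X lift_unit[OF pre Qs f(2) X] down_up[OF sm X(1), of "unit P X s"] is_section_unit[OF pre X]
        by (simp add: \<beta>_def assoc_unit_def)
    qed
    then have "f = Comp (psh_cat C) (assoc_sheaf P, Q, \<beta>) (assoc_eta P)"
      using f by (simp add: assoc_eta_def)
    moreover have "(assoc_sheaf P, Q, \<beta>) \<in> hom (psh_cat C) (assoc_sheaf P) Q"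
      using \<beta> aP QP by simp
    ultimately show "f \<in> (\<lambda>g. Comp (psh_cat C) g (assoc_eta P)) ` hom (psh_cat C) (assoc_sheaf P) Q"
      by (rule image_eqI)
  qed
qed

lemma Sh_presheaves: "Sh \<subseteq> presheaves C"
  by (auto simp: sheaves_iff)

lemma assoc_adjunction:
  "adjunction (psh_cat C) (full_subcat (psh_cat C) Sh) assoc_func id_func assoc_eta"
  unfolding adjunction_def
proof (intro conjI ballI assoc_functor)
  show "is_functor (full_subcat (psh_cat C) Sh) (psh_cat C) id_func"
    using Sh_presheaves category.category_psh_cat[OF category_axioms]
    by (auto simp: is_functor_def id_func_def hom_def)
  show "natural (psh_cat C) (psh_cat C) id_func (comp_func id_func assoc_func) assoc_eta"
    unfolding natural_def
  proof (intro conjI ballI)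
    fix P :: "('o, 'm, 'u) presheaf" assume "P \<in> Obj (psh_cat C)"
    then show "assoc_eta P \<in> hom (psh_cat C) (FOb id_func P) (FOb (comp_func id_func assoc_func) P)"
      using assoc_unit_in assoc_sheaf_in
      by (simp add: assoc_eta_def id_func_def comp_func_def assoc_func_def)
  next
    fix f :: "('o, 'm, 'u) presheaf \<times> ('o, 'm, 'u) presheaf \<times> ('o \<Rightarrow> 'u \<Rightarrow> 'u)"
  assume "f \<in> Mor (psh_cat C)"
    then obtain P Q \<alpha> where f: "f = (P, Q, \<alpha>)" "P \<in> presheaves C" "Q \<in> presheaves C"
      "\<alpha> \<in> nat_trans C P Q" by (rule Mor_psh_catE)
    have "ext_trans C P (\<lambda>X s. assoc_unit Q X (\<alpha> X s)) =
        ext_trans C P (\<lambda>X s. assoc_map P Q \<alpha> X (assoc_unit P X s))"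
      by (rule ext_trans_cong) (rule assoc_unit_natural[OF f(2-4)])
    then show "Comp (psh_cat C) (assoc_eta (Cod (psh_cat C) f)) (FMor id_func f) =
        Comp (psh_cat C) (FMor (comp_func id_func assoc_func) f) (assoc_eta (Dom (psh_cat C) f))"
      using f by (simp add: assoc_eta_def id_func_def comp_func_def assoc_func_def)
  qed
  fix P Q :: "('o, 'm, 'u) presheaf"
  assume "P \<in> Obj (psh_cat C)" "Q \<in> Obj (full_subcat (psh_cat C) Sh)"
  then show "bij_betw (\<lambda>g. Comp (psh_cat C) (FMor id_func g) (assoc_eta P))
      (hom (full_subcat (psh_cat C) Sh) (FOb assoc_func P) Q) (hom (psh_cat C) P (FOb id_func Q))"
    using assoc_unit_bij[of P Q] assoc_sheaf_sheaf[of P] by (simp add: id_func_def assoc_func_def)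
qed

text \<open>Pass from a limit to its pointwise form, sheafify there, move the result into the universe, and
  return to limits.\<close>

lemma assoc_lex: "preserves_finite_limits (psh_cat C) (full_subcat (psh_cat C) Sh) assoc_func"
  unfolding preserves_finite_limits_def
proof (intro allI impI, elim conjE)
  fix K :: "(nat, nat) cat" and D and L :: "('o, 'm, 'u) presheaf" and \<pi>
  assume K: "category K" "finite (Obj K)" "finite (Mor K)"
    and D: "is_functor K (psh_cat C) D" and lim: "is_limit (psh_cat C) K D L \<pi>"
  interpret K: category K by fact
  have cone: "is_cone (psh_cat C) K D L \<pi>" using lim by (simp add: is_limit_def)
  obtain p where L: "L \<in> presheaves C" and p: "\<And>i. i \<in> Obj K \<Longrightarrow> p i \<in> nat_trans C L (FOb D i)"
    "\<And>i. i \<in> Obj K \<Longrightarrow> \<pi> i = (L, FOb D i, p i)" using cone by (rule cone_psh_catE) blast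
  obtain d where DP: "\<And>i. i \<in> Obj K \<Longrightarrow> FOb D i \<in> presheaves C"
    and d: "\<And>k. k \<in> Mor K \<Longrightarrow> d k \<in> nat_trans C (FOb D (Dom K k)) (FOb D (Cod K k))"
    "\<And>k. k \<in> Mor K \<Longrightarrow> FMor D k = (FOb D (Dom K k), FOb D (Cod K k), d k)"
    using D by (rule functor_psh_catE) blast
  have coneD: "d k X (p (Dom K k) X l) = p (Cod K k) X l"
    if "k \<in> Mor K" "X \<in> Obj C" "l \<in> At L X" for k X l
  proof -
    have "Comp (psh_cat C) (FMor D k) (\<pi> (Dom K k)) = \<pi> (Cod K k)"
      using cone that by (auto simp: is_cone_def)
    then have "ext_trans C L (\<lambda>X m. d k X (p (Dom K k) X m)) = p (Cod K k)"
      using that p(2) d(2) by simp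
    from fun_cong[OF fun_cong[OF this, of X], of l] show ?thesis using that by simp
  qed
  have plim: "pointwise_limit K (FOb D) d L p"
    using limit_pointwise[OF K(1) D lim] p(2) d(2) unfolding pointwise_limit_def by simp
  let ?aD = "comp_func assoc_func D"
  let ?E = "full_subcat (psh_cat C) Sh"
  have slim: "pointwise_limit K (\<lambda>i. sheafify (FOb D i))
    (\<lambda>k. sheafify_map (FOb D (Dom K k)) (FOb D (Cod K k)) (d k)) (sheafify L)
    (\<lambda>i. sheafify_map L (FOb D i) (p i))"
    by (rule sheafify_pointwise_limit[OF K _ d(1) _ p(1) coneD plim]) (use DP L in auto)
  have alim: "pointwise_limit K (\<lambda>i. assoc_sheaf (FOb D i))
    (\<lambda>k. assoc_map (FOb D (Dom K k)) (FOb D (Cod K k)) (d k)) (assoc_sheaf L)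
    (\<lambda>i. assoc_map L (FOb D i) (p i))"
  proof (rule pointwise_limit_iso[OF slim K(1), where \<delta> = "\<lambda>i. up C (sheafify (FOb D i))"
        and \<mu> = "up C (sheafify L)"])
    show "bij_betw (up C (sheafify (FOb D i)) X) (At (sheafify (FOb D i)) X) (At (assoc_sheaf (FOb D i)) X)"
      if "i \<in> Obj K" "X \<in> Obj C" for i X
      unfolding assoc_sheaf_def by (rule up_bij[OF small_sheafify[OF DP[OF that(1)]] that(2)])
    show "bij_betw (up C (sheafify L) X) (At (sheafify L) X) (At (assoc_sheaf L) X)"
      if "X \<in> Obj C" for X
      unfolding assoc_sheaf_def by (rule up_bij[OF small_sheafify[OF L] that])
  qed (use assoc_map_up DP L is_section_sheafify_map[OF _ _ d(1)] is_section_sheafify_map[OF _ _ p(1)]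
      in auto)
  have lex: "is_limit ?E K ?aD (assoc_sheaf L) (\<lambda>i. FMor assoc_func (\<pi> i))"
  proof (rule limit_of_pointwise_limit[OF Sh_presheaves _ _ K(1)])
    show "is_functor K ?E ?aD"
      using D assoc_functor by (auto simp: is_functor_def comp_func_def hom_def)
    show "is_cone ?E K ?aD (assoc_sheaf L) (\<lambda>i. FMor assoc_func (\<pi> i))"
      unfolding is_cone_def
    proof (intro conjI ballI)
      show "assoc_sheaf L \<in> Obj ?E" using assoc_sheaf_sheaf[OF L] by simp
      show "FMor assoc_func (\<pi> i) \<in> hom ?E (assoc_sheaf L) (FOb ?aD i)" if i: "i \<in> Obj K" for i
        using assoc_map_in[OF L DP[OF i] p(1)[OF i]] assoc_sheaf_sheaf assoc_sheaf_in L DP[OF i] p(2)[OF i]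
        by (simp add: hom_full_subcat_iff assoc_func_def comp_func_def)
      fix k assume k: "k \<in> Mor K"
      have "FMor assoc_func (Comp (psh_cat C) (FMor D k) (\<pi> (Dom K k))) =
          Comp ?E (FMor assoc_func (FMor D k)) (FMor assoc_func (\<pi> (Dom K k)))"
        using assoc_functor d p k L DP unfolding is_functor_def
        by (metis K.Dom_Cod_Obj(1,2) full_subcat_simps(6) psh_cat_simps(2,3,4))
      moreover have "Comp (psh_cat C) (FMor D k) (\<pi> (Dom K k)) = \<pi> (Cod K k)"
        using cone k by (auto simp: is_cone_def)
      ultimately show "Comp ?E (FMor ?aD k) (FMor assoc_func (\<pi> (Dom K k))) = FMor assoc_func (\<pi> (Cod K k))"
        by (simp add: comp_func_def)
    qed
    show "pointwise_limit K (FOb ?aD) (\<lambda>k. snd (snd (FMor ?aD k))) (assoc_sheaf L)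
        (\<lambda>i. snd (snd (FMor assoc_func (\<pi> i))))"
      using alim p(2) d(2) unfolding pointwise_limit_def
      by (simp add: comp_func_def assoc_func_def)
  qed
  then show "is_limit ?E K ?aD (FOb assoc_func L) (\<lambda>i. FMor assoc_func (\<pi> i))"
    by (simp add: assoc_func_def)
qed

lemma assoc_unit_iso:
  assumes P: "P \<in> presheaves C"
  shows "P \<in> Sh \<longleftrightarrow> is_iso (psh_cat C) (assoc_eta P)"
proof
  assume "P \<in> Sh"
  then have sh: "is_sheaf P" by (simp add: sheaves_iff)
  have "bij_betw (assoc_unit P X) (At P X) (At (assoc_sheaf P) X)" if X: "X \<in> Obj C" for X
  proof -
    have "bij_betw (up C (sheafify P) X \<circ> unit P X) (At P X) (At (assoc_sheaf P) X)"
      unfolding assoc_sheaf_def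
      by (rule bij_betw_trans[OF unit_bij[OF sh X] up_bij[OF small_sheafify[OF P] X]])
    then show ?thesis using X by (rule_tac bij_betw_cong[THEN iffD1]) (auto simp: assoc_unit_def)
  qed
  then show "is_iso (psh_cat C) (assoc_eta P)"
    using P assoc_sheaf_in[OF P] assoc_unit_in[OF P] by (simp add: assoc_eta_def is_iso_psh_cat)
next
  assume "is_iso (psh_cat C) (assoc_eta P)"
  then have bij: "\<And>X. X \<in> Obj C \<Longrightarrow> bij_betw (assoc_unit P X) (At P X) (At (assoc_sheaf P) X)"
    by (simp add: assoc_eta_def is_iso_psh_cat)
  have pre: "is_presheaf C P" "is_presheaf C (assoc_sheaf P)" using P assoc_sheaf_in[OF P] by auto
  have "is_sheaf P"
  proof (rule is_sheaf_iso)
    show "is_sheaf (assoc_sheaf P)" using assoc_sheaf_sheaf[OF P] by (simp add: sheaves_iff)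
    show "ext_trans C (assoc_sheaf P) (\<lambda>X. inv_into (At P X) (assoc_unit P X))
        \<in> nat_trans C (assoc_sheaf P) P"
      by (rule inverse_trans[OF pre assoc_unit_in[OF P] bij])
    show "bij_betw (ext_trans C (assoc_sheaf P) (\<lambda>X. inv_into (At P X) (assoc_unit P X)) X)
        (At (assoc_sheaf P) X) (At P X)" if "X \<in> Obj C" for X
      using bij_betw_inv_into[OF bij[OF that]] that
      by (rule_tac bij_betw_cong[THEN iffD1, of _ "inv_into (At P X) (assoc_unit P X)"]) auto
  qed (use pre in auto)
  then show "P \<in> Sh" using P by (simp add: sheaves_iff)
qed

lemma subtopos_sheaves: "subtopos C Sh"
  unfolding subtopos_def
  using Sh_presheaves assoc_adjunction assoc_lex assoc_unit_iso by blast

end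

section \<open>Every subtopos consists of the sheaves for its dual topology\<close>

locale lex_reflection = small_category C U + R: reflection "psh_cat C" E L \<eta>
  for C :: "('o, 'm) cat" and U :: "'u itself"
    and E :: "('o, 'm, 'u) presheaf set" and L \<eta> +
  assumes lex: "preserves_finite_limits (psh_cat C) (full_subcat (psh_cat C) E) L"
begin

lemma full_subcat_presheaves: "full_subcat (psh_cat C) (presheaves C) = psh_cat C"
  by (auto simp: full_subcat_def psh_cat_def)

lemma inverted_pointwise_pullback:
  assumes f: "R.inverted (A, B, f)" and g: "(D, B, g) \<in> Mor (psh_cat C)"
    and p: "(P, A, p) \<in> Mor (psh_cat C)" and q: "(P, D, q) \<in> Mor (psh_cat C)"
    and comm: "\<And>X u. X \<in> Obj C \<Longrightarrow> u \<in> At P X \<Longrightarrow> f X (p X u) = g X (q X u)"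
    and ex1: "\<And>X a b. X \<in> Obj C \<Longrightarrow> a \<in> At A X \<Longrightarrow> b \<in> At D X \<Longrightarrow> f X a = g X b \<Longrightarrow>
      \<exists>!u. u \<in> At P X \<and> p X u = a \<and> q X u = b"
  shows "R.inverted (P, D, q)"
proof (rule R.inverted_pullback[OF lex f g])
  have fM: "(A, B, f) \<in> Mor (psh_cat C)" using f by (simp add: R.inverted_def)
  show "Cod (psh_cat C) (A, B, f) = Cod (psh_cat C) (D, B, g)" by simp
  let ?F = "cospan_func (psh_cat C) (A, B, f) (D, B, g)"
  let ?c = "cospan_cone (psh_cat C) (A, B, f) (P, A, p) (P, D, q)"
  have func: "is_functor cospan (psh_cat C) ?F"
    by (rule R.functor_cospan_func[OF fM g]) simp
  have fp: "ext_trans C P (\<lambda>X u. f X (p X u)) \<in> nat_trans C P B"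
    using fM p comp_trans_in[of p P A f B] by simp
  have gq: "ext_trans C P (\<lambda>X u. g X (q X u)) = ext_trans C P (\<lambda>X u. f X (p X u))"
    using comm by (intro ext_trans_cong) simp
  have idc: "ext_trans C P (\<lambda>X u. ext_trans C Q (\<lambda>X s. s) X (\<alpha> X u)) = \<alpha>"
    if "\<alpha> \<in> nat_trans C P Q" for Q :: "('o, 'm, 'u) presheaf" and \<alpha>
  proof -
    have "ext_trans C P (\<lambda>X u. ext_trans C Q (\<lambda>X s. s) X (\<alpha> X u)) = ext_trans C P \<alpha>"
      using nat_trans_in[OF that] by (intro ext_trans_cong) simp
    then show ?thesis using ext_trans_nat_trans[OF that] by simp
  qed
  have "is_cone (psh_cat C) cospan ?F P ?c"
    using fM g p q fp gq idc[of p A] idc[of q D] idc[OF fp]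
    by (auto simp: is_cone_def cospan_def cospan_func_def cospan_cone_def)
  moreover have "pointwise_limit cospan (FOb ?F) (\<lambda>k. snd (snd (FMor ?F k))) P (\<lambda>i. snd (snd (?c i)))"
    unfolding pointwise_limit_def
  proof (intro ballI allI impI)
    fix X a assume X: "X \<in> Obj C" and "(\<forall>i \<in> Obj cospan. a i \<in> At (FOb ?F i) X) \<and>
      (\<forall>k \<in> Mor cospan. snd (snd (FMor ?F k)) X (a (Dom cospan k)) = a (Cod cospan k))"
    then have a: "a 0 \<in> At A X" "a 1 \<in> At D X" "f X (a 0) = a 2" "g X (a 1) = a 2"
      by (auto simp: cospan_def cospan_func_def)
    have "(u \<in> At P X \<and> (\<forall>i \<in> Obj cospan. snd (snd (?c i)) X u = a i)) \<longleftrightarrow>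
        (u \<in> At P X \<and> p X u = a 0 \<and> q X u = a 1)" for u
      using a X by (auto simp: cospan_def cospan_cone_def)
    then show "\<exists>!u. u \<in> At P X \<and> (\<forall>i \<in> Obj cospan. snd (snd (?c i)) X u = a i)"
      using ex1[OF X a(1,2)] a(3,4) by simp
  qed
  ultimately show "is_limit (psh_cat C) cospan ?F P ?c"
    using limit_of_pointwise_limit[of "presheaves C" cospan ?F P ?c] category_cospan func
    by (simp add: full_subcat_presheaves)
qed

definition sub_repr :: "'m set \<Rightarrow> ('o, 'm, 'u) presheaf" where
  "sub_repr S = shrink C (sieve_of S)"

definition incl :: "'o \<Rightarrow> 'm set \<Rightarrow> 'o \<Rightarrow> 'u \<Rightarrow> 'u" where
  "incl X S = ext_trans C (sub_repr S)
    (\<lambda>Y u. up C (sieve_of (into X)) Y (down C (sieve_of S) Y u))"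

context
  fixes X S
  assumes X: "X \<in> Obj C" and S: "is_sieve X S"
begin

lemma sub_repr_in: "sub_repr S \<in> presheaves C"
  unfolding sub_repr_def by (rule shrink_in_presheaves[OF small_presheaf_sieve_of[OF S X]])

lemma sub_repr_down:
  assumes "Y \<in> Obj C" "u \<in> At (sub_repr S) Y"
  shows "down C (sieve_of S) Y u \<in> S" "Dom C (down C (sieve_of S) Y u) = Y"
    "u = up C (sieve_of S) Y (down C (sieve_of S) Y u)"
  using nat_trans_in[OF down_in[OF small_presheaf_sieve_of[OF S X]], of Y u]
    up_down[OF small_presheaf_sieve_of[OF S X], of Y u] assms
  by (auto simp: sub_repr_def At_sieve_of)

lemma sub_repr_up:
  assumes "f \<in> S"
  shows "up C (sieve_of S) (Dom C f) f \<in> At (sub_repr S) (Dom C f)"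
    "down C (sieve_of S) (Dom C f) (up C (sieve_of S) (Dom C f) f :: 'u) = f"
  using nat_trans_in[OF up_in[OF small_presheaf_sieve_of[OF S X]], of "Dom C f" f]
    down_up[OF small_presheaf_sieve_of[OF S X], of "Dom C f" f] assms is_sieveD[OF S]
  by (auto simp: sub_repr_def At_sieve_of)

lemma sub_repr_trans:
  assumes "is_presheaf C Q" "compatible Q S \<phi>"
  shows "ext_trans C (sub_repr S) (\<lambda>Y u. \<phi> (down C (sieve_of S) Y u)) \<in> nat_trans C (sub_repr S) Q"
proof -
  have "ext_trans C (sub_repr S) (\<lambda>Y u. ext_trans C (sieve_of S) (\<lambda>Y. \<phi>) Y (down C (sieve_of S) Y u))
      \<in> nat_trans C (sub_repr S) Q"
    using comp_trans_in[OF down_in[OF small_presheaf_sieve_of[OF S X]] compatible_trans[OF S assms(2)]]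
      sub_repr_in by (simp add: sub_repr_def)
  also have "ext_trans C (sub_repr S) (\<lambda>Y u. ext_trans C (sieve_of S) (\<lambda>Y. \<phi>) Y (down C (sieve_of S) Y u)) =
      ext_trans C (sub_repr S) (\<lambda>Y u. \<phi> (down C (sieve_of S) Y u))"
    using sub_repr_down by (intro ext_trans_cong) (simp add: At_sieve_of)
  finally show ?thesis .
qed

lemma incl_in: "incl X S \<in> nat_trans C (sub_repr S) (repr X)"
  unfolding incl_def
proof (rule ext_trans_in)
  let ?y = "sieve_of (into X)" and ?d = "down C (sieve_of S)"
  have up: "up C ?y (Dom C f) f \<in> At (repr X) (Dom C f)" if "f \<in> S" for f
    using nat_trans_in[OF up_in[OF small_presheaf_into[OF X]], of "Dom C f" f] is_sieveD[OF S that]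
    by (simp add: repr_def At_sieve_of into_def)
  show "up C ?y Y (?d Y u) \<in> At (repr X) Y" if "Y \<in> Obj C" "u \<in> At (sub_repr S) Y" for Y u
    using up[OF sub_repr_down(1)[OF that]] sub_repr_down(2)[OF that] by simp
  fix f u assume f: "f \<in> Mor C" and u: "u \<in> At (sub_repr S) (Cod C f)"
  note d = sub_repr_down[OF Dom_Cod_Obj(2)[OF f] u]
  note dD = is_sieveD[OF S d(1)]
  have "?d (Dom C f) (Act (sub_repr S) f u) = Comp C (?d (Cod C f) u) f"
    using nat_trans_natural[OF down_in[OF small_presheaf_sieve_of[OF S X]] f, of u] u f d
    by (simp add: sub_repr_def Act_sieve_of)
  moreover have "Act (repr X) f (up C ?y (Cod C f) (?d (Cod C f) u)) =
      up C ?y (Dom C f) (Comp C (?d (Cod C f) u) f)"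
    using Act_shrink[OF small_presheaf_into[OF X] f, of "?d (Cod C f) u"] d dD f
    by (simp add: repr_def At_sieve_of Act_sieve_of into_def)
  ultimately show "up C ?y (Dom C f) (?d (Dom C f) (Act (sub_repr S) f u)) =
      Act (repr X) f (up C ?y (Cod C f) (?d (Cod C f) u))" by simp
qed (use sub_repr_in in simp)

lemma point_incl:
  assumes "f \<in> S"
  shows "point X Q s (Dom C f) (incl X S (Dom C f) (up C (sieve_of S) (Dom C f) f)) = Act Q f s"
proof -
  note fD = is_sieveD[OF S assms]
  have "incl X S (Dom C f) (up C (sieve_of S) (Dom C f) f) = up C (sieve_of (into X)) (Dom C f) f"
    using sub_repr_up[OF assms] fD by (simp add: incl_def)
  moreover have "up C (sieve_of (into X)) (Dom C f) f \<in> At (repr X) (Dom C f)"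
    using nat_trans_in[OF up_in[OF small_presheaf_into[OF X]], of "Dom C f" f] fD
    by (simp add: repr_def At_sieve_of into_def)
  ultimately show ?thesis
    using down_up[OF small_presheaf_into[OF X], of "Dom C f" f] fD
    by (simp add: point_def At_sieve_of into_def)
qed

text \<open>By the Yoneda lemma, orthogonality to the inclusion of a sieve is the sheaf condition.\<close>

lemma sheaf_on_inverted_incl:
  assumes inv: "R.inverted (sub_repr S, repr X, incl X S)" and Q: "Q \<in> E"
  shows "sheaf_on Q X S"
proof -
  have QP: "Q \<in> presheaves C" and pre: "is_presheaf C Q" using Q R.E_Obj by auto
  have bij: "bij_betw (\<lambda>h. Comp (psh_cat C) h (sub_repr S, repr X, incl X S))
      (hom (psh_cat C) (repr X) Q) (hom (psh_cat C) (sub_repr S) Q)"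
    using R.inverted_orthogonal[OF inv Q] by simp
  define j where "j \<beta> = ext_trans C (sub_repr S) (\<lambda>Y u. \<beta> Y (incl X S Y u))" for \<beta> :: "'o \<Rightarrow> 'u \<Rightarrow> 'u"
  have j_up: "j \<beta> (Dom C f) (up C (sieve_of S) (Dom C f) f) =
      \<beta> (Dom C f) (incl X S (Dom C f) (up C (sieve_of S) (Dom C f) f))" if "f \<in> S" for \<beta> f
    using sub_repr_up[OF that] is_sieveD[OF S that] by (simp add: j_def)
  have inj: "\<beta> = \<gamma>"
    if "\<beta> \<in> nat_trans C (repr X) Q" "\<gamma> \<in> nat_trans C (repr X) Q" "j \<beta> = j \<gamma>" for \<beta> \<gamma>
  proof -
    have "(repr X, Q, \<beta>) = (repr X, Q, \<gamma>)"
      by (rule inj_onD[OF bij_betw_imp_inj_on[OF bij]])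
        (use that QP repr_in[OF X] in \<open>auto simp: j_def\<close>)
    then show ?thesis by simp
  qed
  show ?thesis
    unfolding sheaf_on_def separated_on_def
  proof (intro conjI ballI allI impI)
    fix s t assume s: "s \<in> At Q X" and t: "t \<in> At Q X" and eq: "\<forall>f \<in> S. Act Q f s = Act Q f t"
    have "j (point X Q s) = j (point X Q t)"
      unfolding j_def
    proof (rule ext_trans_cong)
      fix Y u assume u: "Y \<in> Obj C" "u \<in> At (sub_repr S) Y"
      note d = sub_repr_down[OF u]
      show "point X Q s Y (incl X S Y u) = point X Q t Y (incl X S Y u)"
        using point_incl[OF d(1), of Q s] point_incl[OF d(1), of Q t] eq d by simp
    qed
    then have "point X Q s = point X Q t"
      by (rule inj[OF point_in[OF X pre s] point_in[OF X pre t]])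
    then show "s = t" using point_generic[OF X pre s] point_generic[OF X pre t] by metis
  next
    fix \<phi> assume \<phi>: "compatible Q S \<phi>"
    let ?\<alpha> = "ext_trans C (sub_repr S) (\<lambda>Y u. \<phi> (down C (sieve_of S) Y u))"
    have "(sub_repr S, Q, ?\<alpha>) \<in> hom (psh_cat C) (sub_repr S) Q"
      using sub_repr_trans[OF pre \<phi>] sub_repr_in QP by simp
    then have "(sub_repr S, Q, ?\<alpha>) \<in>
        (\<lambda>h. Comp (psh_cat C) h (sub_repr S, repr X, incl X S)) ` hom (psh_cat C) (repr X) Q"
      using bij by (simp add: bij_betw_def)
    then obtain \<beta> where \<beta>: "\<beta> \<in> nat_trans C (repr X) Q" "?\<alpha> = j \<beta>"
      by (auto simp: hom_psh_cat j_def)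
    define s where "s = \<beta> X (generic X)"
    have s: "s \<in> At Q X" unfolding s_def using nat_trans_in[OF \<beta>(1) X generic_in[OF X]] .
    have "\<beta> = point X Q s"
      by (rule repr_trans_eqI[OF X \<beta>(1) point_in[OF X pre s]])
        (simp only: point_generic[OF X pre s] s_def[symmetric])
    then have j_act: "j \<beta> (Dom C f) (up C (sieve_of S) (Dom C f) f) = Act Q f s" if "f \<in> S" for f
      using point_incl[OF that, of Q s] j_up[OF that, of \<beta>] by simp
    have "Act Q f s = \<phi> f" if f: "f \<in> S" for f
    proof -
      have "?\<alpha> (Dom C f) (up C (sieve_of S) (Dom C f) f) = \<phi> f"
        using sub_repr_up[OF f] is_sieveD[OF S f] by simp
      then show ?thesis unfolding \<beta>(2) using j_act[OF f] by simp
    qed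
    then show "\<exists>s \<in> At Q X. \<forall>f \<in> S. Act Q f s = \<phi> f" using s by blast
  qed
qed

end

text \<open>Pulling an inverted monomorphism back along the point \<open>b\<close> of its codomain gives the inclusion of
  the sieve on which \<open>b\<close> lifts.\<close>

lemma sheaf_on_lifting_sieve:
  assumes f: "R.inverted (A, B, f)" and mono: "\<And>Y. Y \<in> Obj C \<Longrightarrow> inj_on (f Y) (At A Y)"
    and X: "X \<in> Obj C" and b: "b \<in> At B X" and Q: "Q \<in> E"
  shows "sheaf_on Q X {g \<in> into X. Act B g b \<in> f (Dom C g) ` At A (Dom C g)}" (is "sheaf_on Q X ?S")
proof -
  have A: "A \<in> presheaves C" and B: "B \<in> presheaves C" and fN: "f \<in> nat_trans C A B"
    using f by (auto simp: R.inverted_def)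
  have preA: "is_presheaf C A" and preB: "is_presheaf C B" using A B by auto
  have S: "is_sieve X ?S"
  proof -
    have "Act B (Comp C g h) b \<in> f (Dom C h) ` At A (Dom C h)"
      if "g \<in> Mor C" "Cod C g = X" "a \<in> At A (Dom C g)" "Act B g b = f (Dom C g) a"
        "h \<in> Mor C" "Cod C h = Dom C g" for g h a
    proof (rule image_eqI)
      show "Act A h a \<in> At A (Dom C h)" using that preA by simp
      have "Act B (Comp C g h) b = Act B h (Act B g b)"
        using Act_Act[OF preB that(5,1,6)] that(2) b by simp
      then show "Act B (Comp C g h) b = f (Dom C h) (Act A h a)"
        using nat_trans_natural[OF fN that(5), of a] that by simp
    qed
    then show ?thesis by (auto simp: is_sieve_def into_def)
  qed
  define \<phi> where "\<phi> g = inv_into (At A (Dom C g)) (f (Dom C g)) (Act B g b)" for g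
  have \<phi>: "\<phi> g \<in> At A (Dom C g)" "f (Dom C g) (\<phi> g) = Act B g b" if "g \<in> ?S" for g
    using that by (auto simp: \<phi>_def f_inv_into_f inv_into_into)
  have \<phi>_eqI: "a = \<phi> g" if "g \<in> ?S" "a \<in> At A (Dom C g)" "f (Dom C g) a = Act B g b" for a g
    using mono[of "Dom C g"] that \<phi>[OF that(1)] is_sieveD[OF S that(1)] by (auto simp: inj_on_def)
  have comp: "compatible A ?S \<phi>"
    unfolding compatible_def
  proof (intro conjI ballI impI)
    show "\<phi> g \<in> At A (Dom C g)" if "g \<in> ?S" for g using \<phi>(1)[OF that] .
    fix g h assume g: "g \<in> ?S" and h: "h \<in> Mor C" "Cod C h = Dom C g"
    note gD = is_sieveD[OF S g]
    have "Act A h (\<phi> g) = \<phi> (Comp C g h)"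
    proof (rule \<phi>_eqI)
      show "Comp C g h \<in> ?S" using gD(4) h by blast
      show "Act A h (\<phi> g) \<in> At A (Dom C (Comp C g h))" using \<phi>(1)[OF g] h gD preA by simp
      show "f (Dom C (Comp C g h)) (Act A h (\<phi> g)) = Act B (Comp C g h) b"
        using nat_trans_natural[OF fN h(1), of "\<phi> g"] \<phi>[OF g] h gD preB b by simp
    qed
    then show "\<phi> (Comp C g h) = Act A h (\<phi> g)" by simp
  qed
  let ?d = "down C (sieve_of ?S)"
  let ?p = "ext_trans C (sub_repr ?S) (\<lambda>Y u. \<phi> (?d Y u))"
  have "R.inverted (sub_repr ?S, repr X, incl X ?S)"
  proof (rule inverted_pointwise_pullback[OF f, where g = "point X B b" and p = ?p])
    show "(repr X, B, point X B b) \<in> Mor (psh_cat C)"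
      using point_in[OF X preB b] repr_in[OF X] B by simp
    show "(sub_repr ?S, A, ?p) \<in> Mor (psh_cat C)"
      using sub_repr_trans[OF X S preA comp] sub_repr_in[OF X S] A by simp
    show "(sub_repr ?S, repr X, incl X ?S) \<in> Mor (psh_cat C)"
      using incl_in[OF X S] sub_repr_in[OF X S] repr_in[OF X] by simp
  next
    fix Y u assume u: "Y \<in> Obj C" "u \<in> At (sub_repr ?S) Y"
    note d = sub_repr_down[OF X S u]
    show "f Y (?p Y u) = point X B b Y (incl X ?S Y u)"
      using point_incl[OF X S d(1), of B b] \<phi>(2)[OF d(1)] d(2,3) u by simp
  next
    fix Y a v assume Y: "Y \<in> Obj C" and a: "a \<in> At A Y" and v: "v \<in> At (repr X) Y"
      and eq: "f Y a = point X B b Y v"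
    define g where "g = down C (sieve_of (into X)) Y v"
    have g: "g \<in> Mor C" "Dom C g = Y" "Cod C g = X"
      using nat_trans_in[OF down_in[OF small_presheaf_into[OF X]], of Y v] v Y
      by (auto simp: repr_def At_sieve_of into_def g_def)
    have v_g: "v = up C (sieve_of (into X)) Y g"
      using up_down[OF small_presheaf_into[OF X], of Y v] v Y by (simp add: repr_def g_def)
    have "Act B g b = f Y a" using eq v Y by (simp add: point_def g_def)
    then have gS: "g \<in> ?S" using g a by (auto simp: into_def)
    have incl_up: "incl X ?S Y (up C (sieve_of ?S) Y h) = up C (sieve_of (into X)) Y h"
      if "h \<in> ?S" "Dom C h = Y" for h
      using sub_repr_up[OF X S that(1)] that(2) Y by (simp add: incl_def)
    show "\<exists>!u. u \<in> At (sub_repr ?S) Y \<and> ?p Y u = a \<and> incl X ?S Y u = v"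
    proof (rule ex1I)
      have "\<phi> g = a" using \<phi>_eqI[OF gS, of a] a g \<open>Act B g b = f Y a\<close> by simp
      then show "up C (sieve_of ?S) Y g \<in> At (sub_repr ?S) Y \<and>
        ?p Y (up C (sieve_of ?S) Y g) = a \<and> incl X ?S Y (up C (sieve_of ?S) Y g) = v"
        using sub_repr_up[OF X S gS] incl_up[OF gS] g Y v_g by simp
      fix u assume u: "u \<in> At (sub_repr ?S) Y \<and> ?p Y u = a \<and> incl X ?S Y u = v"
      note d = sub_repr_down[OF X S Y conjunct1[OF u]]
      note dD = is_sieveD[OF S d(1)]
      have "up C (sieve_of (into X)) Y (?d Y u) = v" using incl_up[OF d(1,2)] d(3) u by simp
      then have "g = ?d Y u"
        using down_up[OF small_presheaf_into[OF X] Y, of "?d Y u"] dD d(2) Y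
        by (simp add: g_def At_sieve_of into_def)
      then show "u = up C (sieve_of ?S) Y g" using d(3) by simp
    qed
  qed
  then show ?thesis by (rule sheaf_on_inverted_incl[OF X S _ Q])
qed

lemma universal_lifting_sieve:
  assumes f: "R.inverted (A, B, f)" and mono: "\<And>Y. Y \<in> Obj C \<Longrightarrow> inj_on (f Y) (At A Y)"
    and X: "X \<in> Obj C" and b: "b \<in> At B X" and Q: "Q \<in> E"
  shows "universal_sheaf_on Q X {g \<in> into X. Act B g b \<in> f (Dom C g) ` At A (Dom C g)}"
  unfolding universal_sheaf_on_def
proof (intro ballI impI)
  fix x assume x: "x \<in> Mor C" "Cod C x = X"
  have B: "is_presheaf C B" using f by (auto simp: R.inverted_def)
  have "pull x {g \<in> into X. Act B g b \<in> f (Dom C g) ` At A (Dom C g)} =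
      {g \<in> into (Dom C x). Act B g (Act B x b) \<in> f (Dom C g) ` At A (Dom C g)}"
    using x b B by (auto simp: pull_def into_def)
  then show "sheaf_on Q (Dom C x) (pull x {g \<in> into X. Act B g b \<in> f (Dom C g) ` At A (Dom C g)})"
    using sheaf_on_lifting_sieve[OF f mono _ _ Q, of "Dom C x" "Act B x b"] x b B by simp
qed

definition kernel_pair :: "('o, 'm, 'u) presheaf \<Rightarrow> ('o \<Rightarrow> 'u \<Rightarrow> 'u) \<Rightarrow> ('o, 'm, 'u \<times> 'u) presheaf" where
  "kernel_pair P h =
    \<lparr>At = (\<lambda>X \<in> Obj C. {(a, b). a \<in> At P X \<and> b \<in> At P X \<and> h X a = h X b}),
     Act = (\<lambda>f \<in> Mor C. \<lambda>(a, b) \<in> {(a, b). a \<in> At P (Cod C f) \<and> b \<in> At P (Cod C f) \<and>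
       h (Cod C f) a = h (Cod C f) b}. (Act P f a, Act P f b))\<rparr>"

definition image_presheaf ::
  "('o, 'm, 'u) presheaf \<Rightarrow> ('o, 'm, 'u) presheaf \<Rightarrow> ('o \<Rightarrow> 'u \<Rightarrow> 'u) \<Rightarrow> ('o, 'm, 'u) presheaf" where
  "image_presheaf P Q h =
    \<lparr>At = (\<lambda>X \<in> Obj C. h X ` At P X),
     Act = (\<lambda>f \<in> Mor C. \<lambda>u \<in> h (Cod C f) ` At P (Cod C f). Act Q f u)\<rparr>"

context
  fixes P Q h
  assumes h: "R.inverted (P, Q, h)"
begin

lemma PQ: "P \<in> presheaves C" "Q \<in> presheaves C" "h \<in> nat_trans C P Q"
  using h by (auto simp: R.inverted_def)

lemma small_presheaf_kernel_pair: "small_presheaf (kernel_pair P h)"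
  unfolding small_presheaf_def is_presheaf_def
proof (intro conjI ballI impI)
  have P: "is_presheaf C P" using PQ by simp
  show "Act (kernel_pair P h) \<in>
      (\<Pi>\<^sub>E f \<in> Mor C. At (kernel_pair P h) (Cod C f) \<rightarrow>\<^sub>E At (kernel_pair P h) (Dom C f))"
    using P nat_trans_natural[OF PQ(3)] by (auto simp: PiE_iff kernel_pair_def)
  show "Act (kernel_pair P h) (Id C X) s = s" if "X \<in> Obj C" "s \<in> At (kernel_pair P h) X" for X s
    using that P by (auto simp: kernel_pair_def)
  show "Act (kernel_pair P h) (Comp C g f) s = Act (kernel_pair P h) f (Act (kernel_pair P h) g s)"
    if "f \<in> Mor C" "g \<in> Mor C" "Cod C f = Dom C g" "s \<in> At (kernel_pair P h) (Cod C g)" for f g s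
    using that P nat_trans_natural[OF PQ(3) that(2)] by (auto simp: kernel_pair_def)
  fix X assume X: "X \<in> Obj C"
  have "small U (At P X)" using PQ(1) X by (auto simp: presheaves_iff small_presheaf_def)
  then have "small U (At P X \<times> At P X)" using universe by (intro small_Times)
  then show "small U (At (kernel_pair P h) X)"
    by (rule small_subset) (use X in \<open>auto simp: kernel_pair_def\<close>)
qed (simp add: kernel_pair_def)

text \<open>The second projection of the kernel pair is a pullback of \<open>h\<close> and has the diagonal as a section.
  So the diagonal is inverted, and the sieve on which a point \<open>(s, t)\<close> lifts to it is the sieve on
  which \<open>s\<close> and \<open>t\<close> agree.\<close>

lemma universal_equalizer_sieve:
  assumes X: "X \<in> Obj C" and s: "s \<in> At P X" and t: "t \<in> At P X" and eq: "h X s = h X t"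
    and Q': "Q' \<in> E"
  shows "universal_sheaf_on Q' X {g \<in> into X. Act P g s = Act P g t}"
proof -
  let ?K = "kernel_pair P h" and ?k = "shrink C (kernel_pair P h) :: ('o, 'm, 'u) presheaf"
  note K = small_presheaf_kernel_pair
  note preK = small_presheaf_is_presheaf[OF K] and kP = shrink_in_presheaves[OF K]
  have P: "is_presheaf C P" using PQ by simp
  have At_K: "At ?K Y = {(a, b). a \<in> At P Y \<and> b \<in> At P Y \<and> h Y a = h Y b}" if "Y \<in> Obj C" for Y
    using that by (simp add: kernel_pair_def)
  have Act_K: "Act ?K g (a, b) = (Act P g a, Act P g b)"
    if "g \<in> Mor C" "(a, b) \<in> At ?K (Cod C g)" for g a b
    using that by (simp add: kernel_pair_def)
  have down: "fst (down C ?K Y u) \<in> At P Y" "snd (down C ?K Y u) \<in> At P Y"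
    "h Y (fst (down C ?K Y u)) = h Y (snd (down C ?K Y u))" if "Y \<in> Obj C" "u \<in> At ?k Y" for Y u
  proof -
    obtain a b where ab: "down C ?K Y u = (a, b)" by fastforce
    have "(a, b) \<in> At ?K Y" using nat_trans_in[OF down_in[OF K] that] unfolding ab .
    then show "fst (down C ?K Y u) \<in> At P Y" "snd (down C ?K Y u) \<in> At P Y"
      "h Y (fst (down C ?K Y u)) = h Y (snd (down C ?K Y u))"
      unfolding At_K[OF that(1)] ab by auto
  qed
  have proj: "ext_trans C ?k (\<lambda>Y u. \<pi> (down C ?K Y u)) \<in> nat_trans C ?k P"
    if "\<pi> = fst \<or> \<pi> = snd" for \<pi> :: "'u \<times> 'u \<Rightarrow> 'u"
  proof (rule ext_trans_in)
    show "\<pi> (down C ?K Y u) \<in> At P Y" if "Y \<in> Obj C" "u \<in> At ?k Y" for Y u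
      using down[OF that] \<open>\<pi> = fst \<or> \<pi> = snd\<close> by auto
    fix g u assume g: "g \<in> Mor C" "u \<in> At ?k (Cod C g)"
    have "down C ?K (Dom C g) (Act ?k g u) = Act ?K g (down C ?K (Cod C g) u)"
      using nat_trans_natural[OF down_in[OF K] g] .
    moreover obtain a b where ab: "down C ?K (Cod C g) u = (a, b)" by fastforce
    ultimately have "down C ?K (Dom C g) (Act ?k g u) = (Act P g a, Act P g b)"
      using Act_K[OF g(1), of a b] nat_trans_in[OF down_in[OF K] _ g(2)] g(1) by simp
    then show "\<pi> (down C ?K (Dom C g) (Act ?k g u)) = Act P g (\<pi> (down C ?K (Cod C g) u))"
      using ab that by auto
  qed (use kP in simp)
  let ?p = "ext_trans C ?k (\<lambda>Y u. fst (down C ?K Y u))"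
  let ?q = "ext_trans C ?k (\<lambda>Y u. snd (down C ?K Y u))"
  have q: "R.inverted (?k, P, ?q)"
  proof (rule inverted_pointwise_pullback[OF h, where g = h and p = ?p])
    show "(?k, P, ?p) \<in> Mor (psh_cat C)" "(?k, P, ?q) \<in> Mor (psh_cat C)"
      using proj[of fst] proj[of snd] kP PQ by auto
    show "h Y (?p Y u) = h Y (?q Y u)" if "Y \<in> Obj C" "u \<in> At ?k Y" for Y u
      using down[OF that] that by simp
    fix Y a b assume Y: "Y \<in> Obj C" and ab: "a \<in> At P Y" "b \<in> At P Y" "h Y a = h Y b"
    then have abK: "(a, b) \<in> At ?K Y" using At_K by simp
    have upk: "up C ?K Y (a, b) \<in> At ?k Y" using nat_trans_in[OF up_in[OF K] Y abK] .
    show "\<exists>!u. u \<in> At ?k Y \<and> ?p Y u = a \<and> ?q Y u = b"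
    proof (rule ex1I)
      show "up C ?K Y (a, b) \<in> At ?k Y \<and> ?p Y (up C ?K Y (a, b)) = a \<and> ?q Y (up C ?K Y (a, b)) = b"
        using upk down_up[OF K Y abK] Y by simp
      fix u assume u: "u \<in> At ?k Y \<and> ?p Y u = a \<and> ?q Y u = b"
      then have "down C ?K Y u = (a, b)" using Y by (auto simp: prod_eq_iff)
      then show "u = up C ?K Y (a, b)" using up_down[OF K Y conjunct1[OF u]] by simp
    qed
  qed (use PQ in simp)
  let ?D = "ext_trans C P (\<lambda>Y a. up C ?K Y (a, a) :: 'u)"
  have aa: "(a, a) \<in> At ?K Y" if "Y \<in> Obj C" "a \<in> At P Y" for Y a using that At_K by simp
  have D: "?D \<in> nat_trans C P ?k"
  proof (rule ext_trans_in[OF _ _ P])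
    show "up C ?K Y (a, a) \<in> At ?k Y" if "Y \<in> Obj C" "a \<in> At P Y" for Y a
      using nat_trans_in[OF up_in[OF K] that(1) aa[OF that]] .
    fix g a assume g: "g \<in> Mor C" "a \<in> At P (Cod C g)"
    then have "(a, a) \<in> At ?K (Cod C g)" using aa by simp
    then show "up C ?K (Dom C g) (Act P g a, Act P g a) = Act ?k g (up C ?K (Cod C g) (a, a))"
      using Act_shrink[OF K g(1)] Act_K[OF g(1)] by simp
  qed
  have "ext_trans C P (\<lambda>Y a. ?q Y (?D Y a)) = ext_trans C P (\<lambda>Y a. a)"
  proof (rule ext_trans_cong)
    fix Y a assume Y: "Y \<in> Obj C" "a \<in> At P Y"
    then show "?q Y (?D Y a) = a"
      using nat_trans_in[OF D Y] down_up[OF K Y(1) aa[OF Y]] by simp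
  qed
  then have "R.inverted (Comp (psh_cat C) (?k, P, ?q) (P, ?k, ?D))"
    using R.inverted_Id[of P] PQ by simp
  then have inv: "R.inverted (P, ?k, ?D)"
    by (rule R.inverted_cancel_left[OF q, rotated -1]) (use D kP PQ in simp_all)
  have inj_up: "inj_on (up C ?K Y :: _ \<Rightarrow> 'u) (At ?K Y)" if "Y \<in> Obj C" for Y
    using up_bij[OF K that] by (rule bij_betw_imp_inj_on)
  have mono: "inj_on (?D Y) (At P Y)" if Y: "Y \<in> Obj C" for Y
  proof (rule inj_onI)
    fix a b assume ab: "a \<in> At P Y" "b \<in> At P Y" "?D Y a = ?D Y b"
    then have "up C ?K Y (a, a) = (up C ?K Y (b, b) :: 'u)" using Y by simp
    then have "(a, a) = (b, b)"
      by (rule inj_onD[OF inj_up[OF Y] _ aa[OF Y ab(1)] aa[OF Y ab(2)]])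
    then show "a = b" by simp
  qed
  have st: "(s, t) \<in> At ?K X" using s t eq X At_K by simp
  have stk: "up C ?K X (s, t) \<in> At ?k X" using nat_trans_in[OF up_in[OF K] X st] .
  have "Act ?k g (up C ?K X (s, t)) \<in> ?D (Dom C g) ` At P (Dom C g) \<longleftrightarrow> Act P g s = Act P g t"
    if g: "g \<in> Mor C" "Cod C g = X" for g
  proof -
    have 1: "Act ?k g (up C ?K X (s, t)) = up C ?K (Dom C g) (Act P g s, Act P g t)"
      using Act_shrink[OF K g(1), of "(s, t)"] Act_K[OF g(1), of s t] st g by simp
    have 2: "(Act P g s, Act P g t) \<in> At ?K (Dom C g)"
      using Act_in[OF preK g st] Act_K[OF g(1), of s t] st g by simp
    have 3: "up C ?K (Dom C g) (Act P g s, Act P g t) = ?D (Dom C g) a \<longleftrightarrow>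
        (Act P g s, Act P g t) = (a, a)" if "a \<in> At P (Dom C g)" for a
      using inj_on_eq_iff[OF inj_up 2 aa] that g by simp
    have 4: "Act P g s \<in> At P (Dom C g)" using P g s by simp
    show ?thesis
      unfolding 1
    proof
      assume "up C ?K (Dom C g) (Act P g s, Act P g t) \<in> ?D (Dom C g) ` At P (Dom C g)"
      then obtain a where "a \<in> At P (Dom C g)"
        "up C ?K (Dom C g) (Act P g s, Act P g t) = ?D (Dom C g) a" by blast
      then show "Act P g s = Act P g t" using 3[of a] by (metis prod.inject)
    next
      assume "Act P g s = Act P g t"
      then have "up C ?K (Dom C g) (Act P g s, Act P g t) = ?D (Dom C g) (Act P g s)"
        using 3[OF 4] by simp
      then show "up C ?K (Dom C g) (Act P g s, Act P g t) \<in> ?D (Dom C g) ` At P (Dom C g)"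
        using 4 by (rule image_eqI)
    qed
  qed
  then have "{g \<in> into X. Act ?k g (up C ?K X (s, t)) \<in> ?D (Dom C g) ` At P (Dom C g)} =
      {g \<in> into X. Act P g s = Act P g t}" unfolding into_def by blast
  then show ?thesis using universal_lifting_sieve[OF inv mono X stk Q'] by simp
qed

text \<open>Pulling \<open>h\<close> back along the inclusion of its image gives the corestriction of \<open>h\<close>.  Hence the
  corestriction, and with it the inclusion of the image, is inverted.\<close>

lemma universal_image_sieve:
  assumes X: "X \<in> Obj C" and b: "b \<in> At Q X" and Q': "Q' \<in> E"
  shows "universal_sheaf_on Q' X {g \<in> into X. Act Q g b \<in> h (Dom C g) ` At P (Dom C g)}"
proof -
  let ?I = "image_presheaf P Q h"
  have P: "is_presheaf C P" and Q: "is_presheaf C Q" using PQ by auto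
  have At_I: "At ?I Y = h Y ` At P Y" if "Y \<in> Obj C" for Y
    using that by (simp add: image_presheaf_def)
  have Act_h: "Act Q g (h (Cod C g) a) = h (Dom C g) (Act P g a)"
    if "g \<in> Mor C" "a \<in> At P (Cod C g)" for g a
    using nat_trans_natural[OF PQ(3) that] by simp
  have Act_I: "Act ?I g u = Act Q g u" if "g \<in> Mor C" "u \<in> At ?I (Cod C g)" for g u
    using that by (simp add: image_presheaf_def)
  have sub: "At ?I Y \<subseteq> At Q Y" if "Y \<in> Obj C" for Y
    using At_I[OF that] nat_trans_in[OF PQ(3) that] by auto
  have in_I: "Act Q g u \<in> At ?I (Dom C g)" if "g \<in> Mor C" "u \<in> At ?I (Cod C g)" for g u
    using that Act_h[OF that(1)] P by (auto simp: At_I)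
  have I: "?I \<in> presheaves C"
    unfolding presheaves_iff small_presheaf_def is_presheaf_def
  proof (intro conjI ballI impI)
    show "Act ?I \<in> (\<Pi>\<^sub>E f \<in> Mor C. At ?I (Cod C f) \<rightarrow>\<^sub>E At ?I (Dom C f))"
      using in_I Act_I by (auto simp: PiE_iff extensional_def) (auto simp: image_presheaf_def)
    show "Act ?I (Id C Y) u = u" if "Y \<in> Obj C" "u \<in> At ?I Y" for Y u
      using that Act_I[of "Id C Y" u] sub[OF that(1)] Q by auto
    show "Act ?I (Comp C g f) u = Act ?I f (Act ?I g u)"
      if "f \<in> Mor C" "g \<in> Mor C" "Cod C f = Dom C g" "u \<in> At ?I (Cod C g)" for f g u
    proof -
      have "u \<in> At Q (Cod C g)" using sub[of "Cod C g"] that(2,4) by auto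
      then show ?thesis
        using that Act_I[of g u] Act_I[of f "Act Q g u"] Act_I[of "Comp C g f" u] in_I[of g u] Q by simp
    qed
    fix Y assume Y: "Y \<in> Obj C"
    have "small U (At Q Y)" using PQ(2) Y by (auto simp: presheaves_iff small_presheaf_def)
    then show "small U (At ?I Y)" using sub[OF Y] by (rule small_subset)
  qed (simp add: image_presheaf_def)
  let ?m = "ext_trans C ?I (\<lambda>Y u. u)"
  have m: "?m \<in> nat_trans C ?I Q"
    by (rule ext_trans_in) (use sub Act_I I in auto)
  have hI: "h \<in> nat_trans C P ?I"
  proof -
    have "ext_trans C P h \<in> nat_trans C P ?I"
      by (rule ext_trans_in[OF _ _ P]) (use At_I Act_I Act_h in auto)
    then show ?thesis using ext_trans_nat_trans[OF PQ(3)] by simp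
  qed
  have e: "R.inverted (P, ?I, h)"
  proof (rule inverted_pointwise_pullback[OF h, where g = ?m and p = "ext_trans C P (\<lambda>Y a. a)"])
    show "(?I, Q, ?m) \<in> Mor (psh_cat C)" "(P, ?I, h) \<in> Mor (psh_cat C)"
      "(P, P, ext_trans C P (\<lambda>Y a. a)) \<in> Mor (psh_cat C)"
      using m hI I PQ id_trans_in[OF P] by auto
    show "h Y (ext_trans C P (\<lambda>Y a. a) Y u) = ?m Y (h Y u)" if "Y \<in> Obj C" "u \<in> At P Y" for Y u
      using that nat_trans_in[OF hI that] by simp
    fix Y a v assume Y: "Y \<in> Obj C" and a: "a \<in> At P Y" and "v \<in> At ?I Y" "h Y a = ?m Y v"
    then have v: "h Y a = v" by simp
    show "\<exists>!u. u \<in> At P Y \<and> ext_trans C P (\<lambda>Y a. a) Y u = a \<and> h Y u = v"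
    proof (rule ex1I[of _ a])
      show "a \<in> At P Y \<and> ext_trans C P (\<lambda>Y a. a) Y a = a \<and> h Y a = v" using Y a v by simp
      fix u assume "u \<in> At P Y \<and> ext_trans C P (\<lambda>Y a. a) Y u = a \<and> h Y u = v"
      then show "u = a" using ext_trans_apply[OF Y, of u P "\<lambda>Y a. a"] by metis
    qed
  qed
  have "ext_trans C P (\<lambda>Y a. ?m Y (h Y a)) = ext_trans C P h"
    using nat_trans_in[OF hI] by (intro ext_trans_cong) simp
  then have "Comp (psh_cat C) (?I, Q, ?m) (P, ?I, h) = (P, Q, h)"
    using ext_trans_nat_trans[OF PQ(3)] by simp
  then have "R.inverted (Comp (psh_cat C) (?I, Q, ?m) (P, ?I, h))" using h by simp
  then have inv: "R.inverted (?I, Q, ?m)"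
    by (rule R.inverted_cancel_right[OF e, rotated -1]) (use m I PQ in simp_all)
  have mono: "inj_on (?m Y) (At ?I Y)" if "Y \<in> Obj C" for Y
    using that by (auto simp: inj_on_def)
  have "?m (Dom C g) ` At ?I (Dom C g) = h (Dom C g) ` At P (Dom C g)" if "g \<in> into X" for g
    using that by (force simp: into_def At_I image_iff)
  then have "{g \<in> into X. Act Q g b \<in> ?m (Dom C g) ` At ?I (Dom C g)} =
      {g \<in> into X. Act Q g b \<in> h (Dom C g) ` At P (Dom C g)}" by blast
  then show ?thesis using universal_lifting_sieve[OF inv mono X b Q'] by simp
qed

end

text \<open>The unit at \<open>P\<close> is injective and surjective up to sieves that all objects of the subtopos treat as
  covering.  If \<open>P\<close> treats them so as well, then the unit is bijective.\<close>

lemma dual_sheaf_in: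
  assumes P: "P \<in> presheaves C"
    and dual: "\<And>X S. X \<in> Obj C \<Longrightarrow> is_sieve X S \<Longrightarrow> (\<And>Q. Q \<in> E \<Longrightarrow> universal_sheaf_on Q X S) \<Longrightarrow>
      universal_sheaf_on P X S"
  shows "P \<in> E"
proof -
  have PO: "P \<in> Obj (psh_cat C)" using P by simp
  define Q where "Q = FOb L P"
  obtain h where h: "\<eta> P = (P, Q, h)" "h \<in> nat_trans C P Q"
    using R.unit_Mor[OF PO] by (cases "\<eta> P") (auto simp: Q_def)
  have QE: "Q \<in> E" unfolding Q_def using R.L_Obj(1)[OF PO] .
  have QP: "Q \<in> presheaves C" using QE R.E_Obj by auto
  have preP: "is_presheaf C P" and preQ: "is_presheaf C Q" using P QP by auto
  have inv: "R.inverted (P, Q, h)" using R.inverted_unit[OF PO] h by simp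
  have inj: "s = t" if X: "X \<in> Obj C" and s: "s \<in> At P X" and t: "t \<in> At P X" and eq: "h X s = h X t"
    for X s t
  proof -
    let ?S = "{g \<in> into X. Act P g s = Act P g t}"
    have "Act P (Comp C g f) s = Act P (Comp C g f) t"
      if "g \<in> Mor C" "Cod C g = X" "Act P g s = Act P g t" "f \<in> Mor C" "Cod C f = Dom C g" for f g
      using Act_Act[OF preP that(4,1,5)] that s t by metis
    then have S: "is_sieve X ?S" by (auto simp: is_sieve_def into_def)
    have "universal_sheaf_on P X ?S"
      using dual[OF X S] universal_equalizer_sieve[OF inv X s t eq] by blast
    then have "sheaf_on P X ?S" using S X by (rule universal_sheaf_on_sheaf_on)
    then show ?thesis by (rule sheaf_on_sep[OF _ s t]) blast
  qed
  have surj: "b \<in> h X ` At P X" if X: "X \<in> Obj C" and b: "b \<in> At Q X" for X b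
  proof -
    let ?S = "{g \<in> into X. Act Q g b \<in> h (Dom C g) ` At P (Dom C g)}"
    have "Act Q (Comp C g f) b \<in> h (Dom C f) ` At P (Dom C f)"
      if "g \<in> Mor C" "Cod C g = X" "a \<in> At P (Dom C g)" "Act Q g b = h (Dom C g) a"
        "f \<in> Mor C" "Cod C f = Dom C g" for f g a
    proof (rule image_eqI)
      show "Act P f a \<in> At P (Dom C f)" using that preP by simp
      have "Act Q (Comp C g f) b = Act Q f (Act Q g b)"
        using Act_Act[OF preQ that(5,1,6)] that(2) b by simp
      then show "Act Q (Comp C g f) b = h (Dom C f) (Act P f a)"
        using nat_trans_natural[OF h(2) that(5), of a] that by simp
    qed
    then have S: "is_sieve X ?S" by (auto simp: is_sieve_def into_def)
    have uni: "universal_sheaf_on Q' X ?S" if "Q' \<in> E" for Q'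
      using universal_image_sieve[OF inv X b that] .
    have shP: "sheaf_on P X ?S" using dual[OF X S uni] S X by (rule universal_sheaf_on_sheaf_on)
    have shQ: "sheaf_on Q X ?S" using uni[OF QE] S X by (rule universal_sheaf_on_sheaf_on)
    note SD = is_sieveD[OF S]
    define \<phi> where "\<phi> g = inv_into (At P (Dom C g)) (h (Dom C g)) (Act Q g b)" for g
    have \<phi>: "\<phi> g \<in> At P (Dom C g)" "h (Dom C g) (\<phi> g) = Act Q g b" if "g \<in> ?S" for g
      using that by (auto simp: \<phi>_def f_inv_into_f inv_into_into)
    have \<phi>_comp: "\<phi> (Comp C g f) = Act P f (\<phi> g)"
      if g: "g \<in> ?S" and f: "f \<in> Mor C" "Cod C f = Dom C g" for g f
    proof (rule inj)
      have gf: "Comp C g f \<in> ?S" using SD(4)[OF g f] .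
      show "\<phi> (Comp C g f) \<in> At P (Dom C f)" using \<phi>(1)[OF gf] SD[OF g] f by simp
      show "Act P f (\<phi> g) \<in> At P (Dom C f)" using \<phi>(1)[OF g] f preP by simp
      have "h (Dom C f) (\<phi> (Comp C g f)) = Act Q (Comp C g f) b" using \<phi>(2)[OF gf] SD(1)[OF g] f by simp
      then show "h (Dom C f) (\<phi> (Comp C g f)) = h (Dom C f) (Act P f (\<phi> g))"
        using nat_trans_natural[OF h(2) f(1), of "\<phi> g"] \<phi>[OF g] SD(1,2)[OF g] f preQ b by simp
    qed (use f in simp)
    obtain a where a: "a \<in> At P X" "\<And>g. g \<in> ?S \<Longrightarrow> Act P g a = \<phi> g"
      using sheaf_on_glue[OF shP \<phi>(1) \<phi>_comp] by blast
    have "h X a = b"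
    proof (rule sheaf_on_sep[OF shQ _ b])
      show "h X a \<in> At Q X" using nat_trans_in[OF h(2) X a(1)] .
      fix g assume g: "g \<in> ?S"
      show "Act Q g (h X a) = Act Q g b"
        using nat_trans_natural[OF h(2) SD(1)[OF g], of a] a \<phi>(2)[OF g] g SD(2)[OF g] by simp
    qed
    then show ?thesis using a by blast
  qed
  have "bij_betw (h X) (At P X) (At Q X)" if X: "X \<in> Obj C" for X
    unfolding bij_betw_def using inj[OF X] surj[OF X] nat_trans_in[OF h(2) X]
    by (auto intro: inj_onI)
  then have "is_iso (psh_cat C) (\<eta> P)" using h P QP by (simp add: is_iso_psh_cat)
  then show ?thesis using R.unit_iso[OF PO] by simp
qed

end

lemma (in small_category) subtopos_dual_closed:
  assumes "subtopos C (E :: ('o, 'm, 'u) presheaf set)"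
  shows "F_R C (G_R C E) \<subseteq> E"
proof
  have E: "E \<subseteq> presheaves C" using assms by (simp add: subtopos_def)
  obtain L \<eta> where L: "adjunction (psh_cat C) (full_subcat (psh_cat C) E) L id_func \<eta>"
    "preserves_finite_limits (psh_cat C) (full_subcat (psh_cat C) E) L"
    "\<forall>P \<in> presheaves C. P \<in> E \<longleftrightarrow> is_iso (psh_cat C) (\<eta> P)"
    using assms unfolding subtopos_def by blast
  interpret lex_reflection C U E L \<eta>
    by (intro lex_reflection.intro reflection.intro reflection_axioms.intro
        lex_reflection_axioms.intro category_psh_cat small_category_axioms) (use E L in auto)
  interpret G: topology C "G_R C E" by unfold_locales (rule G_R_topology[OF E])
  fix P :: "('o, 'm, 'u) presheaf" assume "P \<in> F_R C (G_R C E)"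
  then have P: "P \<in> presheaves C" and sh: "G.is_sheaf P" by (auto simp: G.F_R_iff)
  show "P \<in> E"
  proof (rule dual_sheaf_in[OF P])
    fix X S assume "X \<in> Obj C" "is_sieve X S" "\<And>Q. Q \<in> E \<Longrightarrow> universal_sheaf_on Q X S"
    then have "G.covers X S" by (simp add: G.covers_def G_R_iff[OF E])
    then show "universal_sheaf_on P X S" using G.is_sheaf_universal[OF sh] by blast
  qed
qed

section \<open>The duality\<close>

lemma F_R_presheaves: "F_R C J \<subseteq> presheaves C"
  by (auto simp: F_R_def)

lemma F_R_antimono: "J \<subseteq> J' \<Longrightarrow> F_R C J' \<subseteq> F_R C J"
  by (auto simp: F_R_def)

lemma G_R_antimono: "I \<subseteq> I' \<Longrightarrow> G_R C I' \<subseteq> G_R C I"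
  by (auto simp: G_R_def)

lemma G_R_F_R_superset: "J \<subseteq> sieves C \<Longrightarrow> J \<subseteq> G_R C (F_R C J)"
  by (auto simp: F_R_def G_R_def)

lemma F_R_G_R_superset: "I \<subseteq> presheaves C \<Longrightarrow> I \<subseteq> F_R C (G_R C I)"
  by (auto simp: F_R_def G_R_def)

lemma F_R_G_R_F_R:
  assumes "J \<subseteq> sieves C"
  shows "F_R C (G_R C (F_R C J :: ('o, 'm, 'u) presheaf set)) = (F_R C J :: ('o, 'm, 'u) presheaf set)"
proof
  show "F_R C (G_R C (F_R C J :: ('o, 'm, 'u) presheaf set)) \<subseteq> (F_R C J :: ('o, 'm, 'u) presheaf set)"
    by (rule F_R_antimono[OF G_R_F_R_superset[OF assms]])
qed (rule F_R_G_R_superset[OF F_R_presheaves])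

lemma G_R_F_R_G_R:
  fixes I :: "('o, 'm, 'u) presheaf set"
  assumes "I \<subseteq> presheaves C"
  shows "G_R C (F_R C (G_R C I) :: ('o, 'm, 'u) presheaf set) = G_R C I"
proof
  show "G_R C (F_R C (G_R C I) :: ('o, 'm, 'u) presheaf set) \<subseteq> G_R C I"
    by (rule G_R_antimono[OF F_R_G_R_superset[OF assms]])
  have "G_R C I \<subseteq> sieves C" by (auto simp: G_R_def)
  then show "G_R C I \<subseteq> G_R C (F_R C (G_R C I) :: ('o, 'm, 'u) presheaf set)"
    by (rule G_R_F_R_superset)
qed

context small_category
begin

lemma smallest_topology_dual:
  assumes J: "J \<subseteq> sieves C"
  shows "smallest_topology C J (G_R C (F_R C J :: ('o, 'm, 'u) presheaf set))"
  unfolding smallest_topology_def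
proof (intro conjI allI impI)
  show "grothendieck_topology C (G_R C (F_R C J :: ('o, 'm, 'u) presheaf set))"
    by (rule G_R_topology[OF F_R_presheaves])
  show "J \<subseteq> G_R C (F_R C J :: ('o, 'm, 'u) presheaf set)" by (rule G_R_F_R_superset[OF J])
  fix J' assume J': "grothendieck_topology C J' \<and> J \<subseteq> J'"
  interpret small_topology C J' U
    by (intro small_topology.intro topology.intro topology_axioms.intro category_axioms
        small_category_axioms) (use J' in simp)
  show "G_R C (F_R C J :: ('o, 'm, 'u) presheaf set) \<subseteq> J'"
  proof
    fix t assume t: "t \<in> G_R C (F_R C J :: ('o, 'm, 'u) presheaf set)"
    then have "t \<in> sieves C" by (simp add: G_R_def)
    then obtain X S where X: "X \<in> Obj C" and S: "is_sieve X S" and tS: "t = (X, sieve_of S)"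
      by (cases t) (auto elim: sievesE)
    have "covers X S"
    proof (rule covers_if_sheaves_separated[OF S X])
      fix P :: "('o, 'm, 'u) presheaf" assume "P \<in> presheaves C" "is_sheaf P"
      then have "P \<in> F_R C J'" by (simp add: F_R_iff)
      then have "P \<in> F_R C J" using F_R_antimono J' by blast
      then have "universal_sheaf_on P X S"
        using t tS G_R_iff[OF F_R_presheaves X S] by blast
      then have "sheaf_on P X S" using S X by (rule universal_sheaf_on_sheaf_on)
      then show "separated_on P X S" by (simp add: sheaf_on_def)
    qed
    then show "t \<in> J'" using tS by (simp add: covers_def)
  qed
qed

lemma F_R_topology:
  assumes "grothendieck_topology C J"
  shows "F_R C J = (sheaves C J :: ('o, 'm, 'u) presheaf set)"
proof -
  interpret topology C J by unfold_locales (fact assms)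
  show ?thesis by (auto simp: F_R_iff sheaves_iff)
qed

lemma smallest_subtopos_dual:
  assumes I: "I \<subseteq> (presheaves C :: ('o, 'm, 'u) presheaf set)"
  shows "smallest_subtopos C I (F_R C (G_R C I))"
  unfolding smallest_subtopos_def
proof (intro conjI allI impI)
  have J: "grothendieck_topology C (G_R C I)" by (rule G_R_topology[OF I])
  interpret small_topology C "G_R C I" U
    by (intro small_topology.intro topology.intro topology_axioms.intro category_axioms
        small_category_axioms J)
  show "subtopos C (F_R C (G_R C I) :: ('o, 'm, 'u) presheaf set)"
    using subtopos_sheaves F_R_topology[OF J] by simp
  show "I \<subseteq> F_R C (G_R C I)" by (rule F_R_G_R_superset[OF I])
  fix E' :: "('o, 'm, 'u) presheaf set" assume E': "subtopos C E' \<and> I \<subseteq> E'"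
  then have "F_R C (G_R C I) \<subseteq> F_R C (G_R C E')" by (intro F_R_antimono G_R_antimono) simp
  also have "\<dots> \<subseteq> E'" using E' by (intro subtopos_dual_closed) simp
  finally show "F_R C (G_R C I) \<subseteq> E'" .
qed

end

theorem mainTheorem5:
  fixes C :: "('o, 'm) cat"
  assumes "set_universe TYPE('u)"
    and "category C"
    and "essentially_small TYPE('u) C"
  shows "(\<forall>J \<subseteq> sieves C.
        let FJ = (F_R C J :: ('o, 'm, 'u) presheaf set); Jbar = G_R C FJ in
          smallest_topology C J Jbar \<and>
          FJ = F_R C Jbar \<and>
          FJ = sheaves C Jbar) \<and>
     (\<forall>I \<subseteq> (presheaves C :: ('o, 'm, 'u) presheaf set).
        let GI = G_R C I; Ibar = (F_R C GI :: ('o, 'm, 'u) presheaf set) in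
          smallest_subtopos C I Ibar \<and>
          grothendieck_topology C GI \<and>
          Ibar = sheaves C GI \<and>
          GI = G_R C Ibar)"
proof -
  interpret small_category C "TYPE('u)"
    using assms by (rule essentially_small_category)
  show ?thesis
    unfolding Let_def
  proof (intro conjI allI impI)
    fix J assume J: "J \<subseteq> sieves C"
    show "smallest_topology C J (G_R C (F_R C J :: ('o, 'm, 'u) presheaf set))"
      by (rule smallest_topology_dual[OF J])
    show eq: "(F_R C J :: ('o, 'm, 'u) presheaf set) = F_R C (G_R C (F_R C J :: ('o, 'm, 'u) presheaf set))"
      by (rule F_R_G_R_F_R[OF J, symmetric])
    show "(F_R C J :: ('o, 'm, 'u) presheaf set) = sheaves C (G_R C (F_R C J :: ('o, 'm, 'u) presheaf set))"
      by (rule trans[OF eq F_R_topology[OF G_R_topology[OF F_R_presheaves]]])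
  next
    fix I :: "('o, 'm, 'u) presheaf set" assume I: "I \<subseteq> presheaves C"
    show "smallest_subtopos C I (F_R C (G_R C I))" by (rule smallest_subtopos_dual[OF I])
    show "grothendieck_topology C (G_R C I)" by (rule G_R_topology[OF I])
    then show "F_R C (G_R C I) = (sheaves C (G_R C I) :: ('o, 'm, 'u) presheaf set)"
      by (rule F_R_topology)
    show "G_R C I = G_R C (F_R C (G_R C I) :: ('o, 'm, 'u) presheaf set)"
      by (rule G_R_F_R_G_R[OF I, symmetric])
  qed
qed

end
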